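(* Let $(X,d)$ be a geodesic PT (ptolemaic) metric space which is homeomorphic to $\mathbb{R}\times[0,1]$, and suppose that the two boundary curves (the subsets of $X$ corresponding to $\mathbb{R}\times\{0\}$ and $\mathbb{R}\times\{1\}$) are the images of two parallel geodesic lines $c_0,c_1:\mathbb{R}\to X$. Then $X$ is isometric to a flat strip $\mathbb{R}\times[0,a]\subset\mathbb{R}^2$, for some $a>0$, equipped with the euclidean metric.
   Context: Write $|xy|=d(x,y)$. A metric space $(X,d)$ is a PT (ptolemaic) space if $|xy|\,|zw|\le |xz|\,|yw|+|xw|\,|yz|$ for all $x,y,z,w\in X$. It is geodesic if every two points $x,y$ can be joined by a geodesic, i.e. there is a map $c:I\to X$ on a compact interval $I$ from $x$ to $y$ with $|c(t)c(s)|=\lambda|t-s|$ for all $s,t\in I$ and some constant $\lambda\ge 0$. A (unit speed) geodesic line is a map $c:\mathbb{R}\to X$ with $|c(t)c(s)|=|t-s|$ for all $s,t\in\mathbb{R}$. Two geodesic lines $c_0,c_1$ are parallel if $\lim_{t\to\infty}\frac1t|c_0(t)c_1(t)|=\lim_{t\to-\infty}\frac1t|c_0(t)c_1(t)|=0$. *)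

theory Defs
  imports "HOL-Analysis.Analysis"
begin

definition ptolemaic :: "'a::metric_space set \<Rightarrow> bool" where
  "ptolemaic X \<longleftrightarrow> (\<forall>x\<in>X. \<forall>y\<in>X. \<forall>z\<in>X. \<forall>w\<in>X.
     dist x y * dist z w \<le> dist x z * dist y w + dist x w * dist y z)"

(* Geodesics run at constant, not necessarily unit, speed l; a \<le> b allows degenerate intervals. *)
definition joined_by_geodesic :: "'a::metric_space set \<Rightarrow> 'a \<Rightarrow> 'a \<Rightarrow> bool" where
  "joined_by_geodesic X x y \<longleftrightarrow>
     (\<exists>(a::real) b (c::real \<Rightarrow> 'a) (l::real).
        a \<le> b \<and> l \<ge> 0 \<and> c \<in> {a..b} \<rightarrow> X \<and> c a = x \<and> c b = y \<and>
        (\<forall>s\<in>{a..b}. \<forall>t\<in>{a..b}. dist (c t) (c s) = l * \<bar>t - s\<bar>))"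

definition geodesic_space :: "'a::metric_space set \<Rightarrow> bool" where
  "geodesic_space X \<longleftrightarrow> (\<forall>x\<in>X. \<forall>y\<in>X. joined_by_geodesic X x y)"

definition geodesic_line :: "'a::metric_space set \<Rightarrow> (real \<Rightarrow> 'a) \<Rightarrow> bool" where
  "geodesic_line X c \<longleftrightarrow> range c \<subseteq> X \<and> (\<forall>s t. dist (c t) (c s) = \<bar>t - s\<bar>)"

definition parallel_lines :: "(real \<Rightarrow> 'a::metric_space) \<Rightarrow> (real \<Rightarrow> 'a) \<Rightarrow> bool" where
  "parallel_lines c0 c1 \<longleftrightarrow>
     ((\<lambda>t. 1 / t * dist (c0 t) (c1 t)) \<longlongrightarrow> 0) at_top \<and>
     ((\<lambda>t. 1 / t * dist (c0 t) (c1 t)) \<longlongrightarrow> 0) at_bot"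

definition isometric :: "'a::metric_space set \<Rightarrow> 'b::metric_space set \<Rightarrow> bool" where
  "isometric X Y \<longleftrightarrow>
     (\<exists>f. bij_betw f X Y \<and> (\<forall>x\<in>X. \<forall>y\<in>X. dist (f x) (f y) = dist x y))"

(* The metric of the product type real \<times> real is the euclidean one (see dist_prod_def). *)
definition flat_strip :: "real \<Rightarrow> (real \<times> real) set" where
  "flat_strip a = UNIV \<times> {0..a}"

end

theory Submission
  imports Defs "HOL-Real_Asymp.Real_Asymp"
begin

text \<open>
  Let \<open>Z\<close> be the set where the two Busemann functions of \<open>c0\<close> add up to zero. It contains both lines
  and every geodesic between its points, and the height \<open>\<beta>\<close> (a Busemann function) is affine on it.
  A path \<open>c0 (- T) \<rightarrow> z \<rightarrow> c0 T\<close> of increasing height has to cross the geodesic from \<open>c0 t\<close> to \<open>c1 t\<close>,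
  so the level sets of \<open>\<beta>\<close> in \<open>Z\<close> are segments. In a blow-up at an interior point of \<open>Z\<close> these
  segments become parallel lines, whose Busemann function is a second affine function: the blow-up
  is a normed plane, and being ptolemaic it is Euclidean (Day, Schoenberg). Hence geodesics with
  \<open>\<beta>\<close> of unit speed meet the level sets at right angles, which by first variation makes their mutual
  distances constant, and a comparison of Dini derivatives followed by the Ptolemy inequality for kites
  turns \<open>Z\<close> into a flat strip. Invariance of domain gives \<open>Z = X\<close>.
\<close>


section \<open>Functions of a real variable\<close>

text \<open>Ptolemy's inequality acts mostly through one consequence: along a geodesic the distance
  to a fixed point is convex. So Busemann functions are convex, and where two of them cancel both
  are affine. Angles and derivatives of distances are not given beforehand. The levels of
  \<open>Z\<close> are segments whose lengths might vary, so \<open>Z\<close> itself offers only one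
  affine function; only in a blow-up do levels become full lines with Busemann functions of their
  own. A quantitative estimate excludes this: near a boundary line, a drop by \<open>\<eta>\<close>
  takes a time of order at least the square root of \<open>\<eta>\<close>, so cutting a fixed drop
  into \<open>n\<close> pieces would take a time of order at least the square root of
  \<open>n\<close>.\<close>

lemma interval_induct:
  fixes a b :: real
  assumes "a \<le> b" "P a"
    and step: "\<And>t. a \<le> t \<Longrightarrow> t < b \<Longrightarrow> P t \<Longrightarrow> \<exists>\<delta>>0. \<forall>s. t < s \<longrightarrow> s < t + \<delta> \<longrightarrow> s \<le> b \<longrightarrow> P s"
    and limit: "\<And>t. a < t \<Longrightarrow> t \<le> b \<Longrightarrow> (\<And>s. a \<le> s \<Longrightarrow> s < t \<Longrightarrow> P s) \<Longrightarrow> P t"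
  shows "P b"
proof -
  \<comment> \<open>Membership asks for \<open>P\<close> on the whole initial interval, so
    \<open>limit\<close> applies at the supremum and \<open>step\<close> carries beyond it unless it
    is \<open>b\<close>.\<close>
  define S where "S = {t \<in> {a..b}. \<forall>s\<in>{a..t}. P s}"
  have aS: "a \<in> S" using assms(1,2) by (auto simp: S_def)
  have bdd: "bdd_above S" by (auto simp: S_def intro!: bdd_aboveI[of _ b])
  define T where "T = Sup S"
  have T: "a \<le> T" "T \<le> b"
    using aS bdd by (auto simp: T_def S_def intro!: cSup_upper cSup_least)
  have below: "P s" if "a \<le> s" "s < T" for s
  proof -
    note s = that
    obtain t where "t \<in> S" "s < t" using less_cSupD[of S s] s(2) aS unfolding T_def by auto
    with s show ?thesis by (auto simp: S_def)
  qed
  have "P T" using limit[of T] below T assms(2) by (cases "a = T") auto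
  have "T = b"
  proof (rule ccontr)
    assume "T \<noteq> b"
    then obtain \<delta> where \<delta>: "\<delta> > 0" "\<And>s. T < s \<Longrightarrow> s < T + \<delta> \<Longrightarrow> s \<le> b \<Longrightarrow> P s"
      using step[of T] T \<open>P T\<close> by auto
    define t where "t = min b (T + \<delta> / 2)"
    have t: "T < t" "t \<le> b" "t < T + \<delta>" using T \<open>T \<noteq> b\<close> \<delta>(1) by (auto simp: t_def)
    have "t \<in> S" using below \<open>P T\<close> \<delta>(2) t T by (auto simp: S_def) (metis linorder_neqE_linordered_idom order_le_less_trans order_trans)
    then have "t \<le> T" unfolding T_def using bdd by (intro cSup_upper)
    with t(1) show False by simp
  qed
  with \<open>P T\<close> show ?thesis by simp
qed

text \<open>First variation bounds distances only from above and only to one side, hence the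
  hypothesis on right increments. Such a function cannot rise above a line of slope
  \<open>\<epsilon>\<close>, and \<open>\<epsilon>\<close> is arbitrary.\<close>

lemma dini_nonincreasing:
  fixes \<phi> :: "real \<Rightarrow> real"
  assumes "a \<le> b" and cont: "continuous_on {a..b} \<phi>"
    and dini: "\<And>t \<epsilon>. a \<le> t \<Longrightarrow> t < b \<Longrightarrow> \<epsilon> > 0 \<Longrightarrow>
      \<forall>\<^sub>F l in at_right 0. \<phi> (t + l) \<le> \<phi> t + \<epsilon> * l"
  shows "\<phi> b \<le> \<phi> a"
proof (rule field_le_epsilon)
  fix e :: real assume "e > 0"
  \<comment> \<open>The summand 1 covers the degenerate interval \<open>a = b\<close>.\<close>
  define \<epsilon> where "\<epsilon> = e / (b - a + 1)"
  have \<epsilon>: "\<epsilon> > 0" using \<open>e > 0\<close> \<open>a \<le> b\<close> by (simp add: \<epsilon>_def)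
  have "\<phi> b - \<epsilon> * (b - a) \<le> \<phi> a"
  proof (rule interval_induct[where P = "\<lambda>t. \<phi> t - \<epsilon> * (t - a) \<le> \<phi> a"])
    fix t assume t: "a \<le> t" "t < b" "\<phi> t - \<epsilon> * (t - a) \<le> \<phi> a"
    from dini[OF t(1,2) \<epsilon>] obtain d where d: "d > 0" "\<And>l. 0 < l \<Longrightarrow> l < d \<Longrightarrow> \<phi> (t + l) \<le> \<phi> t + \<epsilon> * l"
      unfolding eventually_at_right_field by auto
    have "\<phi> s - \<epsilon> * (s - a) \<le> \<phi> a" if "t < s" "s < t + d" for s
      using d(2)[of "s - t"] t(3) that by (simp add: algebra_simps)
    then show "\<exists>d>0. \<forall>s. t < s \<longrightarrow> s < t + d \<longrightarrow> s \<le> b \<longrightarrow> \<phi> s - \<epsilon> * (s - a) \<le> \<phi> a"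
      using d(1) by blast
  next
    fix t assume t: "a < t" "t \<le> b" "\<And>s. a \<le> s \<Longrightarrow> s < t \<Longrightarrow> \<phi> s - \<epsilon> * (s - a) \<le> \<phi> a"
    have closure: "closure {a..<t} = {a..t}" using t(1) by (rule closure_atLeastLessThan)
    have "continuous_on {a..t} \<phi>" using cont t(2) by (auto intro: continuous_on_subset)
    then have "continuous_on (closure {a..<t}) (\<lambda>s. \<phi> s - \<epsilon> * (s - a))"
      unfolding closure by (intro continuous_intros)
    then show "\<phi> t - \<epsilon> * (t - a) \<le> \<phi> a"
      by (rule continuous_le_on_closure) (use t closure in auto)
  qed (use \<open>a \<le> b\<close> in auto)
  moreover have "\<epsilon> * (b - a) \<le> e" using \<open>e > 0\<close> \<open>a \<le> b\<close> by (simp add: \<epsilon>_def divide_simps mult_left_mono)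
  ultimately show "\<phi> b \<le> \<phi> a + e" by simp
qed

text \<open>Midpoint convexity doubles increments: a rise by \<open>D\<close> over length
  \<open>h\<close> becomes a rise by at least \<open>2 ^ k * D\<close> over
  \<open>2 ^ k * h\<close>, which is growth of slope \<open>D / h\<close> and contradicts the
  sublinear bound. So there is no rise, and monotonicity excludes a fall.\<close>

lemma midpoint_convex_sublinear_const:
  fixes \<psi> :: "real \<Rightarrow> real"
  assumes mid: "\<And>s t. 2 * \<psi> ((s + t) / 2) \<le> \<psi> s + \<psi> t"
    and mono: "\<And>s t. s \<le> t \<Longrightarrow> \<psi> s \<le> \<psi> t"
    and sub: "\<And>n::nat. \<psi> (real n) \<le> \<eta> n" and lim: "(\<lambda>n. \<eta> n / real n) \<longlonglongrightarrow> 0"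
  shows "\<psi> s = \<psi> t"
proof -
  have pow: "filterlim (\<lambda>k::nat. 2 ^ k :: real) at_top sequentially" by real_asymp
  have double: "\<psi> t + 2 ^ k * (\<psi> (t + h) - \<psi> t) \<le> \<psi> (t + 2 ^ k * h)" for t h k
  proof (induction k)
    case (Suc k)
    have "2 * \<psi> ((t + (t + 2 ^ Suc k * h)) / 2) \<le> \<psi> t + \<psi> (t + 2 ^ Suc k * h)" by (rule mid)
    moreover have "(t + (t + 2 ^ Suc k * h)) / 2 = t + 2 ^ k * h" by simp
    ultimately have "2 * \<psi> (t + 2 ^ k * h) \<le> \<psi> t + \<psi> (t + 2 ^ Suc k * h)" by metis
    then show ?case using Suc by (simp add: algebra_simps)
  qed auto
  have le: "\<psi> (t + h) \<le> \<psi> t" if "h > 0" for t h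
  proof (rule ccontr)
    assume "\<not> \<psi> (t + h) \<le> \<psi> t"
    define D where "D = \<psi> (t + h) - \<psi> t"
    have "D > 0" using \<open>\<not> _\<close> by (simp add: D_def)
    \<comment> \<open>The bound holds at naturals only; rounding up is harmless because
      \<open>\<psi>\<close> is nondecreasing.\<close>
    define N where "N k = nat \<lceil>\<bar>t\<bar> + 2 ^ k * h\<rceil>" for k :: nat
    have N1: "t + 2 ^ k * h \<le> real (N k)" and N2: "real (N k) \<le> \<bar>t\<bar> + 2 ^ k * h + 1" for k
    proof -
      have "0 \<le> \<bar>t\<bar> + 2 ^ k * h" using \<open>h > 0\<close> by simp
      then show "t + 2 ^ k * h \<le> real (N k)" "real (N k) \<le> \<bar>t\<bar> + 2 ^ k * h + 1"
        unfolding N_def by linarith+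
    qed
    have "filterlim (\<lambda>k::nat. 2 ^ k * h) at_top sequentially"
      by (rule filterlim_at_top_mult_tendsto_pos[OF tendsto_const \<open>h > 0\<close>]) (rule pow)
    then have "filterlim (\<lambda>k::nat. t + 2 ^ k * h) at_top sequentially"
      by (rule filterlim_tendsto_add_at_top[OF tendsto_const])
    then have "filterlim (\<lambda>k. real (N k)) at_top sequentially"
      by (rule filterlim_at_top_mono) (use N1 in auto)
    then have Ninf: "filterlim N at_top sequentially"
      by (simp add: filterlim_sequentially_iff_filterlim_real)
    have "(\<lambda>k. \<eta> (N k) / real (N k)) \<longlonglongrightarrow> 0"
      using filterlim_compose[OF lim Ninf] by simp
    moreover have "(\<lambda>k. (\<psi> t + 2 ^ k * D) / (\<bar>t\<bar> + 2 ^ k * h + 1)) \<longlonglongrightarrow> D / h"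
    proof -
      have p: "(\<lambda>k. (1 / 2 :: real) ^ k) \<longlonglongrightarrow> 0" by (rule LIMSEQ_power_zero) simp
      have "(\<lambda>k. (\<psi> t * (1/2) ^ k + D) / ((\<bar>t\<bar> + 1) * (1/2) ^ k + h)) \<longlonglongrightarrow> (\<psi> t * 0 + D) / ((\<bar>t\<bar> + 1) * 0 + h)"
        using \<open>h > 0\<close> by (intro tendsto_intros p) simp
      moreover have "(\<psi> t * (1/2) ^ k + D) / ((\<bar>t\<bar> + 1) * (1/2) ^ k + h)
          = (\<psi> t + 2 ^ k * D) / (\<bar>t\<bar> + 2 ^ k * h + 1)" for k
      proof -
        have "\<psi> t + 2 ^ k * D = 2 ^ k * (\<psi> t * (1/2) ^ k + D)"
          "\<bar>t\<bar> + 2 ^ k * h + 1 = 2 ^ k * ((\<bar>t\<bar> + 1) * (1/2) ^ k + h)"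
          by (simp_all add: field_simps power_one_over)
        then show ?thesis by simp
      qed
      ultimately show ?thesis by simp
    qed
    moreover have "\<forall>\<^sub>F k in sequentially. (\<psi> t + 2 ^ k * D) / (\<bar>t\<bar> + 2 ^ k * h + 1) \<le> \<eta> (N k) / real (N k)"
    proof -
      have "filterlim (\<lambda>k::nat. \<psi> t + 2 ^ k * D) at_top sequentially"
        by (intro filterlim_tendsto_add_at_top[OF tendsto_const]
          filterlim_at_top_mult_tendsto_pos[OF tendsto_const \<open>D > 0\<close>] pow)
      then have "\<forall>\<^sub>F k in sequentially. \<psi> t + 2 ^ k * D \<ge> 0"
        by (simp add: filterlim_at_top)
      moreover have "\<forall>\<^sub>F k in sequentially. N k \<ge> 1" using Ninf by (simp add: filterlim_at_top)
      ultimately show ?thesis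
      proof eventually_elim
        case (elim k)
        have "\<psi> t + 2 ^ k * D \<le> \<psi> (t + 2 ^ k * h)" using double[where t=t and h=h and k=k] by (simp add: D_def)
        also have "\<dots> \<le> \<psi> (real (N k))" by (rule mono) (rule N1)
        also have "\<dots> \<le> \<eta> (N k)" by (rule sub)
        finally have *: "\<psi> t + 2 ^ k * D \<le> \<eta> (N k)" .
        have "(\<psi> t + 2 ^ k * D) / (\<bar>t\<bar> + 2 ^ k * h + 1) \<le> (\<psi> t + 2 ^ k * D) / real (N k)"
          using elim N2[of k] by (intro divide_left_mono mult_pos_pos) auto
        also have "\<dots> \<le> \<eta> (N k) / real (N k)" using * by (simp add: divide_right_mono)
        finally show ?case .
      qed
    qed
    ultimately have "D / h \<le> 0" by (rule tendsto_le[OF trivial_limit_sequentially])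
    with \<open>D > 0\<close> \<open>h > 0\<close> show False by (simp add: divide_le_0_iff)
  qed
  have "\<psi> s = \<psi> t" if "s < t" for s t
    using le[of "t - s" s] mono[of s t] that by simp
  then show ?thesis by (metis linorder_neqE_linordered_idom)
qed

section \<open>Busemann functions of parallel lines\<close>

text \<open>This is the existence of Busemann functions. A unit step changes \<open>f\<close> by at
  most 1, so the shifted values decrease; the triangle inequality with the point of parameter 0
  bounds them below.\<close>

lemma decreasing_shift_convergent:
  fixes f :: "real \<Rightarrow> real"
  assumes "\<And>s t. \<bar>f s - f t\<bar> \<le> \<bar>s - t\<bar>" and "\<And>s t. f s + f t \<ge> \<bar>s - t\<bar>"
  shows "\<exists>L. (\<lambda>n. f (real n) - real n) \<longlonglongrightarrow> L \<and> (\<forall>n. L \<le> f (real n) - real n)"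
proof -
  have dec: "decseq (\<lambda>n. f (real n) - real n)"
  proof (rule decseq_SucI)
    fix n show "f (real (Suc n)) - real (Suc n) \<le> f (real n) - real n"
      using assms(1)[of "real (Suc n)" "real n"] by simp
  qed
  have "\<forall>n. - f 0 \<le> f (real n) - real n"
  proof
    fix n show "- f 0 \<le> f (real n) - real n" using assms(2)[of "real n" 0] by simp
  qed
  from decseq_convergent[OF dec this] show ?thesis by blast
qed

text \<open>Applied to \<open>f t s = dist (c0 t) (c1 s)\<close>: the Busemann functions of either line are affine along
  the other one, and those of the two ends cancel. The product estimate for \<open>f 0 n * f n 0\<close>
  fixes the additive constants.\<close>

locale parallel_pair =
  fixes f :: "real \<Rightarrow> real \<Rightarrow> real"
  assumes lip1: "\<bar>f t s - f t' s\<bar> \<le> \<bar>t - t'\<bar>" and lip2: "\<bar>f t s - f t s'\<bar> \<le> \<bar>s - s'\<bar>"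
    and sum1: "f t s + f t' s \<ge> \<bar>t - t'\<bar>" and sum2: "f t s + f t s' \<ge> \<bar>s - s'\<bar>"
    and mid1: "2 * f ((t + t') / 2) s \<le> f t s + f t' s"
    and mid2: "2 * f t ((s + s') / 2) \<le> f t s + f t s'"
    and ptol: "f t s' * f t' s \<le> \<bar>t - t'\<bar> * \<bar>s - s'\<bar> + f t s * f t' s'"
    and sublin1: "(\<lambda>n. f (real n) (real n) / real n) \<longlonglongrightarrow> 0"
    and sublin2: "(\<lambda>n. f (- real n) (- real n) / real n) \<longlonglongrightarrow> 0"
begin

lemma transpose: "parallel_pair (\<lambda>t s. f s t)"
proof unfold_locales
  fix t s t' s'
  show "f s' t * f s t' \<le> \<bar>t - t'\<bar> * \<bar>s - s'\<bar> + f s t * f s' t'"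
    using ptol[of s' t s t'] by (simp add: mult.commute abs_minus_commute)
qed (fact lip1 lip2 sum1 sum2 mid1 mid2 sublin1 sublin2)+

lemma reverse: "parallel_pair (\<lambda>t s. f (- t) (- s))"
proof unfold_locales
  fix t s t' s'
  show "\<bar>f (- t) (- s) - f (- t') (- s)\<bar> \<le> \<bar>t - t'\<bar>" using lip1[of "-t" "-s" "-t'"] by simp
  show "\<bar>f (- t) (- s) - f (- t) (- s')\<bar> \<le> \<bar>s - s'\<bar>" using lip2[of "-t" "-s" "-s'"] by simp
  show "\<bar>t - t'\<bar> \<le> f (- t) (- s) + f (- t') (- s)" using sum1[of "-t" "-t'" "-s"] by simp
  show "\<bar>s - s'\<bar> \<le> f (- t) (- s) + f (- t) (- s')" using sum2[of "-s" "-s'" "-t"] by simp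
  show "2 * f (- ((t + t') / 2)) (- s) \<le> f (- t) (- s) + f (- t') (- s)"
    using mid1[of "-t" "-t'" "-s"] by (simp add: minus_divide_left)
  show "2 * f (- t) (- ((s + s') / 2)) \<le> f (- t) (- s) + f (- t) (- s')"
    using mid2[of "-t" "-s" "-s'"] by (simp add: minus_divide_left)
  show "f (- t) (- s') * f (- t') (- s) \<le> \<bar>t - t'\<bar> * \<bar>s - s'\<bar> + f (- t) (- s) * f (- t') (- s')"
    using ptol[of "-t" "-s'" "-t'" "-s"] by (simp add: abs_minus_commute)
qed (use sublin1 sublin2 in auto)

text \<open>Let \<open>b t\<close> be the limit. Then \<open>b t + t\<close> is midpoint convex by
  \<open>mid1\<close>, nondecreasing by \<open>lip1\<close>, and at \<open>n\<close> at most
  \<open>f n n\<close>, because the sequence decreases to its limit. Parallelism makes that bound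
  sublinear, so \<open>b t + t\<close> is constant.\<close>

lemma busemann_forward:
  obtains B where "\<And>t. (\<lambda>n. f t (real n) - real n) \<longlonglongrightarrow> B - t"
    "\<And>n. B \<le> f 0 (real n) - real n"
proof -
  have "\<exists>L. (\<lambda>n. f t (real n) - real n) \<longlonglongrightarrow> L \<and> (\<forall>n. L \<le> f t (real n) - real n)" for t
    by (rule decreasing_shift_convergent) (fact lip2 sum2)+
  then obtain b where b: "\<And>t. (\<lambda>n. f t (real n) - real n) \<longlonglongrightarrow> b t"
    "\<And>t n. b t \<le> f t (real n) - real n" by metis
  have "b s + s = b t + t" for s t
  proof (rule midpoint_convex_sublinear_const[where \<psi> = "\<lambda>t. b t + t" and \<eta> = "\<lambda>n. f (real n) (real n)"])
    fix s t
    have "2 * b ((s + t) / 2) \<le> b s + b t"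
    proof (rule LIMSEQ_le)
      show "(\<lambda>n. 2 * (f ((s + t) / 2) (real n) - real n)) \<longlonglongrightarrow> 2 * b ((s + t) / 2)"
        by (intro tendsto_intros b)
      show "(\<lambda>n. (f s (real n) - real n) + (f t (real n) - real n)) \<longlonglongrightarrow> b s + b t"
        by (intro tendsto_intros b)
      show "\<exists>N. \<forall>n\<ge>N. 2 * (f ((s + t) / 2) (real n) - real n) \<le> (f s (real n) - real n) + (f t (real n) - real n)"
        using mid1[of s t] by (auto simp: algebra_simps)
    qed
    then show "2 * (b ((s + t) / 2) + (s + t) / 2) \<le> b s + s + (b t + t)" by (simp add: field_simps)
  next
    fix s t :: real assume "s \<le> t"
    have "b s - b t \<le> t - s"
    proof (rule LIMSEQ_le_const2)
      show "(\<lambda>n. (f s (real n) - real n) - (f t (real n) - real n)) \<longlonglongrightarrow> b s - b t"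
        by (intro tendsto_intros b)
      show "\<exists>N. \<forall>n\<ge>N. (f s (real n) - real n) - (f t (real n) - real n) \<le> t - s"
      proof (intro exI allI impI)
        fix n show "(f s (real n) - real n) - (f t (real n) - real n) \<le> t - s"
          using lip1[of s "real n" t] \<open>s \<le> t\<close> by simp
      qed
    qed
    then show "b s + s \<le> b t + t" by simp
  next
    fix n show "b (real n) + real n \<le> f (real n) (real n)" using b(2)[of "real n" n] by simp
  qed (rule sublin1)
  from this[of 0] have "b t = b 0 - t" for t by (simp add: algebra_simps)
  with b that show thesis by metis
qed

text \<open>Ptolemy's inequality for the quadrilateral with parameters 0 and \<open>n\<close> on
  both lines: the diagonals are at least \<open>n + B\<close> and \<open>n + B'\<close>, two sides
  have length \<open>n\<close>, and the product of the other two is sublinear. The terms of order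
  \<open>n\<close> leave \<open>B + B'\<close>.\<close>

lemma busemann_sum_nonpos:
  assumes "\<And>n. B \<le> f 0 (real n) - real n" and "\<And>n. B' \<le> f (real n) 0 - real n"
  shows "B + B' \<le> 0"
proof (rule LIMSEQ_le)
  show "(\<lambda>n. B + B' + B * B' / real n) \<longlonglongrightarrow> B + B'"
    using tendsto_add[OF tendsto_const lim_const_over_n[of "B * B'"], of "B + B'"] by simp
  show "(\<lambda>n. f 0 0 * (f (real n) (real n) / real n)) \<longlonglongrightarrow> 0"
    using tendsto_mult_left[OF sublin1, of "f 0 0"] by simp
  \<comment> \<open>From \<open>N\<close> on, \<open>n + B\<close> and \<open>n + B'\<close> are
    nonnegative, as multiplying the two estimates requires.\<close>
  obtain N :: nat where N: "\<bar>B\<bar> + \<bar>B'\<bar> + 1 \<le> real N" using real_arch_simple by blast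
  show "\<exists>N. \<forall>n\<ge>N. B + B' + B * B' / real n \<le> f 0 0 * (f (real n) (real n) / real n)"
  proof (intro exI[of _ N] allI impI)
    fix n assume "n \<ge> N"
    then have n: "real n \<ge> \<bar>B\<bar> + \<bar>B'\<bar> + 1" using N by linarith
    have "(real n + B) * (real n + B') \<le> f 0 (real n) * f (real n) 0"
    proof (rule mult_mono)
      show "real n + B \<le> f 0 (real n)" "real n + B' \<le> f (real n) 0"
        using assms(1,2)[of n] by linarith+
      then show "0 \<le> f 0 (real n)" "0 \<le> real n + B'" using n by linarith+
    qed
    also have "\<dots> \<le> real n * real n + f 0 0 * f (real n) (real n)"
      using ptol[of 0 "real n" "real n" 0] by simp
    finally have "real n * (B + B') + B * B' \<le> f 0 0 * f (real n) (real n)"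
      by (simp add: algebra_simps)
    then have "(real n * (B + B') + B * B') / real n \<le> (f 0 0 * f (real n) (real n)) / real n"
      by (rule divide_right_mono) simp
    then show "B + B' + B * B' / real n \<le> f 0 0 * (f (real n) (real n) / real n)"
      using n by (simp add: add_divide_distrib)
  qed
qed

text \<open>There are four constants, one for each end of each line. Ptolemy bounds the sum over the
  two lines at a common end by 0 from above, the triangle inequality bounds the sum over the two
  ends of one line by 0 from below. The four inequalities form a cycle, so all are equalities and a
  single shift \<open>\<delta>\<close> remains.\<close>

lemma busemann_pair:
  obtains \<delta> where "\<And>t. (\<lambda>n. f t (real n) - real n) \<longlonglongrightarrow> \<delta> - t"
    "\<And>t. (\<lambda>n. f t (- real n) - real n) \<longlonglongrightarrow> t - \<delta>"
    "\<And>s. (\<lambda>n. f (real n) s - real n) \<longlonglongrightarrow> - \<delta> - s"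
    "\<And>s. (\<lambda>n. f (- real n) s - real n) \<longlonglongrightarrow> s + \<delta>"
proof -
  interpret t: parallel_pair "\<lambda>t s. f s t" by (rule transpose)
  interpret r: parallel_pair "\<lambda>t s. f (- t) (- s)" by (rule reverse)
  interpret tr: parallel_pair "\<lambda>t s. f (- s) (- t)" by (rule r.transpose)
  obtain P where P: "\<And>t. (\<lambda>n. f t (real n) - real n) \<longlonglongrightarrow> P - t"
    "\<And>n. P \<le> f 0 (real n) - real n" by (rule busemann_forward) blast
  obtain P' where P': "\<And>s. (\<lambda>n. f (real n) s - real n) \<longlonglongrightarrow> P' - s"
    "\<And>n. P' \<le> f (real n) 0 - real n" by (rule t.busemann_forward) blast
  obtain M where M: "\<And>t. (\<lambda>n. f (- t) (- real n) - real n) \<longlonglongrightarrow> M - t"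
    "\<And>n. M \<le> f (- 0) (- real n) - real n" by (rule r.busemann_forward) blast
  obtain M' where M': "\<And>s. (\<lambda>n. f (- real n) (- s) - real n) \<longlonglongrightarrow> M' - s"
    "\<And>n. M' \<le> f (- real n) (- 0) - real n" by (rule tr.busemann_forward) blast
  have "P + P' \<le> 0" by (rule busemann_sum_nonpos[OF P(2) P'(2)])
  moreover have "M + M' \<le> 0" by (rule r.busemann_sum_nonpos[OF M(2) M'(2)])
  moreover have "0 \<le> P + M"
  proof (rule LIMSEQ_le_const)
    show "(\<lambda>n. (f 0 (real n) - real n) + (f (- 0) (- real n) - real n)) \<longlonglongrightarrow> P + M"
      using tendsto_add[OF P(1)[of 0] M(1)[of 0]] by simp
    show "\<exists>N. \<forall>n\<ge>N. 0 \<le> (f 0 (real n) - real n) + (f (- 0) (- real n) - real n)"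
    proof (intro exI allI impI)
      fix n show "0 \<le> (f 0 (real n) - real n) + (f (- 0) (- real n) - real n)"
        using sum2[of "real n" "- real n" 0] by simp
    qed
  qed
  moreover have "0 \<le> P' + M'"
  proof (rule LIMSEQ_le_const)
    show "(\<lambda>n. (f (real n) 0 - real n) + (f (- real n) (- 0) - real n)) \<longlonglongrightarrow> P' + M'"
      using tendsto_add[OF P'(1)[of 0] M'(1)[of 0]] by simp
    show "\<exists>N. \<forall>n\<ge>N. 0 \<le> (f (real n) 0 - real n) + (f (- real n) (- 0) - real n)"
    proof (intro exI allI impI)
      fix n show "0 \<le> (f (real n) 0 - real n) + (f (- real n) (- 0) - real n)"
        using sum1[of "real n" "- real n" 0] by simp
    qed
  qed
  ultimately have eq: "P' = - P" "M = - P" "M' = P" by linarith+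
  show thesis
  proof (rule that[of P])
    fix t
    show "(\<lambda>n. f t (real n) - real n) \<longlonglongrightarrow> P - t" by (rule P)
    show "(\<lambda>n. f t (- real n) - real n) \<longlonglongrightarrow> t - P" using M(1)[of "- t"] eq by simp
    show "(\<lambda>n. f (real n) t - real n) \<longlonglongrightarrow> - P - t" using P'(1)[of t] eq by simp
    show "(\<lambda>n. f (- real n) t - real n) \<longlonglongrightarrow> t + P" using M'(1)[of "- t"] eq by (simp add: add.commute)
  qed
qed

end

section \<open>Ptolemaic planes\<close>

text \<open>Day's argument: the least \<open>c\<close> with \<open>N (s, k)\<^sup>2 \<le> s\<^sup>2 + c * k\<^sup>2\<close> is attained in a direction other than
  \<open>(1, 0)\<close> unless \<open>c \<le> 1\<close>, and the rhombus inequality propagates equality to bisectors. Hence equality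
  would also hold outside the range of slopes in which it can occur.\<close>

lemma ptolemaic_norm_euclidean:
  fixes N :: "real \<times> real \<Rightarrow> real"
  assumes hom: "\<And>r v. N (r *\<^sub>R v) = \<bar>r\<bar> * N v"
    and tri: "\<And>u v. N (u + v) \<le> N u + N v"
    and ptol: "\<And>x y z w. N (x - y) * N (z - w) \<le> N (x - z) * N (y - w) + N (x - w) * N (y - z)"
    and N10: "N (1, 0) = 1" and N01: "N (0, 1) = 1"
    and ge: "\<And>s k. \<bar>s\<bar> \<le> N (s, k)"
  shows "N (s, k) = sqrt (s\<^sup>2 + k\<^sup>2)"
proof -
  have Ns0: "N (s, 0) = \<bar>s\<bar>" for s using hom[of s "(1, 0)"] N10 by simp
  have N0k: "N (0, k) = \<bar>k\<bar>" for k using hom[of k "(0, 1)"] N01 by simp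
  have neg: "N (- v) = N v" for v using hom[of "-1" v] by simp
  have N_nonneg: "0 \<le> N v" for v by (cases v) (use ge order_trans[OF abs_ge_zero] in blast)
  \<comment> \<open>Ptolemy's inequality for \<open>x\<close>, \<open>-x\<close>, \<open>y\<close>,
    \<open>-y\<close>, where opposite sides have equal norm.\<close>
  have rhombus: "4 * (N x * N y) \<le> (N (x + y))\<^sup>2 + (N (x - y))\<^sup>2" for x y
  proof -
    have "N (x - - x) = 2 * N x" for x using hom[of 2 x] by (simp add: scaleR_2)
    moreover have "N (- x + y) = N (x - y)" "N (- x - y) = N (x + y)"
      using neg[of "x - y"] neg[of "x + y"] by (simp_all add: algebra_simps)
    ultimately show ?thesis using ptol[of x "-x" y "-y"] by (simp add: power2_eq_square)
  qed
  have rectangle: "N (a + b) * N (a - b) \<le> (N a)\<^sup>2 + (N b)\<^sup>2" for a b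
  proof -
    have "a + b + (a - b) = 2 *\<^sub>R a" "a + b - (a - b) = 2 *\<^sub>R b" by (simp_all add: scaleR_2)
    then show ?thesis using rhombus[of "a + b" "a - b"] by (simp add: hom power_mult_distrib)
  qed
  define n where "n k = N (1, k)" for k
  have n1: "1 \<le> n k" for k using ge[of 1 k] by (simp add: n_def)
  have n_le: "n k \<le> 1 + \<bar>k\<bar>" for k using tri[of "(1,0)" "(0,k)"] by (simp add: n_def N10 N0k)
  \<comment> \<open>Since \<open>n (- k)\<close> is at least 1 by \<open>ge\<close>, the product
    bound controls \<open>n k\<close> alone: it exceeds 1 at most quadratically, where the triangle
    inequality gives a linear bound.\<close>
  have "n k * n (- k) \<le> 1 + k\<^sup>2" for k using rectangle[of "(1,0)" "(0,k)"] by (simp add: n_def N10 N0k)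
  moreover have "n k * 1 \<le> n k * n (- k)" for k
    using n1[of k] n1[of "- k"] by (intro mult_left_mono) linarith+
  ultimately have n_sq: "n k \<le> 1 + k\<^sup>2" for k by (metis mult.right_neutral order_trans)
  have n_lip: "\<bar>n k - n k'\<bar> \<le> \<bar>k - k'\<bar>" for k k'
    using tri[of "(1,k)" "(0,k'-k)"] tri[of "(1,k')" "(0,k-k')"] by (simp add: n_def N0k abs_minus_commute)
  have n_cont: "continuous_on A n" for A
    by (rule lipschitz_on_continuous_on[of 1]) (auto simp: lipschitz_on_def dist_real_def n_lip)
  have N_n: "N (s, k) = \<bar>s\<bar> * n (k / s)" if "s \<noteq> 0" for s k
    using hom[of s "(1, k / s)"] that by (simp add: n_def)
  \<comment> \<open>\<open>\<phi> k\<close> is the smallest coefficient that suffices for slope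
    \<open>k\<close>, so its supremum is the least \<open>c\<close>. It is bounded:
    \<open>n_sq\<close> controls small slopes, \<open>n_le\<close> large ones.\<close>
  define \<phi> where "\<phi> k = ((n k)\<^sup>2 - 1) / k\<^sup>2" for k
  have \<phi>_far: "\<phi> k \<le> 1 + 2 / \<bar>k\<bar>" if "k \<noteq> 0" for k
  proof -
    have "(n k)\<^sup>2 \<le> (1 + \<bar>k\<bar>)\<^sup>2" using n_le[of k] n1[of k] by (intro power_mono) auto
    then have "(n k)\<^sup>2 - 1 \<le> 2 * \<bar>k\<bar> + k\<^sup>2" by (simp add: power2_eq_square algebra_simps)
    then have "\<phi> k \<le> (2 * \<bar>k\<bar> + k\<^sup>2) / k\<^sup>2" unfolding \<phi>_def by (rule divide_right_mono) simp
    also have "\<dots> = 1 + 2 / \<bar>k\<bar>" using that by (simp add: field_simps power2_eq_square abs_if)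
    finally show ?thesis .
  qed
  have \<phi>_3: "\<phi> k \<le> 3" if "k \<noteq> 0" for k
  proof (cases "\<bar>k\<bar> \<le> 1")
    case True
    have "(n k)\<^sup>2 \<le> (1 + k\<^sup>2)\<^sup>2" using n_sq[of k] n1[of k] by (intro power_mono) auto
    also have "\<dots> \<le> 1 + 3 * k\<^sup>2"
      using True abs_square_le_1[of k] mult_right_mono[of "k\<^sup>2" 1 "k\<^sup>2"]
      by (simp add: power2_eq_square algebra_simps)
    finally show ?thesis using that by (simp add: \<phi>_def field_simps)
  next
    case False
    then have "2 / \<bar>k\<bar> \<le> 2" by (simp add: field_simps)
    then show ?thesis using \<phi>_far[OF that] by linarith
  qed
  define c where "c = (SUP k\<in>UNIV - {0}. \<phi> k)"
  have bdd: "bdd_above (\<phi> ` (UNIV - {0}))" using \<phi>_3 by (intro bdd_aboveI[of _ 3]) auto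
  have \<phi>_c: "\<phi> k \<le> c" if "k \<noteq> 0" for k unfolding c_def using bdd that by (intro cSUP_upper) auto
  have n_c: "(n k)\<^sup>2 \<le> 1 + c * k\<^sup>2" for k
    using \<phi>_c[of k] by (cases "k = 0") (auto simp: \<phi>_def n_def N10 field_simps)
  have "c \<le> 1"
  proof (rule ccontr)
    assume "\<not> c \<le> 1"
    then have c: "c > 1" by simp
    have N_c: "(N (s, k))\<^sup>2 \<le> s\<^sup>2 + c * k\<^sup>2" for s k
    proof (cases "s = 0")
      case True
      have "k\<^sup>2 \<le> c * k\<^sup>2" using c by (simp add: mult_le_cancel_right1)
      with True show ?thesis by (simp add: N0k)
    next
      case False
      have "(N (s, k))\<^sup>2 = s\<^sup>2 * (n (k / s))\<^sup>2" by (simp add: N_n[OF False] power_mult_distrib)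
      also have "\<dots> \<le> s\<^sup>2 * (1 + c * (k / s)\<^sup>2)" by (intro mult_left_mono n_c) simp
      also have "\<dots> = s\<^sup>2 + c * k\<^sup>2" using False by (simp add: field_simps)
      finally show ?thesis .
    qed
    \<comment> \<open>Near slope 0 the coefficient is at most about \<open>(c + 1) / 2 < c\<close>.
      The vectors \<open>(r, 0)\<close> and \<open>(1, k)\<close> have equal norm; in their rhombus
      one diagonal is estimated with \<open>c\<close>, the other, \<open>(r - 1, - k)\<close>, is
      almost vertical, where the norm is the absolute value.\<close>
    have \<phi>_near: "\<phi> k \<le> (c + (1 + \<bar>k\<bar>)\<^sup>2) / 2" if "k \<noteq> 0" for k
    proof -
      define r where "r = n k"
      have r: "1 \<le> r" "r - 1 \<le> k\<^sup>2" using n1[of k] n_sq[of k] by (simp_all add: r_def)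
      have "4 * (r * r) \<le> (N (r + 1, k))\<^sup>2 + (N (r - 1, - k))\<^sup>2"
        using rhombus[of "(r, 0)" "(1, k)"] Ns0[of r] r by (simp add: r_def n_def)
      moreover have "(N (r + 1, k))\<^sup>2 \<le> (r + 1)\<^sup>2 + c * k\<^sup>2" by (rule N_c)
      moreover have "(N (r - 1, - k))\<^sup>2 \<le> (\<bar>k\<bar> * (1 + \<bar>k\<bar>))\<^sup>2"
      proof (rule power_mono)
        have "N (r - 1, - k) \<le> (r - 1) + \<bar>k\<bar>"
          using tri[of "(r - 1, 0)" "(0, - k)"] r by (simp add: Ns0 N0k)
        then show "N (r - 1, - k) \<le> \<bar>k\<bar> * (1 + \<bar>k\<bar>)" using r by (simp add: algebra_simps power2_eq_square)
      qed (rule N_nonneg)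
      moreover have "(\<bar>k\<bar> * (1 + \<bar>k\<bar>))\<^sup>2 = k\<^sup>2 * (1 + \<bar>k\<bar>)\<^sup>2" by (simp add: power_mult_distrib)
      moreover have "4 * (r * r) - (r + 1)\<^sup>2 = 2 * (r\<^sup>2 - 1) + (r - 1)\<^sup>2"
        by (simp add: power2_eq_square algebra_simps)
      ultimately have "2 * (r\<^sup>2 - 1) \<le> c * k\<^sup>2 + k\<^sup>2 * (1 + \<bar>k\<bar>)\<^sup>2"
        using zero_le_power2[of "r - 1"] by linarith
      then have "2 * (r\<^sup>2 - 1) \<le> (c + (1 + \<bar>k\<bar>)\<^sup>2) * k\<^sup>2"
        by (subst distrib_right, subst mult.commute[of "(1 + \<bar>k\<bar>)\<^sup>2"])
      then show ?thesis using that by (simp add: \<phi>_def r_def field_simps)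
    qed
    \<comment> \<open>\<open>\<delta>\<close> and \<open>R\<close> are chosen such that
      \<open>\<phi>_near\<close> below \<open>\<delta>\<close> and \<open>\<phi>_far\<close> beyond
      \<open>R\<close> stay under some \<open>m < c\<close>. So the supremum is attained on the
      compact set \<open>S\<close> between them.\<close>
    define \<delta> where "\<delta> = (sqrt c - 1) / 2"
    have \<delta>: "\<delta> > 0" "1 + \<delta> < sqrt c" using c by (simp_all add: \<delta>_def field_simps)
    have \<delta>c: "(1 + \<delta>)\<^sup>2 < c"
      using power_strict_mono[OF \<delta>(2), of 2] \<delta>(1) c by simp
    define R where "R = 4 / (c - 1) + \<delta>"
    have "4 / (c - 1) > 0" using c by simp
    have R: "R > 0" "\<delta> \<le> R" using \<delta> \<open>4 / (c - 1) > 0\<close> unfolding R_def by linarith+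
    have Rc: "1 + 2 / R < c"
    proof -
      have "4 / (c - 1) \<le> R" using \<delta> by (simp add: R_def)
      then have "4 \<le> R * (c - 1)" using c by (simp add: field_simps)
      then show ?thesis using R c by (simp add: field_simps)
    qed
    define m where "m = max ((c + (1 + \<delta>)\<^sup>2) / 2) (1 + 2 / R)"
    have m: "m < c" "(c + (1 + \<delta>)\<^sup>2) / 2 \<le> m" "1 + 2 / R \<le> m" using \<delta>c Rc by (simp_all add: m_def)
    have out: "\<phi> k \<le> m" if "k \<noteq> 0" "\<bar>k\<bar> \<le> \<delta> \<or> R \<le> \<bar>k\<bar>" for k
      using that(2)
    proof
      assume "\<bar>k\<bar> \<le> \<delta>"
      then have "(1 + \<bar>k\<bar>)\<^sup>2 \<le> (1 + \<delta>)\<^sup>2" by (intro power_mono) auto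
      then have "(c + (1 + \<bar>k\<bar>)\<^sup>2) / 2 \<le> (c + (1 + \<delta>)\<^sup>2) / 2" by (intro divide_right_mono add_left_mono) auto
      then show ?thesis using \<phi>_near[OF that(1)] m(2) by (meson order_trans)
    next
      assume "R \<le> \<bar>k\<bar>"
      then have "2 / \<bar>k\<bar> \<le> 2 / R" using R by (intro divide_left_mono) auto
      then show ?thesis using \<phi>_far[OF that(1)] m(3) by linarith
    qed
    define S where "S = {- R..- \<delta>} \<union> {\<delta>..R}"
    have "compact S" "S \<noteq> {}" using R(2) by (auto simp: S_def)
    moreover have "continuous_on S \<phi>"
      unfolding \<phi>_def by (intro continuous_intros n_cont) (use \<delta> in \<open>auto simp: S_def\<close>)
    ultimately obtain k2 where k2: "k2 \<in> S" "\<And>k. k \<in> S \<Longrightarrow> \<phi> k \<le> \<phi> k2"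
      using continuous_attains_sup by metis
    have k2_0: "k2 \<noteq> 0" using k2(1) \<delta> by (auto simp: S_def)
    have "c \<le> max m (\<phi> k2)" unfolding c_def
    proof (rule cSUP_least)
      fix k :: real assume "k \<in> UNIV - {0}"
      then have "k \<noteq> 0" by simp
      show "\<phi> k \<le> max m (\<phi> k2)"
      proof (cases "k \<in> S")
        case True then show ?thesis using k2(2) by (simp add: le_max_iff_disj)
      next
        case False
        then have "\<bar>k\<bar> \<le> \<delta> \<or> R \<le> \<bar>k\<bar>" by (auto simp: S_def abs_if)
        then show ?thesis using out[OF \<open>k \<noteq> 0\<close>] by (simp add: le_max_iff_disj)
      qed
    qed auto
    then have "\<phi> k2 = c" using m(1) \<phi>_c[OF k2_0] by (simp add: le_max_iff_disj)
    \<comment> \<open>The slopes at which \<open>N\<close> touches the norm with square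
      \<open>s\<^sup>2 + c * k\<^sup>2\<close>. They form a compact set containing 0 and
      \<open>k2\<close>, hence have two distinct extremes.\<close>
    define C where "C = {k. (n k)\<^sup>2 = 1 + c * k\<^sup>2}"
    have "closed C" unfolding C_def by (intro closed_Collect_eq continuous_intros n_cont)
    have C0: "0 \<in> C" by (simp add: C_def n_def N10)
    have Ck2: "k2 \<in> C" using \<open>\<phi> k2 = c\<close> k2_0 by (auto simp: C_def \<phi>_def field_simps)
    have "\<bar>k\<bar> \<le> R" if "k \<in> C" for k
    proof (rule ccontr)
      assume "\<not> \<bar>k\<bar> \<le> R"
      then have "k \<noteq> 0" "R \<le> \<bar>k\<bar>" using R by auto
      moreover have "\<phi> k = c" using that \<open>k \<noteq> 0\<close> by (simp add: C_def \<phi>_def)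
      ultimately show False using out[of k] m(1) by simp
    qed
    then have "C \<subseteq> {-R..R}" by (meson abs_le_iff atLeastAtMost_iff minus_le_iff subsetI)
    then have "compact C" using \<open>closed C\<close> compact_Icc by (meson bounded_closed_interval bounded_subset compact_eq_bounded_closed)
    then obtain ka kb where k: "ka \<in> C" "kb \<in> C" "\<And>k. k \<in> C \<Longrightarrow> ka \<le> k" "\<And>k. k \<in> C \<Longrightarrow> k \<le> kb"
      using compact_attains_inf[of C] compact_attains_sup[of C] C0 by blast
    have "ka < kb" using k(3,4)[OF C0] k(3,4)[OF Ck2] k2_0 by force
    define na nb where "na = n ka" and "nb = n kb"
    have na: "na \<ge> 1" "na\<^sup>2 = 1 + c * ka\<^sup>2" and nb: "nb \<ge> 1" "nb\<^sup>2 = 1 + c * kb\<^sup>2"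
      using n1 k(1,2) by (auto simp: na_def nb_def C_def)
    \<comment> \<open>The difference of the two unit vectors with extreme contact slopes. The
      touching norm obeys the parallelogram law, so the rhombus inequality forces contact in this
      direction too. But it is vertical, where \<open>c > 1\<close> excludes contact, or its slope
      lies outside \<open>{ka..kb}\<close>.\<close>
    define \<alpha> \<beta> where "\<alpha> = 1 / nb - 1 / na" and "\<beta> = kb / nb - ka / na"
    have "4 * (N ((1 / nb) *\<^sub>R (1, kb)) * N ((1 / na) *\<^sub>R (1, ka))) \<le> (N (1 / nb + 1 / na, kb / nb + ka / na))\<^sup>2 + (N (\<alpha>, \<beta>))\<^sup>2"
      using rhombus[of "(1 / nb) *\<^sub>R (1, kb)" "(1 / na) *\<^sub>R (1, ka)"] by (simp add: \<alpha>_def \<beta>_def)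
    moreover have "N ((1 / nb) *\<^sub>R (1, kb)) = 1" "N ((1 / na) *\<^sub>R (1, ka)) = 1"
      using na nb by (simp_all only: hom) (simp_all add: n_def na_def nb_def)
    ultimately have "4 \<le> (N (1 / nb + 1 / na, kb / nb + ka / na))\<^sup>2 + (N (\<alpha>, \<beta>))\<^sup>2" by simp
    also have "\<dots> \<le> (1 / nb + 1 / na)\<^sup>2 + c * (kb / nb + ka / na)\<^sup>2 + (N (\<alpha>, \<beta>))\<^sup>2"
      by (intro add_right_mono N_c)
    also have "(1 / nb + 1 / na)\<^sup>2 + c * (kb / nb + ka / na)\<^sup>2 = 4 - (\<alpha>\<^sup>2 + c * \<beta>\<^sup>2)"
    proof -
      have "(1 / nb + 1 / na)\<^sup>2 + c * (kb / nb + ka / na)\<^sup>2 + (\<alpha>\<^sup>2 + c * \<beta>\<^sup>2)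
          = 2 * ((1 + c * kb\<^sup>2) / nb\<^sup>2) + 2 * ((1 + c * ka\<^sup>2) / na\<^sup>2)"
        by (simp add: \<alpha>_def \<beta>_def power2_eq_square algebra_simps add_divide_distrib)
      also have "\<dots> = 4" using na nb by (simp flip: na(2) nb(2))
      finally show ?thesis by simp
    qed
    finally have contact: "\<alpha>\<^sup>2 + c * \<beta>\<^sup>2 \<le> (N (\<alpha>, \<beta>))\<^sup>2" by simp
    show False
    proof (cases "\<alpha> = 0")
      case True
      then have "nb = na" using na nb by (simp add: \<alpha>_def)
      then have "\<beta> \<noteq> 0" using \<open>ka < kb\<close> na by (simp add: \<beta>_def)
      moreover have "c * \<beta>\<^sup>2 \<le> \<beta>\<^sup>2" using contact True by (simp add: N0k)
      ultimately show False using c by (simp add: mult_le_cancel_right2)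
    next
      case False
      have "\<alpha>\<^sup>2 + c * \<beta>\<^sup>2 \<le> \<alpha>\<^sup>2 * (n (\<beta> / \<alpha>))\<^sup>2"
        using contact by (simp add: N_n[OF False] power_mult_distrib)
      moreover have "\<alpha>\<^sup>2 + c * \<beta>\<^sup>2 = \<alpha>\<^sup>2 * (1 + c * (\<beta> / \<alpha>)\<^sup>2)" using False by (simp add: field_simps)
      ultimately have "1 + c * (\<beta> / \<alpha>)\<^sup>2 \<le> (n (\<beta> / \<alpha>))\<^sup>2" using False by simp
      then have "\<beta> / \<alpha> \<in> C" using n_c[of "\<beta> / \<alpha>"] by (simp add: C_def)
      moreover have "na \<noteq> nb" using False by (auto simp: \<alpha>_def)
      moreover have "\<beta> / \<alpha> = (kb * na - ka * nb) / (na - nb)"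
        using na(1) nb(1) \<open>na \<noteq> nb\<close> by (simp add: \<alpha>_def \<beta>_def divide_simps) 
      ultimately have *: "ka \<le> (kb * na - ka * nb) / (na - nb)" "(kb * na - ka * nb) / (na - nb) \<le> kb"
        using k(3,4) by auto
      show False
      proof (cases "nb < na")
        case True
        then have "kb * na - ka * nb \<le> kb * (na - nb)" using *(2) by (simp add: pos_divide_le_eq)
        then have "kb * nb \<le> ka * nb" by (simp add: algebra_simps)
        then show False using \<open>ka < kb\<close> nb by simp
      next
        case False
        then have "na < nb" using \<open>na \<noteq> nb\<close> by simp
        then have "kb * na - ka * nb \<le> ka * (na - nb)" using *(1) by (simp add: neg_le_divide_eq)
        then have "kb * na \<le> ka * na" by (simp add: algebra_simps)
        then show False using \<open>ka < kb\<close> na by simp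
      qed
    qed
  qed
  have upper: "N (s, k) \<le> sqrt (s\<^sup>2 + k\<^sup>2)" for s k
  proof (cases "s = 0")
    case False
    have "(N (s, k))\<^sup>2 = s\<^sup>2 * (n (k / s))\<^sup>2" by (simp add: N_n[OF False] power_mult_distrib)
    also have "\<dots> \<le> s\<^sup>2 * (1 + c * (k / s)\<^sup>2)" by (intro mult_left_mono n_c) simp
    also have "\<dots> \<le> s\<^sup>2 * (1 + 1 * (k / s)\<^sup>2)"
      using \<open>c \<le> 1\<close> by (intro mult_left_mono add_left_mono mult_right_mono) auto
    also have "\<dots> = s\<^sup>2 + k\<^sup>2" using False by (simp add: field_simps)
    finally show ?thesis by (rule real_le_rsqrt)
  qed (simp add: N0k)
  have lower: "sqrt (u\<^sup>2 + g\<^sup>2) \<le> N (u, - (e * g))" if "u > 0" "g > 0" "\<bar>e\<bar> = 1" for u g e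
  proof -
    have e: "(e * x)\<^sup>2 = x\<^sup>2" for x using that(3) by (metis abs_mult mult_1 power2_abs)
    have diag: "sqrt (x\<^sup>2 + x\<^sup>2) = sqrt 2 * x" if "x > 0" for x :: real
      using that by (simp add: real_sqrt_mult flip: mult_2)
    \<comment> \<open>The four points lie on a Euclidean circle, since the origin cuts both
      diagonals into parts \<open>u\<close> and \<open>g\<close>. So Ptolemy is an equality there,
      and the upper bounds on three sides leave no slack for the fourth. The sign \<open>e\<close>
      covers both kinds of quadrants.\<close>
    have "N ((u, 0) - (- g, 0)) * N ((0, - (e * u)) - (0, e * g)) \<le>
      N ((u, 0) - (0, - (e * u))) * N ((- g, 0) - (0, e * g)) + N ((u, 0) - (0, e * g)) * N ((- g, 0) - (0, - (e * u)))"
      by (rule ptol)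
    moreover have "\<bar>- (e * u) - e * g\<bar> = u + g"
    proof -
      have "- (e * u) - e * g = - (e * (u + g))" by (simp add: algebra_simps)
      then show ?thesis using that by (simp only: abs_minus_cancel abs_mult) simp
    qed
    ultimately have "(u + g) * (u + g) \<le> N (u, e * u) * N (- g, - (e * g)) + N (u, - (e * g)) * N (- g, e * u)"
      using that by (simp add: Ns0 N0k)
    also have "\<dots> \<le> (sqrt 2 * u) * (sqrt 2 * g) + N (u, - (e * g)) * sqrt (u\<^sup>2 + g\<^sup>2)"
    proof (intro add_mono mult_mono mult_left_mono)
      show "N (u, e * u) \<le> sqrt 2 * u" using upper[of u "e * u"] that e diag by simp
      show "N (- g, - (e * g)) \<le> sqrt 2 * g" using upper[of "-g" "- (e * g)"] that e diag by simp
      show "N (- g, e * u) \<le> sqrt (u\<^sup>2 + g\<^sup>2)" using upper[of "-g" "e * u"] e by (simp add: add.commute)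
    qed (use N_nonneg that in auto)
    finally have "sqrt (u\<^sup>2 + g\<^sup>2) * sqrt (u\<^sup>2 + g\<^sup>2) \<le> N (u, - (e * g)) * sqrt (u\<^sup>2 + g\<^sup>2)"
      by (simp add: power2_eq_square algebra_simps)
    moreover have "sqrt (u\<^sup>2 + g\<^sup>2) > 0" using that by (simp add: sum_power2_gt_zero_iff)
    ultimately show ?thesis by (rule mult_right_le_imp_le)
  qed
  show ?thesis
  proof (cases "s = 0 \<or> k = 0")
    case False
    have "N (\<bar>s\<bar>, - (- (sgn s * sgn k) * \<bar>k\<bar>)) = N (sgn s *\<^sub>R (s, k))"
      by (simp add: abs_sgn mult.assoc mult.commute[of "sgn k"] mult.commute[of s])
    also have "\<dots> = N (s, k)" using False unfolding hom by (simp add: abs_sgn_eq)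
    finally show ?thesis
      using lower[of "\<bar>s\<bar>" "\<bar>k\<bar>" "- (sgn s * sgn k)"] upper[of s k] False
      by (simp add: abs_mult abs_sgn_eq)
  qed (auto simp: Ns0 N0k)
qed

text \<open>Ptolemy's inequality for \<open>p\<close>, \<open>q\<close>, their midpoint
  \<open>m\<close> and \<open>r\<close>, divided by \<open>pq\<close>: distance functions are
  midpoint convex.\<close>

lemma ptolemaic_midpoint_convex:
  fixes pm pr qr mr pq :: real
  assumes "mr * pq \<le> (pq / 2) * qr + (pq / 2) * pr" "pq \<ge> 0"
    and "pq = 0 \<Longrightarrow> mr \<le> pr \<and> mr \<le> qr"
  shows "2 * mr \<le> pr + qr"
proof (cases "pq = 0")
  case False
  have "pq * (2 * mr) \<le> pq * (pr + qr)" using assms(1) by (simp add: algebra_simps)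
  with False assms(2) show ?thesis by simp
qed (use assms(3) in auto)

text \<open>Blow-ups of the strip at interior points: \<open>d\<close> is a metric on the plane in which every
  vertical line \<open>{s} \<times> UNIV\<close> (a rescaled level set) is a geodesic line. These lines are
  parallel, so their Busemann function is a second affine function, next to \<open>fst\<close>.\<close>

locale level_plane =
  fixes d :: "real \<times> real \<Rightarrow> real \<times> real \<Rightarrow> real"
  assumes sym: "d P Q = d Q P" and tri: "d P R \<le> d P Q + d Q R"
    and level: "d (s, k) (s, k') = \<bar>k - k'\<bar>"
    and height: "\<bar>fst P - fst Q\<bar> \<le> d P Q"
    and lip: "d P Q \<le> 3 * \<bar>fst P - fst Q\<bar> + \<bar>snd P - snd Q\<bar>"
    and ptol: "d P Q * d R S \<le> d P R * d Q S + d P S * d Q R"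
    and mid: "\<exists>k. d P ((fst P + fst Q) / 2, k) = d P Q / 2 \<and> d ((fst P + fst Q) / 2, k) Q = d P Q / 2"
begin

lemma nonneg: "0 \<le> d P Q" using height[of P Q] by linarith

lemma mid_convex:
  assumes "d P M = d P Q / 2" "d M Q = d P Q / 2"
  shows "2 * d M R \<le> d P R + d Q R"
proof (rule ptolemaic_midpoint_convex)
  show "d M R * d P Q \<le> d P Q / 2 * d Q R + d P Q / 2 * d P R"
    using ptol[of M R P Q] unfolding sym[of M P] sym[of R Q] sym[of R P] assms by simp
  show "d P Q = 0 \<Longrightarrow> d M R \<le> d P R \<and> d M R \<le> d Q R"
    using tri[of M R P] tri[of M R Q] assms sym[of P M] by simp
qed (rule nonneg)

text \<open>By \<open>lip\<close> the levels at heights 0 and \<open>s\<close> stay within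
  \<open>3 * \<bar>s\<bar>\<close> of each other at equal second coordinates, which is more than
  sublinearity.\<close>

lemma parallel_levels: "parallel_pair (\<lambda>k k'. d (0, k) (s, k'))"
proof unfold_locales
  fix t s' t' s'' :: real
  show "\<bar>d (0, t) (s, s') - d (0, t') (s, s')\<bar> \<le> \<bar>t - t'\<bar>"
    using tri[of "(0,t)" "(s,s')" "(0,t')"] tri[of "(0,t')" "(s,s')" "(0,t)"] by (simp add: level abs_minus_commute)
  show "\<bar>d (0, t) (s, s') - d (0, t) (s, s'')\<bar> \<le> \<bar>s' - s''\<bar>"
    using tri[of "(0,t)" "(s,s')" "(s,s'')"] tri[of "(0,t)" "(s,s'')" "(s,s')"] by (simp add: level abs_minus_commute)
  show "\<bar>t - t'\<bar> \<le> d (0, t) (s, s') + d (0, t') (s, s')"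
    using tri[of "(0,t)" "(0,t')" "(s,s')"] sym[of "(0,t')"] by (simp add: level)
  show "\<bar>s' - s''\<bar> \<le> d (0, t) (s, s') + d (0, t) (s, s'')"
    using tri[of "(s,s')" "(s,s'')" "(0,t)"] sym[of "(s,s')"] by (simp add: level)
  show "2 * d (0, (t + t') / 2) (s, s') \<le> d (0, t) (s, s') + d (0, t') (s, s')"
    by (rule mid_convex) (auto simp: level abs_if field_simps)
  show "2 * d (0, t) (s, (s' + s'') / 2) \<le> d (0, t) (s, s') + d (0, t) (s, s'')"
    using mid_convex[of "(s,s')" "(s, (s' + s'') / 2)" "(s,s'')" "(0,t)"]
    by (auto simp: level abs_if field_simps sym[of "(0,t)"])
  show "d (0, t) (s, s'') * d (0, t') (s, s') \<le> \<bar>t - t'\<bar> * \<bar>s' - s''\<bar> + d (0, t) (s, s') * d (0, t') (s, s'')"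
    using ptol[of "(0,t)" "(s,s'')" "(0,t')" "(s,s')"] sym[of "(s,s'')"] by (simp add: level abs_minus_commute)
next
  have bound: "d (0, x) (s, x) \<le> 3 * \<bar>s\<bar>" for x using lip[of "(0, x)" "(s, x)"] by simp
  have "(\<lambda>n. 3 * \<bar>s\<bar> / real n) \<longlonglongrightarrow> 0" by (rule lim_const_over_n)
  then show "(\<lambda>n. d (0, real n) (s, real n) / real n) \<longlonglongrightarrow> 0"
    by (rule Lim_null_comparison[rotated])
      (use nonneg bound in \<open>auto intro!: always_eventually divide_right_mono\<close>)
  show "(\<lambda>n. d (0, - real n) (s, - real n) / real n) \<longlonglongrightarrow> 0"
    by (rule Lim_null_comparison[OF _ \<open>(\<lambda>n. 3 * \<bar>s\<bar> / real n) \<longlonglongrightarrow> 0\<close>])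
      (use nonneg bound in \<open>auto intro!: always_eventually divide_right_mono\<close>)
qed

text \<open>The Busemann functions of the two ends of the line over height 0 are \<open>B\<close>
  and \<open>- B\<close> with \<open>B P = snd P + \<delta> (fst P)\<close>, by
  \<open>busemann_pair\<close>. Both are midpoint convex, so \<open>B\<close> is affine; it is
  1-Lipschitz for \<open>d\<close>, which bounds \<open>\<delta>\<close>.\<close>

lemma second_affine_function:
  "\<exists>\<delta>. (\<forall>P Q M. d P M = d P Q / 2 \<longrightarrow> d M Q = d P Q / 2 \<longrightarrow>
      snd M + \<delta> (fst M) = ((snd P + \<delta> (fst P)) + (snd Q + \<delta> (fst Q))) / 2) \<and>
    (\<forall>s s'. \<bar>\<delta> s - \<delta> s'\<bar> \<le> 3 * \<bar>s - s'\<bar>) \<and> \<delta> 0 = 0"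
proof -
  have ex: "\<forall>s. \<exists>\<delta>. \<forall>k. (\<lambda>n. d (0, real n) (s, k) - real n) \<longlonglongrightarrow> - \<delta> - k \<and>
      (\<lambda>n. d (0, - real n) (s, k) - real n) \<longlonglongrightarrow> k + \<delta>"
  proof
    fix s
    interpret parallel_pair "\<lambda>k k'. d (0, k) (s, k')" by (rule parallel_levels)
    show "\<exists>\<delta>. \<forall>k. (\<lambda>n. d (0, real n) (s, k) - real n) \<longlonglongrightarrow> - \<delta> - k \<and>
      (\<lambda>n. d (0, - real n) (s, k) - real n) \<longlonglongrightarrow> k + \<delta>" (is ?thesis)
    proof (rule busemann_pair)
      fix \<delta>
      assume "\<And>k. (\<lambda>n. d (0, k) (s, real n) - real n) \<longlonglongrightarrow> \<delta> - k"
        "\<And>k. (\<lambda>n. d (0, k) (s, - real n) - real n) \<longlonglongrightarrow> k - \<delta>"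
        and *: "\<And>k. (\<lambda>n. d (0, real n) (s, k) - real n) \<longlonglongrightarrow> - \<delta> - k"
        "\<And>k. (\<lambda>n. d (0, - real n) (s, k) - real n) \<longlonglongrightarrow> k + \<delta>"
      show ?thesis by (intro exI[of _ \<delta>] allI conjI *)
    qed
  qed
  obtain \<delta> where \<delta>: "(\<lambda>n. d (0, real n) (s, k) - real n) \<longlonglongrightarrow> - \<delta> s - k"
    "(\<lambda>n. d (0, - real n) (s, k) - real n) \<longlonglongrightarrow> k + \<delta> s" for s k
    using choice[OF ex] by blast
  define B where "B P = snd P + \<delta> (fst P)" for P
  have Bp: "(\<lambda>n. d (0, real n) P - real n) \<longlonglongrightarrow> - B P" for P
  proof -
    have "- \<delta> (fst P) - snd P = - B P" by (simp add: B_def)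
    then show ?thesis using \<delta>(1)[of "fst P" "snd P"] by simp
  qed
  have Bm: "(\<lambda>n. d (0, - real n) P - real n) \<longlonglongrightarrow> B P" for P
    using \<delta>(2)[of "fst P" "snd P"] by (simp add: B_def)
  have half: "2 * L M \<le> L P + L Q"
    if PM: "d P M = d P Q / 2" "d M Q = d P Q / 2" and L: "\<And>P. (\<lambda>n. d (0, x n) P - real n) \<longlonglongrightarrow> L P"
    for L P Q M x
  proof (rule LIMSEQ_le)
    show "(\<lambda>n. 2 * (d (0, x n) M - real n)) \<longlonglongrightarrow> 2 * L M" by (intro tendsto_intros L)
    show "(\<lambda>n. (d (0, x n) P - real n) + (d (0, x n) Q - real n)) \<longlonglongrightarrow> L P + L Q" by (intro tendsto_intros L)
    show "\<exists>N. \<forall>n\<ge>N. 2 * (d (0, x n) M - real n) \<le> d (0, x n) P - real n + (d (0, x n) Q - real n)"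
    proof (intro exI allI impI)
      fix n show "2 * (d (0, x n) M - real n) \<le> d (0, x n) P - real n + (d (0, x n) Q - real n)"
        using mid_convex[OF PM, of "(0, x n)"] by (simp add: sym[of "(0, x n)"])
    qed
  qed
  have B1: "B P - B Q \<le> d P Q" for P Q
  proof (rule LIMSEQ_le_const2)
    show "(\<lambda>n. (d (0, - real n) P - real n) - (d (0, - real n) Q - real n)) \<longlonglongrightarrow> B P - B Q"
      by (intro tendsto_intros Bm)
    show "\<exists>N. \<forall>n\<ge>N. d (0, - real n) P - real n - (d (0, - real n) Q - real n) \<le> d P Q"
    proof (intro exI allI impI)
      fix n show "d (0, - real n) P - real n - (d (0, - real n) Q - real n) \<le> d P Q"
        using tri[of "(0, - real n)" P Q] by (simp add: sym[of Q])
    qed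
  qed
  show ?thesis
  proof (intro exI[of _ \<delta>] conjI allI impI)
    fix P Q M assume *: "d P M = d P Q / 2" "d M Q = d P Q / 2"
    show "snd M + \<delta> (fst M) = ((snd P + \<delta> (fst P)) + (snd Q + \<delta> (fst Q))) / 2"
      using half[OF * Bp] half[OF * Bm] by (simp add: B_def)
  next
    fix s s'
    show "\<bar>\<delta> s - \<delta> s'\<bar> \<le> 3 * \<bar>s - s'\<bar>"
      using B1[of "(s,0)" "(s',0)"] B1[of "(s',0)" "(s,0)"] lip[of "(s,0)" "(s',0)"] lip[of "(s',0)" "(s,0)"]
      by (simp add: B_def abs_minus_commute)
  next
    have "(\<lambda>n. d (0, - real n) (0, 0) - real n) \<longlonglongrightarrow> 0" by (simp add: level)
    from LIMSEQ_unique[OF this Bm] show "\<delta> 0 = 0" by (simp add: B_def)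
  qed
qed

end

text \<open>Midpoints being vector midpoints, \<open>D\<close> doubles with the vector. Translating
  a segment from \<open>u\<close> to \<open>u'\<close> changes its length by a bounded amount
  however long it is, so scaling by \<open>2 ^ n\<close> shows that the length does not change at
  all. Homogeneity passes from powers of two to naturals by subadditivity and to reals by rounding
  \<open>n * r\<close>.\<close>

lemma affine_midpoints_norm:
  fixes D :: "'v::real_normed_vector \<Rightarrow> 'v \<Rightarrow> real"
  assumes sym: "\<And>u v. D u v = D v u" and tri: "\<And>u v w. D u w \<le> D u v + D v w"
    and lip: "\<And>u v. D u v \<le> C * norm (u - v)"
    and mid: "\<And>u v. D u ((1/2) *\<^sub>R (u + v)) = D u v / 2"
  shows "D u v = D 0 (v - u)" and "D 0 (r *\<^sub>R v) = \<bar>r\<bar> * D 0 v"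
proof -
  have archimedean: "x \<le> 0" if "\<And>n::nat. real n * x \<le> c" for x c :: real
  proof (rule ccontr)
    assume "\<not> x \<le> 0"
    then obtain n :: nat where "c < real n * x" using reals_Archimedean3[of x] by auto
    with that[of n] show False by simp
  qed
  have D00: "D u u = 0" for u using mid[of u u] by (simp flip: scaleR_2)
  have D_nonneg: "0 \<le> D u v" for u v using tri[of u u v] D00[of u] sym[of u v] by simp
  have double: "D u (u + 2 *\<^sub>R v) = 2 * D u (u + v)" for u v
    using mid[of u "u + 2 *\<^sub>R v"] by (simp add: scaleR_2 scaleR_add_right algebra_simps flip: scaleR_add_left)
  have pow: "D u (u + (2 ^ k) *\<^sub>R v) = 2 ^ k * D u (u + v)" for u v k
  proof (induction k)
    case (Suc k)
    then show ?case using double[of u "2 ^ k *\<^sub>R v"] by simp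
  qed auto
  have transl_le: "D u (u + v) - D u' (u' + v) \<le> 0" for u u' v
  proof (rule archimedean)
    fix n :: nat
    define x where "x = D u (u + v) - D u' (u' + v)"
    define c where "c = 2 * (C * norm (u - u'))"
    have "D u (u + w) \<le> D u u' + (D u' (u' + w) + D (u' + w) (u + w))" for w
      using tri[of u "u + w" u'] tri[of u' "u + w" "u' + w"] by linarith
    moreover have "D (u' + w) (u + w) \<le> C * norm (u - u')" for w
      using lip[of "u' + w" "u + w"] by (simp add: norm_minus_commute)
    ultimately have "2 ^ n * D u (u + v) - 2 ^ n * D u' (u' + v) \<le> c"
      using lip[of u u'] pow[of u n v] pow[of u' n v] unfolding c_def by (smt (verit))
    then have le: "2 ^ n * x \<le> c" by (simp add: x_def algebra_simps)
    have "0 \<le> c" using lip[of u u'] D_nonneg[of u u'] by (simp add: c_def)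
    have "real n * x \<le> c"
    proof (cases "x \<le> 0")
      case True
      then show ?thesis using \<open>0 \<le> c\<close> by (meson mult_nonneg_nonpos of_nat_0_le_iff order_trans)
    next
      case False
      have "real n \<le> 2 ^ n" using of_nat_mono[OF less_imp_le[OF less_exp[of n]]] by simp
      then have "real n * x \<le> 2 ^ n * x" using False by (intro mult_right_mono) auto
      with le show ?thesis by linarith
    qed
    then show "real n * (D u (u + v) - D u' (u' + v)) \<le> c" by (simp add: x_def)
  qed
  have transl: "D u v = D 0 (v - u)" for u v
    using transl_le[of u "v - u" 0] transl_le[of 0 "v - u" u] by simp
  then show "D u v = D 0 (v - u)" .
  have subadd: "D 0 (u + v) \<le> D 0 u + D 0 v" for u v
    using tri[of 0 "u + v" u] transl[of u "u + v"] by simp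
  have le_nat: "D 0 (real k *\<^sub>R v) \<le> real k * D 0 v" for k v
  proof (induction k)
    case (Suc k)
    then show ?case using subadd[of "real k *\<^sub>R v" v] by (simp add: algebra_simps)
  qed (simp add: D00)
  have nat: "D 0 (real k *\<^sub>R v) = real k * D 0 v" for k v
  proof -
    have k: "k \<le> 2 ^ k" using less_exp[of k] by simp
    \<comment> \<open>A strict inequality in \<open>le_nat\<close> would, after adding the remaining
      \<open>2 ^ k - k\<close> copies of \<open>v\<close>, contradict the equality
      \<open>pow\<close>.\<close>
    have "2 ^ k * D 0 v = D 0 (real k *\<^sub>R v + real (2 ^ k - k) *\<^sub>R v)"
      using pow[of 0 k v] k by (simp add: of_nat_diff flip: scaleR_add_left)
    also have "\<dots> \<le> D 0 (real k *\<^sub>R v) + real (2 ^ k - k) * D 0 v"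
      using subadd le_nat[of "2 ^ k - k" v] by (meson add_left_mono order_trans)
    also have "real (2 ^ k - k) = 2 ^ k - real k" using k by (simp add: of_nat_diff)
    finally show ?thesis using le_nat[of k v] by (simp add: algebra_simps)
  qed
  have pos: "D 0 (r *\<^sub>R v) = r * D 0 v" if "r \<ge> 0" for r v
  proof -
    have bound: "real n * \<bar>D 0 (r *\<^sub>R v) - r * D 0 v\<bar> \<le> C * norm v + D 0 v" for n
    proof -
      define p where "p = nat \<lfloor>real n * r\<rfloor>"
      have p: "real p \<le> real n * r" "real n * r \<le> real p + 1" using that by (auto simp: p_def)
      define q where "q = real n * r - real p"
      have q: "0 \<le> q" "q \<le> 1" using p by (simp_all add: q_def)
      have "D 0 (q *\<^sub>R v) \<le> C * norm v"
      proof -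
        have "D 0 (q *\<^sub>R v) \<le> q * (C * norm v)" using lip[of 0 "q *\<^sub>R v"] q by (simp add: mult.left_commute)
        also have "\<dots> \<le> 1 * (C * norm v)"
          using q lip[of 0 v] D_nonneg[of 0 v] by (intro mult_right_mono) auto
        finally show ?thesis by simp
      qed
      moreover have "D 0 ((- q) *\<^sub>R v) = D 0 (q *\<^sub>R v)" using transl[of "q *\<^sub>R v" 0] sym[of 0 "q *\<^sub>R v"] by simp
      moreover have "D 0 (real n *\<^sub>R (r *\<^sub>R v)) \<le> D 0 (real p *\<^sub>R v) + D 0 (q *\<^sub>R v)"
        using subadd[of "real p *\<^sub>R v" "q *\<^sub>R v"] by (simp add: q_def flip: scaleR_add_left)
      moreover have "D 0 (real p *\<^sub>R v) \<le> D 0 (real n *\<^sub>R (r *\<^sub>R v)) + D 0 ((- q) *\<^sub>R v)"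
        using subadd[of "(real n * r) *\<^sub>R v" "(- q) *\<^sub>R v"] by (simp add: q_def flip: scaleR_add_left)
      ultimately have "\<bar>real n * D 0 (r *\<^sub>R v) - real p * D 0 v\<bar> \<le> C * norm v"
        unfolding nat by linarith
      moreover have "\<bar>real p * D 0 v - real n * r * D 0 v\<bar> \<le> D 0 v"
      proof -
        have "real p * D 0 v - real n * r * D 0 v = - (q * D 0 v)" by (simp add: q_def algebra_simps)
        then show ?thesis using q D_nonneg[of 0 v] by (simp add: abs_mult mult_left_le_one_le)
      qed
      ultimately have "\<bar>real n * D 0 (r *\<^sub>R v) - real n * r * D 0 v\<bar> \<le> C * norm v + D 0 v" by linarith
      also have "real n * D 0 (r *\<^sub>R v) - real n * r * D 0 v = real n * (D 0 (r *\<^sub>R v) - r * D 0 v)"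
        by (simp add: algebra_simps)
      finally show ?thesis by (simp add: abs_mult)
    qed
    have "\<bar>D 0 (r *\<^sub>R v) - r * D 0 v\<bar> \<le> 0" by (rule archimedean) (rule bound)
    then show ?thesis by simp
  qed
  show "D 0 (r *\<^sub>R v) = \<bar>r\<bar> * D 0 v"
  proof (cases "r \<ge> 0")
    case False
    have "D 0 (r *\<^sub>R v) = D 0 ((- r) *\<^sub>R v)" using transl[of "(- r) *\<^sub>R v" 0] sym[of 0 "(- r) *\<^sub>R v"] by simp
    with pos[of "- r" v] False show ?thesis by simp
  qed (simp add: pos)
qed

text \<open>In the coordinates given by height and the second affine function, \<open>d\<close>
  comes from a norm. By \<open>V\<close> the direction of \<open>(1, k1)\<close> attains the lower
  bound \<open>height\<close>, so after a shear it serves as the first basis vector of the Euclidean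
  plane, orthogonal to the levels. What remains is the law of cosines with inner product
  \<open>h\<close>.\<close>

lemma (in level_plane) right_triangle:
  assumes V: "d (0, 0) (1, k1) = 1"
  shows "(d (1, k1) (h, k2))\<^sup>2 = 1 - 2 * h + (d (0, 0) (h, k2))\<^sup>2"
proof -
  obtain \<delta> where \<delta>: "\<And>P Q M. d P M = d P Q / 2 \<Longrightarrow> d M Q = d P Q / 2 \<Longrightarrow>
      snd M + \<delta> (fst M) = ((snd P + \<delta> (fst P)) + (snd Q + \<delta> (fst Q))) / 2"
    "\<And>s s'. \<bar>\<delta> s - \<delta> s'\<bar> \<le> 3 * \<bar>s - s'\<bar>" "\<delta> 0 = 0" using second_affine_function by blast
  define e where "e u = (fst u, snd u - \<delta> (fst u))" for u :: "real \<times> real"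
  define D where "D u v = d (e u) (e v)" for u v
  \<comment> \<open>Three from \<open>lip\<close>, three from the Lipschitz bound on
    \<open>\<delta>\<close>, one from the second coordinate.\<close>
  have lip': "D u v \<le> 7 * norm (u - v)" for u v
  proof -
    have "D u v \<le> 3 * \<bar>fst u - fst v\<bar> + \<bar>snd u - \<delta> (fst u) - (snd v - \<delta> (fst v))\<bar>"
      using lip[of "e u" "e v"] by (simp add: D_def e_def)
    also have "\<dots> \<le> 6 * \<bar>fst u - fst v\<bar> + \<bar>snd u - snd v\<bar>" using \<delta>(2)[of "fst u" "fst v"] by linarith
    also have "\<dots> \<le> 7 * norm (u - v)"
      using norm_fst_le[of "fst (u - v)" "snd (u - v)"] norm_snd_le[of "snd (u - v)" "fst (u - v)"]
      by (cases u; cases v) simp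
    finally show ?thesis .
  qed
  have mid': "D u ((1/2) *\<^sub>R (u + v)) = D u v / 2" for u v
  proof -
    obtain k where k: "d (e u) ((fst u + fst v) / 2, k) = d (e u) (e v) / 2"
      "d ((fst u + fst v) / 2, k) (e v) = d (e u) (e v) / 2"
      using mid[of "e u" "e v"] by (auto simp: e_def)
    from \<delta>(1)[OF k] have "((fst u + fst v) / 2, k) = e ((1/2) *\<^sub>R (u + v))"
      by (simp add: e_def algebra_simps add_divide_distrib)
    with k(1) show ?thesis by (simp add: D_def)
  qed
  have norm: "D u v = D 0 (v - u)" "D 0 (r *\<^sub>R v) = \<bar>r\<bar> * D 0 v" for u v r
    using affine_midpoints_norm[of D 7] sym tri lip' mid' unfolding D_def by blast+
  define m where "m = k1 + \<delta> 1"
  \<comment> \<open>The slope \<open>m\<close> makes \<open>e (T (1, 0))\<close> the point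
    \<open>(1, k1)\<close>. The map is linear, so the norm survives it.\<close>
  define T where "T v = (fst v, snd v + m * fst v)" for v :: "real \<times> real"
  have T: "T (u + v) = T u + T v" "T (u - v) = T u - T v" "T (r *\<^sub>R v) = r *\<^sub>R T v" for u v r
    by (simp_all add: T_def algebra_simps prod_eq_iff)
  define N where "N v = D 0 (T v)" for v
  have D_N: "D (T u) (T v) = N (v - u)" for u v by (simp add: norm(1)[of "T u"] N_def T)
  have N_sym: "N (v - u) = N (u - v)" for u v using D_N[of u v] D_N[of v u] sym by (simp add: D_def)
  have e0: "e 0 = (0, 0)" by (simp add: e_def \<delta>(3) zero_prod_def)
  have euclidean: "N (s, k) = sqrt (s\<^sup>2 + k\<^sup>2)" for s k
  proof (rule ptolemaic_norm_euclidean)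
    fix r v show "N (r *\<^sub>R v) = \<bar>r\<bar> * N v" by (simp add: N_def T norm(2))
  next
    fix u v
    have "D 0 (T (u + v)) \<le> D 0 (T u) + D (T u) (T (u + v))" unfolding D_def by (rule tri)
    then show "N (u + v) \<le> N u + N v" using D_N[of u "u + v"] by (simp add: N_def)
  next
    fix x y z w
    show "N (x - y) * N (z - w) \<le> N (x - z) * N (y - w) + N (x - w) * N (y - z)"
      unfolding D_N[symmetric] unfolding D_def
      using ptol[of "e (T x)" "e (T y)" "e (T z)" "e (T w)"] sym[of "e (T x)" "e (T y)"]
        sym[of "e (T z)" "e (T w)"] sym[of "e (T x)" "e (T z)"] sym[of "e (T y)" "e (T w)"]
        sym[of "e (T x)" "e (T w)"] sym[of "e (T y)" "e (T z)"] by simp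
  next
    have "e (T (1, 0)) = (1, k1)" by (simp add: e_def T_def m_def)
    then show "N (1, 0) = 1" using V by (simp add: N_def D_def e0)
    show "N (0, 1) = 1" by (simp add: N_def D_def e0 e_def T_def \<delta>(3) level)
  next
    fix s k show "\<bar>s\<bar> \<le> N (s, k)" using height[of "e 0" "e (T (s, k))"] by (simp add: N_def D_def e_def T_def)
  qed
  define \<omega> where "\<omega> = k2 + \<delta> h - m * h"
  have "e (T (h, \<omega>)) = (h, k2)" "e (T (1, 0)) = (1, k1)" by (simp_all add: e_def T_def m_def \<omega>_def)
  then have "d (1, k1) (h, k2) = N ((h, \<omega>) - (1, 0))" "d (0, 0) (h, k2) = N (h, \<omega>)"
    using D_N[of "(1, 0)" "(h, \<omega>)"] by (simp_all add: D_def N_def e0)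
  then have "(d (1, k1) (h, k2))\<^sup>2 = (h - 1)\<^sup>2 + \<omega>\<^sup>2" "(d (0, 0) (h, k2))\<^sup>2 = h\<^sup>2 + \<omega>\<^sup>2"
    by (simp_all add: euclidean)
  then show ?thesis by (simp add: power2_eq_square algebra_simps)
qed

section \<open>Cluster points of functions\<close>

text \<open>The filter is refined by the neighbourhoods of a cluster point \<open>L\<close>, pulled
  back along \<open>f\<close>; it stays nontrivial because \<open>L\<close> is a cluster
  point.\<close>

lemma filter_cluster:
  fixes f :: "'x \<Rightarrow> 'b::topological_space"
  assumes "compact K" "F \<noteq> bot" "\<forall>\<^sub>F x in F. f x \<in> K"
  obtains G L where "G \<le> F" "G \<noteq> bot" "L \<in> K" "(f \<longlongrightarrow> L) G"
proof -
  have "filtermap f F \<noteq> bot" "\<forall>\<^sub>F y in filtermap f F. y \<in> K"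
    using assms(2,3) by (simp_all add: filtermap_bot_iff eventually_filtermap)
  then obtain L where L: "L \<in> K" "inf (nhds L) (filtermap f F) \<noteq> bot"
    using assms(1) unfolding compact_filter by blast
  show thesis
  proof (rule that[of "inf F (filtercomap f (nhds L))" L])
    show "inf F (filtercomap f (nhds L)) \<noteq> bot"
    proof
      assume "inf F (filtercomap f (nhds L)) = bot"
      then obtain P Q where PQ: "eventually P F" "eventually Q (nhds L)" "\<And>x. P x \<Longrightarrow> \<not> Q (f x)"
        unfolding trivial_limit_def eventually_inf eventually_filtercomap by blast
      have "eventually (\<lambda>y. \<not> Q y) (filtermap f F)"
        unfolding eventually_filtermap using PQ(1) by (rule eventually_mono) (rule PQ(3))
      with PQ(2) have "eventually (\<lambda>_. False) (inf (nhds L) (filtermap f F))"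
        unfolding eventually_inf by blast
      with L(2) show False by (simp add: trivial_limit_def)
    qed
    show "(f \<longlongrightarrow> L) (inf F (filtercomap f (nhds L)))"
      by (rule filterlim_mono[OF filterlim_filtercomap order_refl inf_le2])
  qed (use L in auto)
qed

text \<open>Tychonoff's theorem gives one filter for all indices. It is applied to all pairs of
  points of a plane and to all real heights, too many for a diagonal subsequence.\<close>

lemma function_cluster:
  fixes f :: "'x \<Rightarrow> 'i \<Rightarrow> 'b::topological_space"
  assumes K: "\<And>i. compact (K i)" and F: "F \<noteq> bot" and ev: "\<And>i. \<forall>\<^sub>F x in F. f x i \<in> K i"
  obtains G L where "G \<le> F" "G \<noteq> bot" "\<And>i. L i \<in> K i" "\<And>i. ((\<lambda>x. f x i) \<longlongrightarrow> L i) G"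
proof -
  have "K i \<noteq> {}" for i
  proof
    assume "K i = {}"
    with ev[of i] F show False by (simp add: trivial_limit_def)
  qed
  then have "\<forall>i. \<exists>e. e \<in> K i" by blast
  from choice[OF this] obtain e where e: "\<And>i. e i \<in> K i" by blast
  \<comment> \<open>Values lie in \<open>K i\<close> eventually, but not uniformly in
    \<open>i\<close>. The default \<open>e i\<close> puts every \<open>g x\<close> into the
    product.\<close>
  define g where "g x i = (if f x i \<in> K i then f x i else e i)" for x i
  have "compactin (product_topology (\<lambda>_. euclidean) UNIV) (PiE UNIV K)"
    unfolding compactin_PiE using K by (simp add: compactin_euclidean_iff)
  then have "compact (PiE UNIV K)" by (simp add: euclidean_product_topology)
  moreover have "\<forall>\<^sub>F x in F. g x \<in> PiE UNIV K" using e by (auto simp: g_def intro!: always_eventually)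
  ultimately obtain G L where G: "G \<le> F" "G \<noteq> bot" "L \<in> PiE UNIV K" "(g \<longlongrightarrow> L) G"
    using F by (rule_tac filter_cluster)
  show thesis
  proof (rule that[OF G(1,2)])
    fix i show "L i \<in> K i" using G(3) by auto
    have "continuous_on UNIV (\<lambda>h :: 'i \<Rightarrow> 'b. h i)"
      by (rule continuous_on_product_then_coordinatewise[OF continuous_on_id])
    then have lim: "((\<lambda>x. g x i) \<longlongrightarrow> L i) G"
      by (rule continuous_on_tendsto_compose[OF _ G(4)]) auto
    have "\<forall>\<^sub>F x in G. f x i = g x i"
      using filter_leD[OF G(1) ev[of i]] by (rule eventually_mono) (simp add: g_def)
    with lim show "((\<lambda>x. f x i) \<longlongrightarrow> L i) G" by (simp add: tendsto_cong)
  qed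
qed

section \<open>Strips foliated by level segments\<close>

text \<open>The height will be 1-Lipschitz, so these are the geodesic lines on which it grows as
  fast as possible, parametrized by height.\<close>

definition vertical_line :: "'a::metric_space set \<Rightarrow> ('a \<Rightarrow> real) \<Rightarrow> (real \<Rightarrow> 'a) \<Rightarrow> bool" where
  "vertical_line Z \<beta> l \<longleftrightarrow> (\<forall>t. l t \<in> Z \<and> \<beta> (l t) = t) \<and> (\<forall>s t. dist (l s) (l t) = \<bar>s - t\<bar>)"

text \<open>The height \<open>\<beta>\<close> is the Busemann function of the lines \<open>c0\<close> and \<open>c1\<close>. Its level sets are segments
  from \<open>c0\<close> to \<open>c1\<close>, but nothing is assumed on how their lengths vary.\<close>

locale strip =
  fixes Z :: "'a::metric_space set" and \<beta> :: "'a \<Rightarrow> real" and c0 c1 :: "real \<Rightarrow> 'a"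
  assumes ptol: "ptolemaic Z"
    and height: "x \<in> Z \<Longrightarrow> y \<in> Z \<Longrightarrow> \<bar>\<beta> x - \<beta> y\<bar> \<le> dist x y"
    and between: "x \<in> Z \<Longrightarrow> y \<in> Z \<Longrightarrow> 0 \<le> r \<Longrightarrow> r \<le> 1 \<Longrightarrow>
      \<exists>m\<in>Z. dist x m = r * dist x y \<and> dist m y = (1 - r) * dist x y \<and> \<beta> m = (1 - r) * \<beta> x + r * \<beta> y"
    and c0: "vertical_line Z \<beta> c0" and c1: "vertical_line Z \<beta> c1"
    and c01: "c0 t \<noteq> c1 t"
    and level_sum: "x \<in> Z \<Longrightarrow> dist x (c0 (\<beta> x)) + dist x (c1 (\<beta> x)) = dist (c0 (\<beta> x)) (c1 (\<beta> x))"
    and level_dist: "x \<in> Z \<Longrightarrow> y \<in> Z \<Longrightarrow> \<beta> x = \<beta> y \<Longrightarrow>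
      dist x y = \<bar>dist x (c0 (\<beta> x)) - dist y (c0 (\<beta> x))\<bar>"
    and level_ex: "0 \<le> h \<Longrightarrow> h \<le> dist (c0 t) (c1 t) \<Longrightarrow> \<exists>x\<in>Z. \<beta> x = t \<and> dist x (c0 t) = h"
    and line_ex: "x \<in> Z \<Longrightarrow> \<exists>l. vertical_line Z \<beta> l \<and> l (\<beta> x) = x"
begin

definition y where "y x = dist x (c0 (\<beta> x))"
definition w where "w t = dist (c0 t) (c1 t)"
definition interior_point where "interior_point x \<longleftrightarrow> x \<in> Z \<and> 0 < y x \<and> y x < w (\<beta> x)"

lemma ptolemy:
  "a \<in> Z \<Longrightarrow> b \<in> Z \<Longrightarrow> c \<in> Z \<Longrightarrow> d \<in> Z \<Longrightarrow> dist a b * dist c d \<le> dist a c * dist b d + dist a d * dist b c"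
  using ptol unfolding ptolemaic_def by blast

lemma vlineD:
  assumes "vertical_line Z \<beta> l"
  shows "l t \<in> Z" "\<beta> (l t) = t" "dist (l s) (l t) = \<bar>s - t\<bar>"
  using assms by (auto simp: vertical_line_def)

lemmas c0D = vlineD[OF c0] and c1D = vlineD[OF c1]

text \<open>Every estimate proved for increasing height has a counterpart for decreasing height
  through this instance.\<close>

lemma reverse: "strip Z (\<lambda>x. - \<beta> x) (\<lambda>t. c0 (- t)) (\<lambda>t. c1 (- t))"
proof unfold_locales
  have vl: "vertical_line Z (\<lambda>x. - \<beta> x) (\<lambda>t. l (- t))" if "vertical_line Z \<beta> l" for l
    using vlineD[OF that] by (auto simp: vertical_line_def abs_minus_commute)
  show "vertical_line Z (\<lambda>x. - \<beta> x) (\<lambda>t. c0 (- t))" "vertical_line Z (\<lambda>x. - \<beta> x) (\<lambda>t. c1 (- t))"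
    by (intro vl c0 c1)+
  show "\<exists>l. vertical_line Z (\<lambda>x. - \<beta> x) l \<and> l (- \<beta> x) = x" if x: "x \<in> Z" for x
  proof -
    obtain l where "vertical_line Z \<beta> l" "l (\<beta> x) = x" using line_ex[OF x] by blast
    then show ?thesis using vl by (intro exI[of _ "\<lambda>t. l (- t)"]) auto
  qed
  show "\<exists>m\<in>Z. dist x m = r * dist x y \<and> dist m y = (1 - r) * dist x y \<and> - \<beta> m = (1 - r) * - \<beta> x + r * - \<beta> y"
    if xy: "x \<in> Z" "y \<in> Z" "0 \<le> r" "r \<le> 1" for x y r
  proof -
    obtain m where m: "m \<in> Z" "dist x m = r * dist x y" "dist m y = (1 - r) * dist x y" "\<beta> m = (1 - r) * \<beta> x + r * \<beta> y"
      using between[OF xy] by blast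
    then show ?thesis by (intro bexI[of _ m]) simp_all
  qed
  show "\<exists>x\<in>Z. - \<beta> x = t \<and> dist x (c0 (- t)) = h" if h: "0 \<le> h" "h \<le> dist (c0 (- t)) (c1 (- t))" for h t
  proof -
    obtain x where "x \<in> Z" "\<beta> x = - t" "dist x (c0 (- t)) = h" using level_ex[OF h] by blast
    then show ?thesis by (intro bexI[of _ x]) simp_all
  qed
  show "\<bar>- \<beta> x - - \<beta> y\<bar> \<le> dist x y" if "x \<in> Z" "y \<in> Z" for x y
    using height[OF that] by simp
qed (use ptol c01 level_sum level_dist in auto)

text \<open>Exchanging the boundary lines replaces \<open>y\<close> by the complementary distance
  \<open>w - y\<close>, so constancy of \<open>y\<close> also yields constancy of
  \<open>w\<close>.\<close>

lemma swap: "strip Z \<beta> c1 c0"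
proof unfold_locales
  have flip: "dist x (c0 (\<beta> x)) = w (\<beta> x) - dist x (c1 (\<beta> x))" if "x \<in> Z" for x
    using level_sum[OF that] by (simp add: w_def)
  show "c1 t \<noteq> c0 t" for t using c01[of t] by metis
  show "dist x (c1 (\<beta> x)) + dist x (c0 (\<beta> x)) = dist (c1 (\<beta> x)) (c0 (\<beta> x))" if "x \<in> Z" for x
    using level_sum[OF that] by (simp add: dist_commute)
  show "dist x y = \<bar>dist x (c1 (\<beta> x)) - dist y (c1 (\<beta> x))\<bar>" if "x \<in> Z" "y \<in> Z" "\<beta> x = \<beta> y" for x y
    using level_dist[OF that] flip[OF that(1)] flip[OF that(2)] that(3) by simp
  show "\<exists>x\<in>Z. \<beta> x = t \<and> dist x (c1 t) = h" if h: "0 \<le> h" "h \<le> dist (c1 t) (c0 t)" for h t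
  proof -
    have "0 \<le> w t - h" "w t - h \<le> w t" using h by (simp_all add: w_def dist_commute)
    then obtain x where x: "x \<in> Z" "\<beta> x = t" "dist x (c0 t) = w t - h"
      using level_ex[of "w t - h" t] unfolding w_def by blast
    then show ?thesis using flip[OF x(1)] by (intro bexI[of _ x]) simp_all
  qed
qed (fact ptol height between c0 c1 line_ex)+

lemma y_bounds: "x \<in> Z \<Longrightarrow> 0 \<le> y x \<and> y x \<le> w (\<beta> x)"
  unfolding y_def w_def using level_sum[of x] zero_le_dist[of x "c1 (\<beta> x)"]
  by (intro conjI zero_le_dist) linarith

lemma dist_level: "x \<in> Z \<Longrightarrow> x' \<in> Z \<Longrightarrow> \<beta> x = \<beta> x' \<Longrightarrow> dist x x' = \<bar>y x - y x'\<bar>"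
  using level_dist[of x x'] by (simp add: y_def)

lemma point_ex: "0 \<le> h \<Longrightarrow> h \<le> w t \<Longrightarrow> \<exists>x\<in>Z. \<beta> x = t \<and> y x = h"
  using level_ex[of h t] by (auto simp: y_def w_def)

lemma y_lip: "\<bar>y x - y x'\<bar> \<le> dist x x' + \<bar>\<beta> x - \<beta> x'\<bar>"
proof -
  have "\<bar>dist x (c0 (\<beta> x)) - dist x' (c0 (\<beta> x'))\<bar> \<le> dist x x' + dist (c0 (\<beta> x)) (c0 (\<beta> x'))"
    by metric
  then show ?thesis by (simp add: y_def c0D)
qed

lemma y_lip2: "x \<in> Z \<Longrightarrow> x' \<in> Z \<Longrightarrow> \<bar>y x - y x'\<bar> \<le> 2 * dist x x'"
  using y_lip[of x x'] height[of x x'] by linarith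

lemma w_lip: "\<bar>w t - w s\<bar> \<le> 2 * \<bar>t - s\<bar>"
proof -
  have "\<bar>dist (c0 t) (c1 t) - dist (c0 s) (c1 s)\<bar> \<le> dist (c0 t) (c0 s) + dist (c1 t) (c1 s)"
    by metric
  then show ?thesis by (simp add: w_def c0D c1D)
qed

lemma w_pos: "0 < w t" using c01[of t] by (simp add: w_def)

text \<open>Walk from \<open>x\<close> along a vertical line to the level of \<open>x'\<close>, then
  along that level. The walk costs the height difference once and changes \<open>y\<close> by at
  most twice that amount, whence the factor 3.\<close>

lemma dist_upper:
  assumes "x \<in> Z" "x' \<in> Z"
  shows "dist x x' \<le> 3 * \<bar>\<beta> x - \<beta> x'\<bar> + \<bar>y x - y x'\<bar>"
proof -
  obtain l where l: "vertical_line Z \<beta> l" "l (\<beta> x) = x" using line_ex[OF assms(1)] by blast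
  note lD = vlineD[OF l(1)]
  have d: "dist x (l (\<beta> x')) = \<bar>\<beta> x - \<beta> x'\<bar>" using lD(3)[of "\<beta> x" "\<beta> x'"] l(2) by simp
  have "dist x x' \<le> dist x (l (\<beta> x')) + dist (l (\<beta> x')) x'" by (rule dist_triangle)
  moreover have "dist (l (\<beta> x')) x' = \<bar>y (l (\<beta> x')) - y x'\<bar>" using lD assms(2) by (intro dist_level) auto
  moreover have "\<bar>y x - y (l (\<beta> x'))\<bar> \<le> 2 * \<bar>\<beta> x - \<beta> x'\<bar>"
    using y_lip2[of x "l (\<beta> x')"] d assms(1) lD(1) by simp
  ultimately show ?thesis using d by (smt (verit))
qed

lemma eq_point: "x \<in> Z \<Longrightarrow> x' \<in> Z \<Longrightarrow> \<beta> x = \<beta> x' \<Longrightarrow> y x = y x' \<Longrightarrow> x = x'"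
  using dist_level[of x x'] by simp

section \<open>Blow-ups at interior points\<close>

text \<open>Distances near \<open>z\<close> divided by \<open>\<tau> n\<close> cluster at a metric
  \<open>D\<close> on the plane that satisfies \<open>level_plane\<close>. Heights of
  \<open>z'\<close> and \<open>x\<close> and their distances from \<open>z\<close> are exact
  multiples of \<open>\<tau> n\<close>, so only second coordinates need a limit before
  \<open>right_triangle\<close> applies.\<close>

lemma blowup_pythagoras:
  assumes z: "interior_point z"
    and \<tau>: "\<And>n. \<tau> n > 0" "\<tau> \<longlonglongrightarrow> 0"
    and z': "\<And>n. z' n \<in> Z" "\<And>n. \<beta> (z' n) = \<beta> z + \<tau> n" "\<And>n. dist z (z' n) = \<tau> n"
    and x: "\<And>n. x n \<in> Z" "\<And>n. \<beta> (x n) = \<beta> z + h * \<tau> n" "\<And>n. dist z (x n) = K * \<tau> n"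
    and far: "\<And>n. dist (z' n) (x n) \<ge> \<tau> n * c"
  shows "c \<le> sqrt (1 - 2 * h + K\<^sup>2)"
proof -
  \<comment> \<open>The rescaled coordinates \<open>P\<close> denote a point of the strip. As
    \<open>z\<close> is interior, every fixed \<open>P\<close> is valid for large \<open>n\<close>,
    and \<open>p n P\<close> is then that point.\<close>
  define valid where "valid n P \<longleftrightarrow> 0 \<le> y z + \<tau> n * snd P \<and> y z + \<tau> n * snd P \<le> w (\<beta> z + \<tau> n * fst P)" for n P
  have valid: "\<forall>\<^sub>F n in sequentially. valid n P" for P
  proof -
    have "(\<lambda>n. y z + \<tau> n * snd P) \<longlonglongrightarrow> y z + 0 * snd P" by (intro tendsto_intros \<tau>)
    then have "\<forall>\<^sub>F n in sequentially. 0 < y z + \<tau> n * snd P"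
      using z by (intro order_tendstoD(1)) (auto simp: interior_point_def)
    moreover have "(\<lambda>n. y z + \<tau> n * snd P + 2 * \<bar>\<tau> n * fst P\<bar>) \<longlonglongrightarrow> y z + 0 * snd P + 2 * \<bar>0 * fst P\<bar>"
      by (intro tendsto_intros \<tau>)
    then have "\<forall>\<^sub>F n in sequentially. y z + \<tau> n * snd P + 2 * \<bar>\<tau> n * fst P\<bar> < w (\<beta> z)"
      using z by (intro order_tendstoD(2)) (auto simp: interior_point_def)
    ultimately show ?thesis
    proof eventually_elim
      case (elim n)
      then show ?case using w_lip[of "\<beta> z + \<tau> n * fst P" "\<beta> z"] by (auto simp: valid_def)
    qed
  qed
  define p where "p n P = (SOME q. q \<in> Z \<and> \<beta> q = \<beta> z + \<tau> n * fst P \<and> y q = y z + \<tau> n * snd P)" for n P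
  have p: "p n P \<in> Z" "\<beta> (p n P) = \<beta> z + \<tau> n * fst P" "y (p n P) = y z + \<tau> n * snd P" if "valid n P" for n P
  proof -
    have "\<exists>q. q \<in> Z \<and> \<beta> q = \<beta> z + \<tau> n * fst P \<and> y q = y z + \<tau> n * snd P"
      using point_ex that unfolding valid_def by blast
    from someI_ex[OF this] show "p n P \<in> Z" "\<beta> (p n P) = \<beta> z + \<tau> n * fst P" "y (p n P) = y z + \<tau> n * snd P"
      unfolding p_def by blast+
  qed
  define d where "d n PQ = dist (p n (fst PQ)) (p n (snd PQ)) / \<tau> n" for n PQ
  have d_le: "d n (P, Q) \<le> 3 * \<bar>fst P - fst Q\<bar> + \<bar>snd P - snd Q\<bar>" if "valid n P" "valid n Q" for n P Q
  proof -
    have "dist (p n P) (p n Q) \<le> 3 * \<bar>\<tau> n * (fst P - fst Q)\<bar> + \<bar>\<tau> n * (snd P - snd Q)\<bar>"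
      using dist_upper[OF p(1)[OF that(1)] p(1)[OF that(2)]] p(2,3)[OF that(1)] p(2,3)[OF that(2)]
      by (simp add: algebra_simps)
    also have "\<dots> = \<tau> n * (3 * \<bar>fst P - fst Q\<bar> + \<bar>snd P - snd Q\<bar>)"
      using \<tau>(1)[of n] by (simp add: abs_mult distrib_left mult.left_commute)
    finally show ?thesis using \<tau>(1)[of n] by (simp add: d_def pos_divide_le_eq mult.commute)
  qed
  obtain G D0 where G: "G \<le> sequentially" "G \<noteq> bot" and D0: "\<And>PQ. ((\<lambda>n. d n PQ) \<longlongrightarrow> D0 PQ) G"
  proof (rule function_cluster[of "\<lambda>PQ. {0..3 * \<bar>fst (fst PQ) - fst (snd PQ)\<bar> + \<bar>snd (fst PQ) - snd (snd PQ)\<bar>}" sequentially d])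
    fix PQ :: "(real \<times> real) \<times> real \<times> real"
    show "\<forall>\<^sub>F n in sequentially. d n PQ \<in> {0..3 * \<bar>fst (fst PQ) - fst (snd PQ)\<bar> + \<bar>snd (fst PQ) - snd (snd PQ)\<bar>}"
      using valid[of "fst PQ"] valid[of "snd PQ"]
    proof eventually_elim
      case (elim n)
      then show ?case using d_le[of n "fst PQ" "snd PQ"] \<tau>(1)[of n] by (simp add: d_def)
    qed
  qed auto
  define D where "D P Q = D0 (P, Q)" for P Q
  have D: "((\<lambda>n. dist (p n P) (p n Q) / \<tau> n) \<longlongrightarrow> D P Q) G" for P Q
    using D0[of "(P, Q)"] by (simp add: d_def D_def)
  have evG: "eventually R G" if "eventually R sequentially" for R using that filter_leD[OF G(1)] by blast
  \<comment> \<open>Two points of one level differ by the difference of their second coordinates. So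
    a sequence of the right height whose rescaled second coordinate converges may replace the
    reference points \<open>p n\<close> in the limit.\<close>
  have lim: "((\<lambda>n. dist (u n) (v n) / \<tau> n) \<longlongrightarrow> D (s, k) (s', k')) G'"
    if G': "G' \<le> G" and u: "\<And>n. u n \<in> Z" "\<And>n. \<beta> (u n) = \<beta> z + \<tau> n * s" "((\<lambda>n. (y (u n) - y z) / \<tau> n) \<longlongrightarrow> k) G'"
      and v: "\<And>n. v n \<in> Z" "\<And>n. \<beta> (v n) = \<beta> z + \<tau> n * s'" "((\<lambda>n. (y (v n) - y z) / \<tau> n) \<longlongrightarrow> k') G'"
    for G' u v s s' k k'
  proof -
    have near: "((\<lambda>n. dist (p n (s, k)) (u n) / \<tau> n) \<longlongrightarrow> 0) G'"
      if u: "\<And>n. u n \<in> Z" "\<And>n. \<beta> (u n) = \<beta> z + \<tau> n * s" "((\<lambda>n. (y (u n) - y z) / \<tau> n) \<longlongrightarrow> k) G'" for u s k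
    proof -
      have "\<forall>\<^sub>F n in G'. dist (p n (s, k)) (u n) / \<tau> n = \<bar>k - (y (u n) - y z) / \<tau> n\<bar>"
        using filter_leD[OF G' evG[OF valid[of "(s, k)"]]]
      proof eventually_elim
        case (elim n)
        have "dist (p n (s, k)) (u n) = \<bar>y z + \<tau> n * k - y (u n)\<bar>"
          using dist_level[OF p(1)[OF elim] u(1)] p(2,3)[OF elim] u(2) by simp
        also have "\<dots> = \<bar>\<tau> n * (k - (y (u n) - y z) / \<tau> n)\<bar>"
        proof -
          have "\<tau> n * ((y (u n) - y z) / \<tau> n) = y (u n) - y z" using \<tau>(1)[of n] by simp
          then show ?thesis unfolding right_diff_distrib by simp
        qed
        finally show ?case using \<tau>(1)[of n] by (simp add: abs_mult)
      qed
      moreover have "((\<lambda>n. \<bar>k - (y (u n) - y z) / \<tau> n\<bar>) \<longlongrightarrow> \<bar>k - k\<bar>) G'" by (intro tendsto_intros u)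
      ultimately show ?thesis by (simp add: tendsto_cong)
    qed
    have "((\<lambda>n. dist (p n (s, k)) (p n (s', k')) / \<tau> n
        + (dist (p n (s, k)) (u n) / \<tau> n + dist (p n (s', k')) (v n) / \<tau> n)) \<longlongrightarrow> D (s, k) (s', k') + (0 + 0)) G'"
      by (intro tendsto_add near u v filterlim_mono[OF D order_refl G'])
    moreover have "((\<lambda>n. dist (p n (s, k)) (p n (s', k')) / \<tau> n
        - (dist (p n (s, k)) (u n) / \<tau> n + dist (p n (s', k')) (v n) / \<tau> n)) \<longlongrightarrow> D (s, k) (s', k') - (0 + 0)) G'"
      by (intro tendsto_diff tendsto_add near u v filterlim_mono[OF D order_refl G'])
    ultimately show ?thesis
    proof (rule_tac tendsto_sandwich)
      have "dist (p n (s, k)) (p n (s', k')) - (dist (p n (s, k)) (u n) + dist (p n (s', k')) (v n)) \<le> dist (u n) (v n)" for n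
        by metric
      then show "\<forall>\<^sub>F n in G'. dist (p n (s, k)) (p n (s', k')) / \<tau> n
          - (dist (p n (s, k)) (u n) / \<tau> n + dist (p n (s', k')) (v n) / \<tau> n) \<le> dist (u n) (v n) / \<tau> n"
        using \<tau>(1) by (intro always_eventually allI)
          (simp add: divide_right_mono less_imp_le flip: add_divide_distrib diff_divide_distrib)
      have "dist (u n) (v n) \<le> dist (p n (s, k)) (p n (s', k')) + (dist (p n (s, k)) (u n) + dist (p n (s', k')) (v n))" for n
        by metric
      then show "\<forall>\<^sub>F n in G'. dist (u n) (v n) / \<tau> n \<le> dist (p n (s, k)) (p n (s', k')) / \<tau> n
          + (dist (p n (s, k)) (u n) / \<tau> n + dist (p n (s', k')) (v n) / \<tau> n)"
        using \<tau>(1) by (intro always_eventually allI)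
          (simp add: divide_right_mono less_imp_le flip: add_divide_distrib diff_divide_distrib)
    qed (simp_all)
  qed
  have le: "a \<le> b" if "((\<lambda>n. f n) \<longlongrightarrow> a) G" "((\<lambda>n. g n) \<longlongrightarrow> b) G" "\<forall>\<^sub>F n in sequentially. f n \<le> g n"
    for a b :: real and f g
    by (rule tendsto_le[OF G(2) that(2,1) evG[OF that(3)]])
  have level_plane: "level_plane D"
  proof
    fix P Q R S
    show "D P Q = D Q P" using tendsto_unique[OF G(2) D[of P Q] D[of Q P, unfolded dist_commute[of "p _ Q"]]] .
    show "D P R \<le> D P Q + D Q R"
      by (rule le[OF D tendsto_add[OF D D]])
        (use \<tau>(1) dist_triangle in \<open>auto intro!: always_eventually divide_right_mono simp: less_imp_le simp flip: add_divide_distrib\<close>)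
    show "\<bar>fst P - fst Q\<bar> \<le> D P Q"
    proof (rule le[OF tendsto_const D])
      show "\<forall>\<^sub>F n in sequentially. \<bar>fst P - fst Q\<bar> \<le> dist (p n P) (p n Q) / \<tau> n"
        using valid[of P] valid[of Q]
      proof eventually_elim
        case (elim n)
        have "\<bar>\<tau> n * (fst P - fst Q)\<bar> \<le> dist (p n P) (p n Q)"
          using height[OF p(1)[OF elim(1)] p(1)[OF elim(2)]] p(2)[OF elim(1)] p(2)[OF elim(2)]
          by (simp add: algebra_simps)
        then show ?case using \<tau>(1)[of n] by (simp add: abs_mult pos_le_divide_eq mult.commute)
      qed
    qed
    show "D P Q \<le> 3 * \<bar>fst P - fst Q\<bar> + \<bar>snd P - snd Q\<bar>"
    proof (rule le[OF D tendsto_const])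
      show "\<forall>\<^sub>F n in sequentially. dist (p n P) (p n Q) / \<tau> n \<le> 3 * \<bar>fst P - fst Q\<bar> + \<bar>snd P - snd Q\<bar>"
        using valid[of P] valid[of Q] by eventually_elim (use d_le in \<open>simp add: d_def\<close>)
    qed
    show "D P Q * D R S \<le> D P R * D Q S + D P S * D Q R"
    proof (rule le[OF tendsto_mult[OF D D] tendsto_add[OF tendsto_mult[OF D D] tendsto_mult[OF D D]]])
      show "\<forall>\<^sub>F n in sequentially. dist (p n P) (p n Q) / \<tau> n * (dist (p n R) (p n S) / \<tau> n) \<le>
        dist (p n P) (p n R) / \<tau> n * (dist (p n Q) (p n S) / \<tau> n) + dist (p n P) (p n S) / \<tau> n * (dist (p n Q) (p n R) / \<tau> n)"
        using valid[of P] valid[of Q] valid[of R] valid[of S]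
      proof eventually_elim
        case (elim n)
        then show ?case using ptolemy[OF p(1) p(1) p(1) p(1), of n P n Q n R n S] \<tau>(1)[of n]
          by (simp add: divide_right_mono flip: add_divide_distrib)
      qed
    qed
    \<comment> \<open>Midpoints of the approximating pairs have the right height and bounded
      rescaled second coordinates. A finer filter makes the latter converge, to the required
      \<open>k\<close>, without changing \<open>D\<close>.\<close>
    show "\<exists>k. D P ((fst P + fst Q) / 2, k) = D P Q / 2 \<and> D ((fst P + fst Q) / 2, k) Q = D P Q / 2"
    proof -
      have "\<exists>m. valid n P \<longrightarrow> valid n Q \<longrightarrow> m \<in> Z \<and> dist (p n P) m = dist (p n P) (p n Q) / 2 \<and>
          dist m (p n Q) = dist (p n P) (p n Q) / 2 \<and> \<beta> m = \<beta> z + \<tau> n * ((fst P + fst Q) / 2)" for n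
      proof (cases "valid n P \<and> valid n Q")
        case True
        then obtain m where "m \<in> Z" "dist (p n P) m = 1/2 * dist (p n P) (p n Q)"
          "dist m (p n Q) = (1 - 1/2) * dist (p n P) (p n Q)" "\<beta> m = (1 - 1/2) * \<beta> (p n P) + 1/2 * \<beta> (p n Q)"
          using between[of "p n P" "p n Q" "1/2"] p(1) by auto
        moreover from this have "\<beta> m = \<beta> z + \<tau> n * ((fst P + fst Q) / 2)"
          using p(2)[of n P] p(2)[of n Q] True by (simp add: field_simps)
        ultimately show ?thesis by (intro exI[of _ m]) simp
      qed auto
      then obtain m where m: "\<And>n. valid n P \<Longrightarrow> valid n Q \<Longrightarrow> m n \<in> Z \<and> dist (p n P) (m n) = dist (p n P) (p n Q) / 2 \<and>
          dist (m n) (p n Q) = dist (p n P) (p n Q) / 2 \<and> \<beta> (m n) = \<beta> z + \<tau> n * ((fst P + fst Q) / 2)"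
        by metis
      define B where "B = 3 * \<bar>fst P - fst Q\<bar> + \<bar>snd P - snd Q\<bar>"
      have "\<forall>\<^sub>F n in sequentially. (y (m n) - y z) / \<tau> n \<in> {snd P - B..snd P + B}"
        using valid[of P] valid[of Q]
      proof eventually_elim
        case (elim n)
        have "\<bar>y (m n) - y (p n P)\<bar> \<le> dist (p n P) (p n Q)"
          using y_lip2[of "m n" "p n P"] m[OF elim] p(1)[OF elim(1)] by (simp add: dist_commute)
        also have "\<dots> \<le> \<tau> n * B" using d_le[OF elim] \<tau>(1)[of n] by (simp add: d_def B_def pos_divide_le_eq mult.commute)
        finally have "\<bar>y (m n) - y z - \<tau> n * snd P\<bar> \<le> \<tau> n * B" using p(3)[OF elim(1)] by (simp add: algebra_simps)
        then have "y (m n) - y z \<le> \<tau> n * (snd P + B)" "\<tau> n * (snd P - B) \<le> y (m n) - y z"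
          by (simp_all add: abs_le_iff algebra_simps)
        then show ?case using \<tau>(1)[of n] by (simp add: pos_divide_le_eq pos_le_divide_eq mult.commute)
      qed
      note evB = this
      obtain G' k where G': "G' \<le> G" "G' \<noteq> bot" "((\<lambda>n. (y (m n) - y z) / \<tau> n) \<longlongrightarrow> k) G'"
      proof -
        show thesis by (rule filter_cluster[OF compact_Icc G(2) evG[OF evB]]) (rule that)
      qed
      define M where "M = ((fst P + fst Q) / 2, k)"
      text \<open>Off the good indices the sequences are replaced by arbitrary points of the right height.\<close>
      define c where "c s n = c0 (\<beta> z + \<tau> n * s)" for s n
      define u where "u n = (if valid n P \<and> valid n Q then m n else c ((fst P + fst Q) / 2) n)" for n
      define p' where "p' R n = (if valid n R then p n R else c (fst R) n)" for R n
      have good: "\<forall>\<^sub>F n in G'. valid n R" for R by (rule filter_leD[OF G'(1) evG[OF valid]])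
      have u: "u n \<in> Z" "\<beta> (u n) = \<beta> z + \<tau> n * ((fst P + fst Q) / 2)" for n
        using m[of n] by (auto simp: u_def c_def c0D)
      have "\<forall>\<^sub>F n in G'. (y (m n) - y z) / \<tau> n = (y (u n) - y z) / \<tau> n"
        using good[of P] good[of Q] by eventually_elim (simp add: u_def)
      from Lim_transform_eventually[OF G'(3) this] have u3: "((\<lambda>n. (y (u n) - y z) / \<tau> n) \<longlongrightarrow> k) G'" .
      have p': "p' R n \<in> Z" "\<beta> (p' R n) = \<beta> z + \<tau> n * fst R" for R n
        using p[of n R] by (auto simp: p'_def c_def c0D)
      have p'3: "((\<lambda>n. (y (p' R n) - y z) / \<tau> n) \<longlongrightarrow> snd R) G'" for R
      proof -
        have "\<forall>\<^sub>F n in G'. snd R = (y (p' R n) - y z) / \<tau> n"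
          using good[of R]
        proof eventually_elim
          case (elim n) then show ?case using p(3)[OF elim] \<tau>(1)[of n] by (simp add: p'_def)
        qed
        from Lim_transform_eventually[OF tendsto_const this] show ?thesis .
      qed
      have half: "((\<lambda>n. dist (p n P) (p n Q) / \<tau> n / 2) \<longlongrightarrow> D P Q / 2) G'"
        by (intro tendsto_divide filterlim_mono[OF D order_refl G'(1)] tendsto_const) simp
      have a: "((\<lambda>n. dist (p' P n) (u n) / \<tau> n) \<longlongrightarrow> D P M) G'"
        using lim[OF G'(1) p'[of P] p'3[of P] u u3] by (simp add: M_def)
      have "\<forall>\<^sub>F n in G'. dist (p' P n) (u n) / \<tau> n = dist (p n P) (p n Q) / \<tau> n / 2"
        using good[of P] good[of Q]
      proof eventually_elim
        case (elim n)
        then have "dist (p' P n) (u n) = dist (p n P) (p n Q) / 2" using m[OF elim] by (simp add: p'_def u_def)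
        then show ?case by (simp only:) simp
      qed
      from tendsto_unique[OF G'(2) Lim_transform_eventually[OF a this] half] have 1: "D P M = D P Q / 2" .
      have b: "((\<lambda>n. dist (u n) (p' Q n) / \<tau> n) \<longlongrightarrow> D M Q) G'"
        using lim[OF G'(1) u u3 p'[of Q] p'3[of Q]] by (simp add: M_def)
      have "\<forall>\<^sub>F n in G'. dist (u n) (p' Q n) / \<tau> n = dist (p n P) (p n Q) / \<tau> n / 2"
        using good[of P] good[of Q]
      proof eventually_elim
        case (elim n)
        then have "dist (u n) (p' Q n) = dist (p n P) (p n Q) / 2" using m[OF elim] by (simp add: p'_def u_def)
        then show ?case by (simp only:) simp
      qed
      from tendsto_unique[OF G'(2) Lim_transform_eventually[OF b this] half] have "D M Q = D P Q / 2" .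
      with 1 show ?thesis by (auto simp: M_def)
    qed
  next
    fix s k k'
    show "D (s, k) (s, k') = \<bar>k - k'\<bar>"
    proof (rule tendsto_unique[OF G(2) D])
      have "\<forall>\<^sub>F n in G. \<bar>k - k'\<bar> = dist (p n (s, k)) (p n (s, k')) / \<tau> n"
        using evG[OF valid[of "(s, k)"]] evG[OF valid[of "(s, k')"]]
      proof eventually_elim
        case (elim n)
        have "dist (p n (s, k)) (p n (s, k')) = \<bar>\<tau> n * (k - k')\<bar>"
          using dist_level[OF p(1)[OF elim(1)] p(1)[OF elim(2)]] p(2,3)[OF elim(1)] p(2,3)[OF elim(2)]
          by (simp add: algebra_simps)
        then show ?case using \<tau>(1)[of n] by (simp add: abs_mult)
      qed
      from Lim_transform_eventually[OF tendsto_const this]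
      show "((\<lambda>n. dist (p n (s, k)) (p n (s, k')) / \<tau> n) \<longlongrightarrow> \<bar>k - k'\<bar>) G" .
    qed
  qed
  interpret D: level_plane D by (rule level_plane)
  have zZ: "z \<in> Z" using z by (simp add: interior_point_def)
  have bounded: "\<forall>\<^sub>F n in F. (y (v n) - y z) / \<tau> n \<in> {- (2 * C)..2 * C}"
    if "\<And>n. v n \<in> Z" "\<And>n. dist z (v n) = C * \<tau> n" for v C F
  proof (intro always_eventually allI)
    fix n
    have "\<bar>y (v n) - y z\<bar> \<le> 2 * C * \<tau> n" using y_lip2[OF that(1) zZ, of n] that(2)[of n] by (simp add: dist_commute)
    then show "(y (v n) - y z) / \<tau> n \<in> {- (2 * C)..2 * C}"
      using \<tau>(1)[of n] by (simp add: pos_divide_le_eq pos_le_divide_eq abs_le_iff)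
  qed
  \<comment> \<open>The second coordinates of the limits may depend on the filter; this is harmless,
    since the conclusion of \<open>right_triangle\<close> contains only distances and
    \<open>h\<close>.\<close>
  obtain G1 k1 where G1: "G1 \<le> G" "G1 \<noteq> bot" "((\<lambda>n. (y (z' n) - y z) / \<tau> n) \<longlongrightarrow> k1) G1"
  proof -
    have "\<forall>\<^sub>F n in G. (y (z' n) - y z) / \<tau> n \<in> {- (2 * 1)..2 * 1}" by (rule bounded) (use z' in auto)
    then show thesis by (rule filter_cluster[OF compact_Icc G(2)]) (rule that)
  qed
  obtain G2 k2 where G2: "G2 \<le> G1" "G2 \<noteq> bot" "((\<lambda>n. (y (x n) - y z) / \<tau> n) \<longlongrightarrow> k2) G2"
  proof -
    have "\<forall>\<^sub>F n in G1. (y (x n) - y z) / \<tau> n \<in> {- (2 * K)..2 * K}" by (rule bounded) (use x in auto)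
    then show thesis by (rule filter_cluster[OF compact_Icc G1(2)]) (rule that)
  qed
  have G2G: "G2 \<le> G" using G1(1) G2(1) by simp
  have k1: "((\<lambda>n. (y (z' n) - y z) / \<tau> n) \<longlongrightarrow> k1) G2" by (rule filterlim_mono[OF G1(3) order_refl G2(1)])
  have k0: "((\<lambda>n. (y z - y z) / \<tau> n) \<longlongrightarrow> 0) G2" by simp
  have "((\<lambda>n. dist z (z' n) / \<tau> n) \<longlongrightarrow> D (0, 0) (1, k1)) G2"
    by (rule lim[OF G2G _ _ k0 z'(1) _ k1]) (simp_all add: zZ z')
  moreover have "dist z (z' n) / \<tau> n = 1" for n using z'(3)[of n] \<tau>(1)[of n] by simp
  ultimately have D1: "D (0, 0) (1, k1) = 1" using G2(2) by (simp add: tendsto_const_iff)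
  have "((\<lambda>n. dist z (x n) / \<tau> n) \<longlongrightarrow> D (0, 0) (h, k2)) G2"
    by (rule lim[OF G2G _ _ k0 x(1) _ G2(3)]) (simp_all add: zZ x mult.commute)
  moreover have "dist z (x n) / \<tau> n = K" for n using x(3)[of n] \<tau>(1)[of n] by simp
  ultimately have DK: "D (0, 0) (h, k2) = K" using G2(2) by (simp add: tendsto_const_iff)
  have "((\<lambda>n. dist (z' n) (x n) / \<tau> n) \<longlongrightarrow> D (1, k1) (h, k2)) G2"
    by (rule lim[OF G2G z'(1) _ k1 x(1) _ G2(3)]) (simp_all add: z' x mult.commute)
  then have "c \<le> D (1, k1) (h, k2)"
    by (rule tendsto_lowerbound) (use far \<tau>(1) G2(2) in \<open>auto intro!: always_eventually simp: pos_le_divide_eq mult.commute\<close>)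
  also have "\<dots> = sqrt (1 - 2 * h + K\<^sup>2)"
    using D.right_triangle[OF D1, of h k2] D.nonneg[of "(1, k1)" "(h, k2)"] DK by (simp add: real_sqrt_unique)
  finally show ?thesis .
qed

section \<open>First variation and orthogonality to the levels\<close>

text \<open>Otherwise take offending \<open>z'\<close> at distances \<open>t\<close> tending to 0,
  and \<open>x\<close> on a geodesic from \<open>z\<close> to \<open>q\<close> at distance
  \<open>K * t\<close> from \<open>z\<close>. With \<open>a\<close> the cosine-like quotient, the
  triangle inequality gives \<open>dist z' x \<ge> t * (K + a + \<epsilon>)\<close>, whereas the
  blow-up allows at most the root of \<open>1 + 2 * a * K + K\<^sup>2\<close>, which is close to
  \<open>K + a\<close> for large \<open>K\<close>.\<close>

lemma first_variation:
  assumes z: "interior_point z" and q: "q \<in> Z" "q \<noteq> z" and \<epsilon>: "\<epsilon> > 0"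
  shows "\<exists>\<delta>>0. \<forall>t z'. 0 < t \<longrightarrow> t < \<delta> \<longrightarrow> z' \<in> Z \<longrightarrow> \<beta> z' = \<beta> z + t \<longrightarrow> dist z z' = t \<longrightarrow>
    dist z' q \<le> dist z q + t * ((\<beta> z - \<beta> q) / dist z q + \<epsilon>)"
proof (rule ccontr)
  assume neg: "\<not> ?thesis"
  have zZ: "z \<in> Z" using z by (simp add: interior_point_def)
  define h where "h = dist z q"
  have h: "h > 0" using q by (simp add: h_def)
  define a where "a = (\<beta> z - \<beta> q) / h"
  have a: "- 1 \<le> a" using height[OF zZ q(1)] h by (simp add: a_def pos_le_divide_eq h_def)
  \<comment> \<open>Large enough for \<open>\<epsilon> / 2 * (K + a) \<ge> 1\<close>, given
    \<open>a \<ge> - 1\<close>; this absorbs the 1 under the root.\<close>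
  define K where "K = 1 + 2 / \<epsilon>"
  have K: "K > 0" using \<epsilon> by (simp add: K_def add_pos_pos)
  have K_sqrt: "sqrt (1 - 2 * (- a * K) + K\<^sup>2) \<le> K + a + \<epsilon> / 2"
  proof (rule real_le_lsqrt)
    have "1 \<le> \<epsilon> / 2 * (K + a)"
    proof -
      have "\<epsilon> / 2 * (1 + 2 / \<epsilon> - 1) \<le> \<epsilon> / 2 * (K + a)" using a \<epsilon> by (intro mult_left_mono) (auto simp: K_def)
      then show ?thesis using \<epsilon> by simp
    qed
    then have "1 \<le> \<epsilon> * (K + a)" using \<epsilon> by simp
    moreover have "(K + a + \<epsilon> / 2)\<^sup>2 = K\<^sup>2 + 2 * (a * K) + a\<^sup>2 + \<epsilon> * (K + a) + (\<epsilon> / 2)\<^sup>2"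
      by (simp add: power2_eq_square algebra_simps)
    ultimately have "1 + 2 * (a * K) + K\<^sup>2 \<le> (K + a + \<epsilon> / 2)\<^sup>2"
      using zero_le_power2[of a] zero_le_power2[of "\<epsilon> / 2"] by linarith
    then show "1 - 2 * (- a * K) + K\<^sup>2 \<le> (K + a + \<epsilon> / 2)\<^sup>2" by simp
    have "2 / \<epsilon> > 0" using \<epsilon> by simp
    then show "0 \<le> K + a + \<epsilon> / 2" using a \<epsilon> unfolding K_def by linarith
  qed
  \<comment> \<open>The first bound sends \<open>t\<close> to 0; the second keeps
    \<open>K * t\<close> below \<open>h\<close>, so that \<open>x\<close> exists on the geodesic to
    \<open>q\<close>.\<close>
  define b where "b n = min (1 / real (Suc n)) (h / K)" for n
  have b: "b n > 0" for n using h K by (simp add: b_def)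
  have "\<forall>n. \<exists>t z'. 0 < t \<and> t < b n \<and> z' \<in> Z \<and> \<beta> z' = \<beta> z + t \<and> dist z z' = t \<and> h + t * (a + \<epsilon>) < dist z' q"
  proof
    fix n show "\<exists>t z'. 0 < t \<and> t < b n \<and> z' \<in> Z \<and> \<beta> z' = \<beta> z + t \<and> dist z z' = t \<and> h + t * (a + \<epsilon>) < dist z' q"
      using neg b[of n] unfolding not_le[symmetric] a_def h_def by blast
  qed
  then obtain t z' where t: "\<And>n. 0 < t n" "\<And>n. t n < b n"
    and z': "\<And>n. z' n \<in> Z" "\<And>n. \<beta> (z' n) = \<beta> z + t n" "\<And>n. dist z (z' n) = t n"
    and far: "\<And>n. h + t n * (a + \<epsilon>) < dist (z' n) q"
    by metis
  have t0: "t \<longlonglongrightarrow> 0"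
  proof (rule Lim_null_comparison)
    show "\<forall>\<^sub>F n in sequentially. norm (t n) \<le> inverse (real (Suc n))"
      using t by (intro always_eventually allI) (auto simp: b_def less_imp_le inverse_eq_divide)
  qed (rule LIMSEQ_inverse_real_of_nat)
  have tK: "K * t n / h \<le> 1" "0 \<le> K * t n / h" for n
    using t(1)[of n] t(2)[of n] h K by (auto simp: b_def field_simps)
  have "\<exists>x\<in>Z. dist z x = K * t n \<and> dist x q = h - K * t n \<and> \<beta> x = \<beta> z + (- a * K) * t n" for n
  proof -
    obtain x where "x \<in> Z" "dist z x = (K * t n / h) * h" "dist x q = (1 - K * t n / h) * h"
      "\<beta> x = (1 - K * t n / h) * \<beta> z + (K * t n / h) * \<beta> q"
      using between[OF zZ q(1) tK(2,1)[of n]] unfolding h_def by blast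
    moreover from this(4) have "\<beta> x = \<beta> z + (- a * K) * t n"
      using h by (simp add: a_def field_simps)
    moreover have "(K * t n / h) * h = K * t n" "(1 - K * t n / h) * h = h - K * t n"
      using h by (simp_all add: left_diff_distrib)
    ultimately show ?thesis by (intro bexI[of _ x]) simp_all
  qed
  then obtain x where x: "\<And>n. x n \<in> Z" "\<And>n. dist z (x n) = K * t n" "\<And>n. dist (x n) q = h - K * t n"
    "\<And>n. \<beta> (x n) = \<beta> z + (- a * K) * t n" by metis
  have "K + a + \<epsilon> \<le> sqrt (1 - 2 * (- a * K) + K\<^sup>2)"
  proof (rule blowup_pythagoras[OF z t(1) t0 z' x(1,4,2)])
    fix n
    have "t n * (K + a + \<epsilon>) = h + t n * (a + \<epsilon>) - (h - K * t n)" by (simp add: algebra_simps)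
    then show "t n * (K + a + \<epsilon>) \<le> dist (z' n) (x n)"
      using far[of n] dist_triangle[of "z' n" q "x n"] x(3)[of n] by simp
  qed
  with K_sqrt \<epsilon> show False by simp
qed

lemma first_variation_line:
  assumes l: "vertical_line Z \<beta> l" and z: "interior_point (l t)" and q: "q \<in> Z" "q \<noteq> l t" and \<epsilon>: "\<epsilon> > 0"
  shows "\<forall>\<^sub>F s in at_right 0. dist (l (t + s)) q \<le> dist (l t) q + s * ((t - \<beta> q) / dist (l t) q + \<epsilon>)"
proof -
  obtain \<delta> where \<delta>: "\<delta> > 0" "\<And>s z'. 0 < s \<Longrightarrow> s < \<delta> \<Longrightarrow> z' \<in> Z \<Longrightarrow> \<beta> z' = \<beta> (l t) + s \<Longrightarrow> dist (l t) z' = s \<Longrightarrow>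
    dist z' q \<le> dist (l t) q + s * ((\<beta> (l t) - \<beta> q) / dist (l t) q + \<epsilon>)"
    using first_variation[OF z q \<epsilon>] by blast
  have "dist (l (t + s)) q \<le> dist (l t) q + s * ((t - \<beta> q) / dist (l t) q + \<epsilon>)" if "0 < s" "s < \<delta>" for s
    using \<delta>(2)[OF that, of "l (t + s)"] vlineD[OF l] that by simp
  then show ?thesis using \<delta>(1) unfolding eventually_at_right_field by auto
qed

lemma line_convex:
  assumes l: "vertical_line Z \<beta> l" and "q \<in> Z" and "s \<le> t" "t \<le> u"
  shows "(u - s) * dist (l t) q \<le> (u - t) * dist (l s) q + (t - s) * dist (l u) q"
proof -
  note D = vlineD[OF l]
  have "dist (l t) q * dist (l s) (l u) \<le> dist (l t) (l s) * dist q (l u) + dist (l t) (l u) * dist q (l s)"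
    by (rule ptolemy) (use D assms(2) in auto)
  then show ?thesis using assms(3,4) D(3)[of s u] D(3)[of t s] D(3)[of t u]
    by (simp add: dist_commute[of q] algebra_simps)
qed

text \<open>At the height of \<open>q\<close> the first variation term vanishes, so just above
  \<open>t\<close> the distance to \<open>q\<close> grows with arbitrarily small slope. By convexity
  along \<open>l\<close> it cannot have been smaller below. With the reversed statement,
  \<open>l\<close> is orthogonal to its levels.\<close>

lemma nearest_on_line_above:
  assumes l: "vertical_line Z \<beta> l" and z: "interior_point (l t)" and q: "q \<in> Z" "\<beta> q = t" and "s < t"
  shows "dist (l t) q \<le> dist (l s) q"
proof (cases "q = l t")
  case False
  show ?thesis
  proof (rule field_le_epsilon)
    fix e :: real assume "e > 0"
    define \<epsilon> where "\<epsilon> = e / (t - s)"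
    have \<epsilon>: "\<epsilon> > 0" using \<open>e > 0\<close> \<open>s < t\<close> by (simp add: \<epsilon>_def)
    obtain \<delta> where \<delta>: "\<delta> > 0" "\<And>r. 0 < r \<Longrightarrow> r < \<delta> \<Longrightarrow> dist (l (t + r)) q \<le> dist (l t) q + r * \<epsilon>"
      using first_variation_line[OF l z q(1) False \<epsilon>] q(2) unfolding eventually_at_right_field by auto
    define r where "r = \<delta> / 2"
    have r: "0 < r" "r < \<delta>" using \<delta>(1) by (simp_all add: r_def)
    have "(t + r - s) * dist (l t) q \<le> r * dist (l s) q + (t - s) * dist (l (t + r)) q"
      using line_convex[OF l q(1), of s t "t + r"] \<open>s < t\<close> r by simp
    also have "\<dots> \<le> r * dist (l s) q + (t - s) * (dist (l t) q + r * \<epsilon>)"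
      using \<delta>(2)[OF r] \<open>s < t\<close> by (intro add_left_mono mult_left_mono) auto
    finally have "r * dist (l t) q \<le> r * (dist (l s) q + (t - s) * \<epsilon>)" by (simp add: algebra_simps)
    then have "dist (l t) q \<le> dist (l s) q + (t - s) * \<epsilon>" using r by simp
    then show "dist (l t) q \<le> dist (l s) q + e" using \<open>s < t\<close> by (simp add: \<epsilon>_def)
  qed
qed simp

lemma vertical_line_reverse:
  assumes "vertical_line Z \<beta> l"
  shows "vertical_line Z (\<lambda>x. - \<beta> x) (\<lambda>t. l (- t))"
  using vlineD[OF assms] by (auto simp: vertical_line_def abs_minus_commute)

lemma reverse_simps:
  "strip.y (\<lambda>x. - \<beta> x) (\<lambda>t. c0 (- t)) = y"
  "strip.w (\<lambda>t. c0 (- t)) (\<lambda>t. c1 (- t)) t = w (- t)"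
  "strip.interior_point Z (\<lambda>x. - \<beta> x) (\<lambda>t. c0 (- t)) (\<lambda>t. c1 (- t)) = interior_point"
  by (auto simp: fun_eq_iff strip.y_def[OF reverse] strip.w_def[OF reverse] strip.interior_point_def[OF reverse]
    y_def w_def interior_point_def)

lemma nearest_on_line:
  assumes l: "vertical_line Z \<beta> l" and z: "interior_point (l t)" and q: "q \<in> Z" "\<beta> q = t"
  shows "dist (l t) q \<le> dist (l s) q"
proof (cases s t rule: linorder_cases)
  case less
  then show ?thesis by (rule nearest_on_line_above[OF l z q])
next
  case greater
  show ?thesis
    using strip.nearest_on_line_above[OF reverse vertical_line_reverse[OF l], of "- t" q "- s"] z q greater
    by (simp add: reverse_simps)
qed simp

text \<open>Advance the lines in turn. Advancing \<open>l\<close> costs at most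
  \<open>\<epsilon> * s\<close> by first variation at equal heights; advancing \<open>l'\<close>
  then costs nothing, since \<open>l' (t + s)\<close> is the point of \<open>l'\<close> nearest to
  \<open>l (t + s)\<close>.\<close>

lemma line_dist_nonincreasing:
  assumes l: "vertical_line Z \<beta> l" "vertical_line Z \<beta> l'" and "a \<le> b"
    and int: "\<And>t. a \<le> t \<Longrightarrow> t \<le> b \<Longrightarrow> interior_point (l t) \<and> interior_point (l' t) \<and> l t \<noteq> l' t"
  shows "dist (l b) (l' b) \<le> dist (l a) (l' a)"
proof (rule dini_nonincreasing[where \<phi> = "\<lambda>t. dist (l t) (l' t)"])
  have "2-lipschitz_on {a..b} (\<lambda>t. dist (l t) (l' t))"
  proof (rule lipschitz_onI)
    fix s t
    have "\<bar>dist (l s) (l' s) - dist (l t) (l' t)\<bar> \<le> dist (l s) (l t) + dist (l' s) (l' t)" by metric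
    then show "dist (dist (l s) (l' s)) (dist (l t) (l' t)) \<le> 2 * dist s t"
      using vlineD(3)[OF l(1), of s t] vlineD(3)[OF l(2), of s t] by (simp add: dist_real_def)
  qed simp
  then show "continuous_on {a..b} (\<lambda>t. dist (l t) (l' t))" by (rule lipschitz_on_continuous_on)
next
  fix t \<epsilon> :: real assume t: "a \<le> t" "t < b" and \<epsilon>: "\<epsilon> > 0"
  have "\<forall>\<^sub>F s in at_right 0. dist (l (t + s)) (l' t) \<le> dist (l t) (l' t) + s * ((t - \<beta> (l' t)) / dist (l t) (l' t) + \<epsilon>)"
    by (rule first_variation_line[OF l(1)]) (use int[of t] t \<epsilon> vlineD[OF l(2)] in auto)
  moreover have "\<forall>\<^sub>F s in at_right 0. s < b - t"
    unfolding eventually_at_right_field using t by (intro exI[of _ "b - t"]) simp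
  moreover have "\<forall>\<^sub>F s in at_right 0. 0 < (s :: real)" by (rule eventually_at_right_less)
  ultimately show "\<forall>\<^sub>F s in at_right 0. dist (l (t + s)) (l' (t + s)) \<le> dist (l t) (l' t) + \<epsilon> * s"
  proof eventually_elim
    case (elim s)
    have "dist (l' (t + s)) (l (t + s)) \<le> dist (l' t) (l (t + s))"
      by (rule nearest_on_line[OF l(2)]) (use int[of "t + s"] t elim vlineD[OF l(1)] in auto)
    then show ?case using elim vlineD(2)[OF l(2)] by (simp add: dist_commute mult.commute)
  qed
qed fact

lemma line_dist_const:
  assumes l: "vertical_line Z \<beta> l" "vertical_line Z \<beta> l'" and "a \<le> b"
    and int: "\<And>t. a \<le> t \<Longrightarrow> t \<le> b \<Longrightarrow> interior_point (l t) \<and> interior_point (l' t) \<and> l t \<noteq> l' t"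
  shows "dist (l b) (l' b) = dist (l a) (l' a)"
proof (rule antisym)
  show "dist (l b) (l' b) \<le> dist (l a) (l' a)" by (rule line_dist_nonincreasing[OF assms])
  show "dist (l a) (l' a) \<le> dist (l b) (l' b)"
    using strip.line_dist_nonincreasing[OF reverse vertical_line_reverse[OF l(1)] vertical_line_reverse[OF l(2)], of "- b" "- a"]
      \<open>a \<le> b\<close> int by (simp add: reverse_simps)
qed

section \<open>Vertical lines cannot approach the boundary\<close>

lemma y_line_lip:
  assumes l: "vertical_line Z \<beta> l"
  shows "\<bar>y (l s) - y (l t)\<bar> \<le> 2 * \<bar>s - t\<bar>"
  using y_lip2[of "l s" "l t"] vlineD[OF l] by simp

lemma interior_nearby:
  assumes l: "vertical_line Z \<beta> l" and "interior_point (l t)"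
  obtains \<delta> where "\<delta> > 0" "\<And>s. \<bar>s - t\<bar> < \<delta> \<Longrightarrow> interior_point (l s)"
proof -
  \<comment> \<open>Along a line \<open>y\<close> and \<open>w\<close> each change at rate at most
    2, so \<open>w - y\<close> changes at rate at most 4.\<close>
  define \<delta> where "\<delta> = min (y (l t)) (w t - y (l t)) / 4"
  have "\<delta> > 0" using assms vlineD[OF l] by (simp add: \<delta>_def interior_point_def)
  moreover have "interior_point (l s)" if "\<bar>s - t\<bar> < \<delta>" for s
  proof -
    have "4 * \<bar>s - t\<bar> < y (l t)" "4 * \<bar>s - t\<bar> < w t - y (l t)" using that by (simp_all add: \<delta>_def)
    then show ?thesis using y_line_lip[OF l, of s t] w_lip[of s t] vlineD[OF l] unfolding interior_point_def by (smt (verit))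
  qed
  ultimately show thesis by (rule that)
qed

text \<open>A line starting at distance \<open>\<kappa>\<close> from \<open>l'\<close> runs into \<open>c0\<close> at height \<open>\<tau>\<close>. Continued along \<open>c0\<close> it is
  still a line, and convexity along it bounds the speed at which \<open>c0\<close> can approach \<open>l'\<close> afterwards.\<close>

lemma boundary_approach:
  assumes l': "vertical_line Z \<beta> l'" and a\<tau>: "a < \<tau>"
    and int: "\<And>t. a \<le> t \<Longrightarrow> t \<le> \<tau> \<Longrightarrow> interior_point (l' t)"
    and first: "\<And>t. a \<le> t \<Longrightarrow> t < \<tau> \<Longrightarrow> \<kappa> < y (l' t)" "y (l' \<tau>) = \<kappa>" and "\<sigma> \<ge> 0"
  shows "\<kappa>\<^sup>2 \<le> \<sigma>\<^sup>2 + \<kappa> * y (l' (\<tau> + \<sigma>))"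
proof -
  note D' = vlineD[OF l']
  have \<kappa>: "\<kappa> > 0" using int[of \<tau>] first(2) a\<tau> by (simp add: interior_point_def)
  have w': "y (l' t) < w t" if "a \<le> t" "t \<le> \<tau>" for t using int[OF that] D' by (simp add: interior_point_def)
  have "0 \<le> y (l' a) - \<kappa>" "y (l' a) - \<kappa> \<le> w a"
    using first(1)[of a] w'[of a] a\<tau> \<kappa> by linarith+
  \<comment> \<open>The point at distance \<open>\<kappa>\<close> from \<open>l' a\<close> on the
    side of \<open>c0\<close>. The line \<open>l\<close> through it keeps this gap, so it meets
    \<open>c0\<close> exactly when \<open>y\<close> along \<open>l'\<close> has fallen to
    \<open>\<kappa>\<close>.\<close>
  then obtain z where z: "z \<in> Z" "\<beta> z = a" "y z = y (l' a) - \<kappa>" using point_ex by blast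
  obtain l where l: "vertical_line Z \<beta> l" "l a = z" using line_ex[OF z(1)] z(2) by blast
  note D = vlineD[OF l(1)]
  define \<phi> where "\<phi> t = y (l' t) - y (l t)" for t
  have \<phi>_lip: "\<bar>\<phi> s - \<phi> t\<bar> \<le> 4 * \<bar>s - t\<bar>" for s t
    using y_line_lip[OF l(1), of s t] y_line_lip[OF l', of s t] by (simp add: \<phi>_def)
  have \<phi>_dist: "dist (l t) (l' t) = \<bar>\<phi> t\<bar>" for t
    using dist_level[of "l t" "l' t"] D D' by (simp add: \<phi>_def abs_minus_commute)
  have \<phi>: "\<phi> t = \<kappa>" if "a \<le> t" "t \<le> \<tau>" for t
  proof (rule interval_induct[where P = "\<lambda>t. \<phi> t = \<kappa>", OF that(1)])
    show "\<phi> a = \<kappa>" by (simp add: \<phi>_def l z)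
  next
    fix s assume s: "a \<le> s" "s < t" "\<phi> s = \<kappa>"
    have "s < \<tau>" using s that by simp
    have "interior_point (l s)"
      using s(3) first(1)[OF s(1) \<open>s < \<tau>\<close>] w'[of s] s(1) \<open>s < \<tau>\<close> D \<kappa> by (simp add: interior_point_def \<phi>_def)
    then obtain \<delta> where \<delta>: "\<delta> > 0" "\<And>r. \<bar>r - s\<bar> < \<delta> \<Longrightarrow> interior_point (l r)" using interior_nearby[OF l(1)] by blast
    show "\<exists>\<delta>>0. \<forall>r. s < r \<longrightarrow> r < s + \<delta> \<longrightarrow> r \<le> t \<longrightarrow> \<phi> r = \<kappa>"
    proof (intro exI[of _ "min \<delta> (\<kappa> / 4)"] conjI allI impI)
      show "0 < min \<delta> (\<kappa> / 4)" using \<delta>(1) \<kappa> by simp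
    next
      fix r assume r: "s < r" "r < s + min \<delta> (\<kappa> / 4)" "r \<le> t"
      have pos: "\<phi> u > 0" if "s \<le> u" "u \<le> r" for u
      proof -
        have "u - s < \<kappa> / 4" using that r by simp
        then show ?thesis using \<phi>_lip[of u s] s(3) that(1) by simp
      qed
      have "dist (l r) (l' r) = dist (l s) (l' s)"
      proof (rule line_dist_const[OF l(1) l'])
        fix u assume u: "s \<le> u" "u \<le> r"
        have "l u \<noteq> l' u" using pos[OF u] \<phi>_dist[of u] by auto
        moreover have "interior_point (l u)" using \<delta>(2)[of u] u r by auto
        moreover have "interior_point (l' u)" using int[of u] u s r that by auto
        ultimately show "interior_point (l u) \<and> interior_point (l' u) \<and> l u \<noteq> l' u" by simp
      qed (use r in simp)
      then show "\<phi> r = \<kappa>" using \<phi>_dist[of r] \<phi>_dist[of s] pos[of r] r s(3) \<kappa> by simp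
    qed
  next
    fix s assume s: "a < s" "s \<le> t" "\<And>r. a \<le> r \<Longrightarrow> r < s \<Longrightarrow> \<phi> r = \<kappa>"
    have "\<bar>\<phi> s - \<kappa>\<bar> \<le> 0"
    proof (rule field_le_epsilon)
      fix e :: real assume "e > 0"
      define r where "r = max a (s - e / 4)"
      have "a \<le> r" "r < s" "s - r \<le> e / 4" using s(1) \<open>e > 0\<close> by (auto simp: r_def max_def)
      then show "\<bar>\<phi> s - \<kappa>\<bar> \<le> 0 + e" using \<phi>_lip[of s r] s(3)[of r] by simp
    qed
    then show "\<phi> s = \<kappa>" by simp
  qed
  have "y (l \<tau>) = 0" using \<phi>[of \<tau>] first(2) a\<tau> by (simp add: \<phi>_def)
  then have hit: "l \<tau> = c0 \<tau>" using D by (simp add: y_def)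
  have near: "\<kappa> \<le> dist (c0 \<tau>) (l' s)" for s
  proof -
    have "dist (l' \<tau>) (c0 \<tau>) \<le> dist (l' s) (c0 \<tau>)"
      by (rule nearest_on_line[OF l']) (use int[of \<tau>] a\<tau> c0D in auto)
    then show ?thesis using first(2) D' by (simp add: y_def dist_commute)
  qed
  have \<kappa>_dist: "dist (c0 \<tau>) (l' \<tau>) = \<kappa>" using first(2) D' by (simp add: y_def dist_commute)
  have before: "dist (l (\<tau> - r)) (l' \<tau>) \<le> \<kappa> + r\<^sup>2 / \<kappa>" if "0 < r" "r \<le> \<tau> - a" for r
  proof -
    have "dist (l (\<tau> - r)) (l' \<tau>) * \<kappa> \<le> dist (l (\<tau> - r)) (l' \<tau>) * dist (l \<tau>) (l' (\<tau> - r))"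
      using near[of "\<tau> - r"] hit by (intro mult_left_mono) auto
    also have "\<dots> \<le> dist (l (\<tau> - r)) (l \<tau>) * dist (l' \<tau>) (l' (\<tau> - r)) + dist (l (\<tau> - r)) (l' (\<tau> - r)) * dist (l' \<tau>) (l \<tau>)"
      by (rule ptolemy) (use D D' in auto)
    also have "\<dots> = r\<^sup>2 + \<kappa> * \<kappa>"
      using D(3)[of "\<tau> - r" \<tau>] D'(3)[of \<tau> "\<tau> - r"] \<phi>_dist[of "\<tau> - r"] \<phi>[of "\<tau> - r"] \<kappa>_dist hit that \<kappa>
      by (simp add: power2_eq_square dist_commute)
    finally have "dist (l (\<tau> - r)) (l' \<tau>) * \<kappa> \<le> (\<kappa> + r\<^sup>2 / \<kappa>) * \<kappa>" using \<kappa> by (simp add: distrib_right)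
    then show ?thesis using \<kappa> by simp
  qed
  \<comment> \<open>By \<open>height\<close>, \<open>l\<close> up to \<open>\<tau>\<close> continued
    by \<open>c0\<close> is still geodesic, so the distance to \<open>l' \<tau>\<close> is convex
    along it. By \<open>before\<close> its value before \<open>\<tau>\<close> exceeds
    \<open>\<kappa>\<close> only to second order, hence it cannot fall below \<open>\<kappa>\<close>
    afterwards.\<close>
  have after: "\<kappa> \<le> dist (c0 (\<tau> + \<sigma>)) (l' \<tau>)"
  proof (rule field_le_epsilon)
    fix e :: real assume "e > 0"
    define r where "r = min (\<tau> - a) (e * \<kappa> / (\<sigma> + 1))"
    have r: "0 < r" "r \<le> \<tau> - a" "r * (\<sigma> + 1) \<le> e * \<kappa>"
      using a\<tau> \<open>e > 0\<close> \<kappa> \<open>\<sigma> \<ge> 0\<close> by (auto simp: r_def min_le_iff_disj simp flip: pos_le_divide_eq)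
    have "(r + \<sigma>) * \<kappa> \<le> dist (l (\<tau> - r)) (c0 (\<tau> + \<sigma>)) * dist (c0 \<tau>) (l' \<tau>)"
      using height[of "l (\<tau> - r)" "c0 (\<tau> + \<sigma>)"] D c0D r \<open>\<sigma> \<ge> 0\<close> \<kappa> \<kappa>_dist by (intro mult_mono) auto
    also have "\<dots> \<le> dist (l (\<tau> - r)) (c0 \<tau>) * dist (c0 (\<tau> + \<sigma>)) (l' \<tau>) + dist (l (\<tau> - r)) (l' \<tau>) * dist (c0 (\<tau> + \<sigma>)) (c0 \<tau>)"
      by (rule ptolemy) (use D D' c0D in auto)
    also have "\<dots> = r * dist (c0 (\<tau> + \<sigma>)) (l' \<tau>) + dist (l (\<tau> - r)) (l' \<tau>) * \<sigma>"
      using D(3)[of "\<tau> - r" \<tau>] hit c0D(3) r \<open>\<sigma> \<ge> 0\<close> by simp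
    also have "\<dots> \<le> r * dist (c0 (\<tau> + \<sigma>)) (l' \<tau>) + (\<kappa> + r\<^sup>2 / \<kappa>) * \<sigma>"
      using before[OF r(1,2)] \<open>\<sigma> \<ge> 0\<close> by (intro add_left_mono mult_right_mono)
    finally have "r * \<kappa> \<le> r * (dist (c0 (\<tau> + \<sigma>)) (l' \<tau>) + r * \<sigma> / \<kappa>)"
      by (simp add: algebra_simps power2_eq_square)
    then have "\<kappa> \<le> dist (c0 (\<tau> + \<sigma>)) (l' \<tau>) + r * \<sigma> / \<kappa>" using r by simp
    moreover have "r * \<sigma> / \<kappa> \<le> e" using r \<kappa> by (simp add: pos_divide_le_eq algebra_simps)
    ultimately show "\<kappa> \<le> dist (c0 (\<tau> + \<sigma>)) (l' \<tau>) + e" by simp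
  qed
  have "\<kappa> * \<kappa> \<le> dist (c0 (\<tau> + \<sigma>)) (l' \<tau>) * dist (c0 \<tau>) (l' (\<tau> + \<sigma>))"
    using after near \<kappa> by (intro mult_mono) auto
  also have "\<dots> \<le> dist (c0 (\<tau> + \<sigma>)) (c0 \<tau>) * dist (l' \<tau>) (l' (\<tau> + \<sigma>)) + dist (c0 (\<tau> + \<sigma>)) (l' (\<tau> + \<sigma>)) * dist (l' \<tau>) (c0 \<tau>)"
    by (rule ptolemy) (use D' c0D in auto)
  also have "\<dots> = \<sigma>\<^sup>2 + \<kappa> * y (l' (\<tau> + \<sigma>))"
    using c0D(3) D' \<kappa>_dist \<open>\<sigma> \<ge> 0\<close> by (simp add: y_def power2_eq_square dist_commute)
  finally show ?thesis by (simp add: power2_eq_square)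
qed

lemma first_time:
  fixes G :: "real \<Rightarrow> real"
  assumes "continuous_on {a..b} G" "a \<le> b" "\<kappa> < G a" "G b \<le> \<kappa>"
  obtains \<tau> where "a < \<tau>" "\<tau> \<le> b" "G \<tau> = \<kappa>" "\<And>t. a \<le> t \<Longrightarrow> t < \<tau> \<Longrightarrow> \<kappa> < G t"
proof -
  define S where "S = {t \<in> {a..b}. G t \<le> \<kappa>}"
  have "S = {a..b} \<inter> G -` {..\<kappa>}" by (auto simp: S_def)
  then have "closed S" using continuous_closed_preimage[OF assms(1) closed_atLeastAtMost closed_atMost] by simp
  have "b \<in> S" "bdd_below S" using assms by (auto simp: S_def intro!: bdd_belowI[of _ a])
  define \<tau> where "\<tau> = Inf S"
  have \<tau>: "\<tau> \<in> S" unfolding \<tau>_def using \<open>closed S\<close> \<open>b \<in> S\<close> \<open>bdd_below S\<close> by (intro closed_contains_Inf) auto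
  have lt: "\<kappa> < G t" if "a \<le> t" "t < \<tau>" for t
  proof (rule ccontr)
    assume "\<not> \<kappa> < G t"
    then have "t \<in> S" using that \<tau> by (auto simp: S_def)
    then have "\<tau> \<le> t" unfolding \<tau>_def using \<open>bdd_below S\<close> by (rule cInf_lower)
    with that show False by simp
  qed
  have "a \<noteq> \<tau>" using \<tau> assms(3) by (auto simp: S_def)
  then have "a < \<tau>" "\<tau> \<le> b" using \<tau> by (auto simp: S_def)
  moreover have "G \<tau> = \<kappa>"
  proof (rule ccontr)
    assume "G \<tau> \<noteq> \<kappa>"
    then have "G \<tau> < \<kappa>" using \<tau> by (auto simp: S_def)
    moreover have "continuous_on {a..\<tau>} G" using assms(1) \<open>\<tau> \<le> b\<close> by (auto intro: continuous_on_subset)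
    ultimately obtain t where "a \<le> t" "t \<le> \<tau>" "G t = \<kappa>"
      using IVT2'[of G \<tau> \<kappa> a] assms(3) \<open>a < \<tau>\<close> by auto
    with lt[of t] \<open>G \<tau> \<noteq> \<kappa>\<close> show False by (cases "t = \<tau>") auto
  qed
  ultimately show thesis using that lt by blast
qed

text \<open>Cut a drop from \<open>G a\<close> to \<open>m\<close> into \<open>n\<close> drops of
  size \<open>\<eta>\<close>. By \<open>boundary_approach\<close> a drop from
  \<open>\<kappa>\<close> to \<open>\<kappa> - \<eta>\<close> takes at least the time
  \<open>sqrt (\<kappa> * \<eta>)\<close>, hence at least \<open>s0\<close>. The total time grows
  like the square root of \<open>n\<close> and exceeds \<open>b - a\<close>.\<close>

lemma y_line_nondecreasing:
  assumes l: "vertical_line Z \<beta> l" and "a \<le> b" and int: "\<And>t. a \<le> t \<Longrightarrow> t \<le> b \<Longrightarrow> interior_point (l t)"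
  shows "y (l a) \<le> y (l b)"
proof (rule ccontr)
  define G where "G t = y (l t)" for t
  define m where "m = G b"
  assume "\<not> y (l a) \<le> y (l b)"
  then have \<Delta>: "G a - m > 0" by (simp add: G_def m_def)
  have m: "m > 0" using int[of b] \<open>a \<le> b\<close> by (simp add: m_def G_def interior_point_def)
  have cont: "continuous_on S G" for S
  proof -
    have "2-lipschitz_on S G" by (rule lipschitz_onI) (auto simp: G_def dist_real_def y_line_lip[OF l])
    then show ?thesis by (rule lipschitz_on_continuous_on)
  qed
  have bound: "real n * (m * (G a - m)) \<le> 4 * (b - a)\<^sup>2" if n: "n \<ge> 2" for n :: nat
  proof -
    define \<eta> where "\<eta> = (G a - m) / real n"
    have \<eta>: "\<eta> > 0" using \<Delta> n by (simp add: \<eta>_def)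
    define \<kappa> where "\<kappa> i = G a - real i * \<eta>" for i :: nat
    define s0 where "s0 = sqrt (m * \<eta>)"
    have s0: "s0 > 0" "s0\<^sup>2 = m * \<eta>" using m \<eta> by (simp_all add: s0_def)
    have \<kappa>_ge: "m \<le> \<kappa> i" if "i \<le> n" for i
    proof -
      have "real i * \<eta> \<le> real n * \<eta>" using that \<eta> by (intro mult_right_mono) auto
      then show ?thesis using n by (simp add: \<kappa>_def \<eta>_def)
    qed
    \<comment> \<open>The first drop is not charged, because \<open>boundary_approach\<close> needs
      a stretch before the time \<open>\<tau>\<close> on which \<open>y\<close> is above
      \<open>\<kappa>\<close>. Hence \<open>Suc i\<close> drops cost \<open>i * s0\<close>.\<close>
    have slow: "\<kappa> (Suc i) < G t" if "Suc i \<le> n" "a \<le> t" "t \<le> b" "t < a + real i * s0" for i t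
      using that
    proof (induction i arbitrary: t)
      case (Suc i)
      show ?case
      proof (rule ccontr)
        assume "\<not> \<kappa> (Suc (Suc i)) < G t"
        then have Gt: "G t \<le> \<kappa> (Suc i) - \<eta>" by (simp add: \<kappa>_def algebra_simps)
        have "\<kappa> (Suc i) < G a" using \<eta> by (simp add: \<kappa>_def add_pos_nonneg)
        moreover have "G t \<le> \<kappa> (Suc i)" using Gt \<eta> by simp
        ultimately obtain \<tau> where \<tau>: "a < \<tau>" "\<tau> \<le> t" "G \<tau> = \<kappa> (Suc i)" "\<And>r. a \<le> r \<Longrightarrow> r < \<tau> \<Longrightarrow> \<kappa> (Suc i) < G r"
          using first_time[OF cont Suc.prems(2)] by metis
        have \<tau>_ge: "a + real i * s0 \<le> \<tau>"
          using Suc.IH[of \<tau>] Suc.prems \<tau> by force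
        define k where "k = \<kappa> (Suc i)"
        have k: "m \<le> k" using \<kappa>_ge[of "Suc i"] Suc.prems by (simp add: k_def)
        have "k\<^sup>2 \<le> (t - \<tau>)\<^sup>2 + k * G (\<tau> + (t - \<tau>))"
          unfolding G_def
          by (rule boundary_approach[OF l \<tau>(1)]) (use int \<tau> Suc.prems in \<open>auto simp: G_def k_def\<close>)
        also have "k * G (\<tau> + (t - \<tau>)) \<le> k * (k - \<eta>)" using Gt k m by (intro mult_left_mono) (auto simp: k_def)
        finally have "k * \<eta> \<le> (t - \<tau>)\<^sup>2" by (simp add: power2_eq_square algebra_simps)
        moreover have "m * \<eta> \<le> k * \<eta>" using k \<eta> by (intro mult_right_mono) auto
        moreover have "(t - \<tau>)\<^sup>2 < s0\<^sup>2"
          using \<tau> \<tau>_ge Suc.prems(4) by (intro power_strict_mono) (auto simp: algebra_simps)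
        ultimately show False using s0(2) by simp
      qed
    qed simp
    have "a + real (n - 1) * s0 \<le> b"
    proof (rule ccontr)
      assume "\<not> ?thesis"
      then have "\<kappa> (Suc (n - 1)) < G b" using n \<open>a \<le> b\<close> by (intro slow) auto
      then show False using \<kappa>_ge[of "Suc (n - 1)"] n by (simp add: m_def)
    qed
    then have "(real (n - 1) * s0)\<^sup>2 \<le> (b - a)\<^sup>2" using s0(1) by (intro power_mono) auto
    then have "(real (n - 1))\<^sup>2 * (m * \<eta>) \<le> (b - a)\<^sup>2" by (simp add: power_mult_distrib s0(2))
    moreover have "(real n)\<^sup>2 \<le> 4 * (real (n - 1))\<^sup>2"
    proof -
      have "real n \<le> 2 * real (n - 1)" using n by linarith
      then have "(real n)\<^sup>2 \<le> (2 * real (n - 1))\<^sup>2" by (intro power_mono) auto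
      then show ?thesis by (simp add: power_mult_distrib)
    qed
    then have "(real n)\<^sup>2 * (m * \<eta>) \<le> 4 * (real (n - 1))\<^sup>2 * (m * \<eta>)" using m \<eta> by (intro mult_right_mono) auto
    moreover have "(real n)\<^sup>2 * (m * \<eta>) = real n * (m * (G a - m))" using n by (simp add: \<eta>_def power2_eq_square)
    ultimately show ?thesis by linarith
  qed
  obtain N :: nat where N: "4 * (b - a)\<^sup>2 < real N * (m * (G a - m))"
    using reals_Archimedean3[of "m * (G a - m)"] m \<Delta> by auto
  have "real N * (m * (G a - m)) \<le> real (N + 2) * (m * (G a - m))" using m \<Delta> by (intro mult_right_mono) auto
  with bound[of "N + 2"] N show False by simp
qed

lemma y_line_const_interior:
  assumes l: "vertical_line Z \<beta> l" and "a \<le> b" and int: "\<And>t. a \<le> t \<Longrightarrow> t \<le> b \<Longrightarrow> interior_point (l t)"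
  shows "y (l a) = y (l b)"
proof (rule antisym)
  show "y (l a) \<le> y (l b)" by (rule y_line_nondecreasing[OF assms])
  show "y (l b) \<le> y (l a)"
    using strip.y_line_nondecreasing[OF reverse vertical_line_reverse[OF l], of "- b" "- a"] \<open>a \<le> b\<close> int
    by (simp add: reverse_simps)
qed

lemma swap_simps:
  "x \<in> Z \<Longrightarrow> strip.y \<beta> c1 x = w (\<beta> x) - y x"
  "strip.interior_point Z \<beta> c1 c0 = interior_point"
proof -
  have w: "strip.w c1 c0 = w" by (simp add: fun_eq_iff strip.w_def[OF swap] w_def dist_commute)
  show y: "strip.y \<beta> c1 x = w (\<beta> x) - y x" if "x \<in> Z" for x
    using level_sum[OF that] by (simp add: strip.y_def[OF swap] y_def w_def)
  show "strip.interior_point Z \<beta> c1 c0 = interior_point"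
    by (auto simp: fun_eq_iff strip.interior_point_def[OF swap] interior_point_def w y)
qed

lemma line_const_interior:
  assumes l: "vertical_line Z \<beta> l" and "a \<le> b" and int: "\<And>t. a \<le> t \<Longrightarrow> t \<le> b \<Longrightarrow> interior_point (l t)"
  shows "y (l a) = y (l b) \<and> w a = w b"
  using y_line_const_interior[OF assms] strip.y_line_const_interior[OF swap l \<open>a \<le> b\<close>] int vlineD[OF l]
  by (simp add: swap_simps)

text \<open>Constant \<open>y\<close> and \<open>w\<close> keep the line interior, and interior
  lines have constant \<open>y\<close> and \<open>w\<close>, so the property propagates; Lipschitz
  continuity carries it to limits.\<close>

lemma line_const_forward:
  assumes l: "vertical_line Z \<beta> l" and "interior_point (l a)" and "a \<le> b"
  shows "y (l b) = y (l a) \<and> w b = w a"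
proof (rule interval_induct[where P = "\<lambda>b. y (l b) = y (l a) \<and> w b = w a", OF \<open>a \<le> b\<close>])
  fix t assume t: "a \<le> t" "t < b" "y (l t) = y (l a) \<and> w t = w a"
  have "interior_point (l t)" using t(3) assms(2) vlineD[OF l] by (simp add: interior_point_def)
  then obtain \<delta> where \<delta>: "\<delta> > 0" "\<And>s. \<bar>s - t\<bar> < \<delta> \<Longrightarrow> interior_point (l s)" using interior_nearby[OF l] by blast
  have "y (l t) = y (l s) \<and> w t = w s" if "t < s" "s < t + \<delta>" for s
    by (rule line_const_interior[OF l]) (use that \<delta> in auto)
  then show "\<exists>\<delta>>0. \<forall>s. t < s \<longrightarrow> s < t + \<delta> \<longrightarrow> s \<le> b \<longrightarrow> y (l s) = y (l a) \<and> w s = w a"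
    using \<delta>(1) t(3) by (intro exI[of _ \<delta>]) simp
next
  fix t assume t: "a < t" "\<And>s. a \<le> s \<Longrightarrow> s < t \<Longrightarrow> y (l s) = y (l a) \<and> w s = w a"
  have "\<bar>y (l t) - y (l a)\<bar> \<le> 0 + e" "\<bar>w t - w a\<bar> \<le> 0 + e" if "e > 0" for e
  proof -
    define s where "s = max a (t - e / 2)"
    have "a \<le> s" "s < t" "t - s \<le> e / 2" using t(1) \<open>e > 0\<close> by (auto simp: s_def max_def)
    then show "\<bar>y (l t) - y (l a)\<bar> \<le> 0 + e" "\<bar>w t - w a\<bar> \<le> 0 + e"
      using y_line_lip[OF l, of t s] w_lip[of t s] t(2)[of s] by auto
  qed
  then have "\<bar>y (l t) - y (l a)\<bar> \<le> 0" "\<bar>w t - w a\<bar> \<le> 0" by (blast intro: field_le_epsilon)+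
  then show "y (l t) = y (l a) \<and> w t = w a" by simp
qed simp

lemma line_const:
  assumes l: "vertical_line Z \<beta> l" and "interior_point (l a)"
  shows "y (l b) = y (l a)" and "w b = w a"
proof -
  have "y (l b) = y (l a) \<and> w b = w a"
  proof (cases "a \<le> b")
    case True
    then show ?thesis by (rule line_const_forward[OF assms])
  next
    case False
    then show ?thesis
      using strip.line_const_forward[OF reverse vertical_line_reverse[OF l], of "- a" "- b"] assms(2)
      by (simp add: reverse_simps)
  qed
  then show "y (l b) = y (l a)" "w b = w a" by simp_all
qed

lemma line_interior:
  assumes "vertical_line Z \<beta> l" and "interior_point (l a)"
  shows "interior_point (l b)"
  using line_const[OF assms, of b] assms(2) vlineD[OF assms(1)] by (simp add: interior_point_def)

lemma w_const: "w s = w t"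
proof -
  obtain z where z: "z \<in> Z" "\<beta> z = t" "y z = w t / 2" using point_ex[of "w t / 2" t] w_pos[of t] by auto
  obtain l where l: "vertical_line Z \<beta> l" "l (\<beta> z) = z" using line_ex[OF z(1)] by blast
  have "interior_point (l t)" using l z w_pos[of t] by (auto simp: interior_point_def)
  from line_const(2)[OF l(1) this] show ?thesis .
qed

section \<open>Height and \<open>y\<close> as Euclidean coordinates\<close>

text \<open>First variation bounds the derivative of \<open>(h s)\<^sup>2\<close> by
  \<open>2 * (s - b)\<close>, the derivative of \<open>(s - b)\<^sup>2\<close>. So the difference of
  the squares does not increase from its value at the level of \<open>q\<close>.\<close>

lemma dist_line_upper_above:
  assumes l: "vertical_line Z \<beta> l" and int: "interior_point (l t)" and q: "q \<in> Z" "\<beta> q \<le> t"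
  shows "(dist (l t) q)\<^sup>2 \<le> (t - \<beta> q)\<^sup>2 + (y (l t) - y q)\<^sup>2"
proof -
  note D = vlineD[OF l]
  define b where "b = \<beta> q"
  define h where "h s = dist (l s) q" for s
  have h_b: "h b = \<bar>y (l t) - y q\<bar>"
    using dist_level[of "l b" q] D q line_const(1)[OF l int, of b] by (simp add: h_def b_def)
  show ?thesis
  proof (cases "h b = 0")
    case True
    then have "q = l b" by (simp add: h_def)
    then show ?thesis using D(3)[of t b] D(2)[of b] by (simp add: b_def[symmetric])
  next
    case False
    have h_pos: "0 < h s" for s
      using False height[of "l s" q] D q(1) by (cases "s = b") (auto simp: h_def b_def)
    have "(h t)\<^sup>2 - (t - b)\<^sup>2 \<le> (h b)\<^sup>2 - (b - b)\<^sup>2"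
    proof (rule dini_nonincreasing[where \<phi> = "\<lambda>s. (h s)\<^sup>2 - (s - b)\<^sup>2"])
      have "1-lipschitz_on {b..t} l" by (rule lipschitz_onI) (simp_all add: D dist_real_def)
      then show "continuous_on {b..t} (\<lambda>s. (h s)\<^sup>2 - (s - b)\<^sup>2)"
        unfolding h_def by (intro continuous_intros lipschitz_on_continuous_on)
    next
      fix s \<epsilon> :: real assume s: "b \<le> s" "s < t" and \<epsilon>: "\<epsilon> > 0"
      \<comment> \<open>This error contributes half of \<open>\<epsilon> * r\<close>; the quadratic
        term in \<open>r\<close> gets the other half.\<close>
      define e where "e = \<epsilon> / (4 * h s)"
      have e: "e > 0" "h s * e = \<epsilon> / 4" using \<epsilon> h_pos[of s] by (simp_all add: e_def)
      define a where "a = (s - b) / h s"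
      have a: "0 \<le> a" "a \<le> 1" "h s * a = s - b"
        using s h_pos[of s] height[of "l s" q] D q(1) by (auto simp: a_def h_def b_def)
      have "\<forall>\<^sub>F r in at_right 0. h (s + r) \<le> h s + r * (a + e)"
        unfolding h_def a_def b_def
        by (rule first_variation_line[OF l line_interior[OF l int] q(1)]) (use h_pos[of s] e in \<open>auto simp: h_def\<close>)
      moreover have "\<forall>\<^sub>F r in at_right 0. r * (1 + e)\<^sup>2 < \<epsilon> / 2"
        unfolding eventually_at_right_field using \<epsilon> e
        by (intro exI[of _ "\<epsilon> / 2 / (1 + e)\<^sup>2"]) (auto simp: pos_less_divide_eq)
      moreover have "\<forall>\<^sub>F r in at_right 0. 0 < (r :: real)" by (rule eventually_at_right_less)
      ultimately show "\<forall>\<^sub>F r in at_right 0. (h (s + r))\<^sup>2 - (s + r - b)\<^sup>2 \<le> (h s)\<^sup>2 - (s - b)\<^sup>2 + \<epsilon> * r"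
      proof eventually_elim
        case (elim r)
        have "(h (s + r))\<^sup>2 \<le> (h s + r * (a + e))\<^sup>2"
          using elim(1) by (intro power_mono) (simp_all add: h_def)
        also have "\<dots> = (h s)\<^sup>2 + 2 * r * (h s * a + h s * e) + r * (r * (a + e)\<^sup>2)"
          by (simp add: power2_eq_square algebra_simps)
        also have "\<dots> = (h s)\<^sup>2 + 2 * r * (s - b) + r * \<epsilon> / 2 + r * (r * (a + e)\<^sup>2)"
          unfolding a(3) e(2) by (simp add: algebra_simps)
        also have "r * (r * (a + e)\<^sup>2) \<le> r * (\<epsilon> / 2)"
        proof -
          have "r * (a + e)\<^sup>2 \<le> r * (1 + e)\<^sup>2" using a e elim(3) by (intro mult_left_mono power_mono) auto
          then have "r * (a + e)\<^sup>2 \<le> \<epsilon> / 2" using elim(2) by linarith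
          then show ?thesis using elim(3) by (intro mult_left_mono) auto
        qed
        finally have "(h (s + r))\<^sup>2 \<le> (h s)\<^sup>2 + 2 * r * (s - b) + r * \<epsilon>" by (simp add: mult.commute)
        moreover have "(s + r - b)\<^sup>2 = (s - b)\<^sup>2 + 2 * r * (s - b) + r\<^sup>2" by (simp add: power2_eq_square algebra_simps)
        ultimately show ?case using zero_le_power2[of r] mult.commute[of r \<epsilon>] by linarith
      qed
    qed (use q b_def in simp)
    then show ?thesis by (simp add: h_b h_def[symmetric] b_def[symmetric])
  qed
qed

lemma dist_line_upper:
  assumes l: "vertical_line Z \<beta> l" and int: "interior_point (l t)" and q: "q \<in> Z"
  shows "dist (l t) q \<le> sqrt ((t - \<beta> q)\<^sup>2 + (y (l t) - y q)\<^sup>2)"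
proof (rule real_le_rsqrt)
  show "(dist (l t) q)\<^sup>2 \<le> (t - \<beta> q)\<^sup>2 + (y (l t) - y q)\<^sup>2"
  proof (cases "\<beta> q \<le> t")
    case True
    then show ?thesis by (rule dist_line_upper_above[OF assms])
  next
    case False
    then show ?thesis
      using strip.dist_line_upper_above[OF reverse vertical_line_reverse[OF l], of "- t" q] int q
      by (simp add: reverse_simps power2_commute)
  qed
qed

lemma dist_line:
  assumes l: "vertical_line Z \<beta> l" and int: "interior_point (l t)" and q: "q \<in> Z"
  shows "dist (l t) q = sqrt ((t - \<beta> q)\<^sup>2 + (y (l t) - y q)\<^sup>2)"
proof -
  note D = vlineD[OF l]
  have y_l: "y (l s) = y (l t)" for s by (rule line_const(1)[OF l int])
  define b where "b = \<beta> q"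
  define u where "u = \<bar>t - b\<bar>"
  define g where "g = \<bar>y (l t) - y q\<bar>"
  have level_b: "dist (l b) x = \<bar>y (l t) - y x\<bar>" if "x \<in> Z" "\<beta> x = b" for x
    using dist_level[of "l b" x] D that y_l[of b] by simp
  consider "u = 0" | "g = 0" | "u > 0" "g > 0" by (auto simp: u_def g_def)
  then show ?thesis
  proof cases
    case 1
    then show ?thesis using level_b[OF q] by (simp add: u_def b_def)
  next
    case 2
    then have "q = l b" using level_b[OF q] by (simp add: b_def g_def)
    then show ?thesis using D(3)[of t b] D(2)[of b] y_l[of b] by simp
  next
    case 3
    \<comment> \<open>There is room \<open>g1\<close> on either side of \<open>l\<close>, so
      \<open>x\<close> can be placed in the level of \<open>q\<close> on the side away from
      \<open>q\<close>. The length \<open>v\<close> then solves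
      \<open>u * v = g * g1\<close>.\<close>
    define g1 where "g1 = min (y (l t)) (w b - y (l t))"
    have g1: "g1 > 0" using int D w_const[of b t] by (simp add: g1_def interior_point_def)
    define h where "h = (if y (l t) < y q then y (l t) - g1 else y (l t) + g1)"
    have "0 \<le> h" "h \<le> w b" using g1 by (auto simp: h_def g1_def)
    then obtain x where x: "x \<in> Z" "\<beta> x = b" "y x = h" using point_ex by blast
    define v where "v = g1 * g / u"
    have v: "v > 0" using g1 3 by (simp add: v_def)
    define r where "r = (if b < t then b - v else b + v)"
    have r: "\<bar>t - r\<bar> = u + v" "\<bar>r - b\<bar> = v" using v 3 by (auto simp: r_def u_def)
    have int_r: "interior_point (l r)" by (rule line_interior[OF l int])
    have sq: "(t - b)\<^sup>2 = u\<^sup>2" "(r - b)\<^sup>2 = v\<^sup>2" "(y (l t) - h)\<^sup>2 = g1\<^sup>2" "(y (l t) - y q)\<^sup>2 = g\<^sup>2"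
      using r(2) by (auto simp: u_def g_def h_def simp flip: power2_abs[of "r - b"])
    have S: "sqrt (v\<^sup>2 + g1\<^sup>2) = g1 / u * sqrt (u\<^sup>2 + g\<^sup>2)" "sqrt (v\<^sup>2 + g\<^sup>2) = g / u * sqrt (u\<^sup>2 + g1\<^sup>2)"
    proof -
      have "v\<^sup>2 + g1\<^sup>2 = (g1 / u)\<^sup>2 * (u\<^sup>2 + g\<^sup>2)" "v\<^sup>2 + g\<^sup>2 = (g / u)\<^sup>2 * (u\<^sup>2 + g1\<^sup>2)"
        using 3 by (simp_all add: v_def field_simps power2_eq_square)
      then show "sqrt (v\<^sup>2 + g1\<^sup>2) = g1 / u * sqrt (u\<^sup>2 + g\<^sup>2)" "sqrt (v\<^sup>2 + g\<^sup>2) = g / u * sqrt (u\<^sup>2 + g1\<^sup>2)"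
        using 3 g1 by (simp_all add: real_sqrt_mult)
    qed
    define d where "d = dist (l t) q"
    define E where "E = sqrt (u\<^sup>2 + g\<^sup>2)"
    have E: "E > 0" "E * E = u\<^sup>2 + g\<^sup>2" using 3 by (simp_all add: E_def add_pos_pos)
    text \<open>The kite with diagonals along \<open>l\<close> and along the level of \<open>q\<close> is cyclic in the Euclidean
      plane because \<open>u * v = g * g1\<close>, so the upper bounds on its sides force equality.\<close>
    have "(u + v) * (g + g1) = dist (l t) (l r) * dist q x"
    proof -
      have "dist q x = g + g1"
        using dist_level[of q x] q x g1 3(2) by (auto simp: b_def h_def g_def)
      then show ?thesis using D(3)[of t r] r(1) by simp
    qed
    also have "\<dots> \<le> dist (l t) q * dist (l r) x + dist (l t) x * dist (l r) q"
      by (rule ptolemy) (use D q x in auto)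
    also have "\<dots> \<le> d * sqrt (v\<^sup>2 + g1\<^sup>2) + sqrt (u\<^sup>2 + g1\<^sup>2) * sqrt (v\<^sup>2 + g\<^sup>2)"
      using dist_line_upper[OF l int_r x(1)] dist_line_upper[OF l int x(1)] dist_line_upper[OF l int_r q] x
      by (intro add_mono mult_mono) (simp_all add: y_l[of r] sq d_def b_def[symmetric])
    also have "\<dots> = d * (g1 / u * E) + g / u * (u\<^sup>2 + g1\<^sup>2)"
      unfolding S E_def[symmetric] by simp
    finally have "u * ((u + v) * (g + g1)) \<le> u * (d * (g1 / u * E) + g / u * (u\<^sup>2 + g1\<^sup>2))"
      using 3 by (intro mult_left_mono) auto
    moreover have "u * ((u + v) * (g + g1)) = g1 * (E * E) + g * (u\<^sup>2 + g1\<^sup>2)"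
      using 3 by (simp add: v_def E(2) power2_eq_square field_simps)
    moreover have "u * (d * (g1 / u * E) + g / u * (u\<^sup>2 + g1\<^sup>2)) = g1 * (d * E) + g * (u\<^sup>2 + g1\<^sup>2)"
      using 3 by (simp add: distrib_left)
    ultimately have "E * E \<le> d * E" using g1 by simp
    then have "E \<le> d" using E(1) by simp
    moreover have "d \<le> E" using dist_line_upper[OF l int q] by (simp add: d_def E_def sq b_def[symmetric])
    ultimately show ?thesis by (simp add: d_def E_def sq b_def[symmetric])
  qed
qed

lemma euclidean_interior:
  assumes x: "interior_point x" and x': "x' \<in> Z"
  shows "dist x x' = dist (\<beta> x, y x) (\<beta> x', y x')"
proof -
  have "x \<in> Z" using x by (simp add: interior_point_def)
  then obtain l where l: "vertical_line Z \<beta> l" "l (\<beta> x) = x" using line_ex by blast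
  then show ?thesis using dist_line[OF l(1) _ x', of "\<beta> x"] x by (simp add: dist_prod_def dist_real_def)
qed

lemma interior_dense:
  assumes "x \<in> Z" "e > 0"
  obtains p where "interior_point p" "\<beta> p = \<beta> x" "dist p x \<le> e"
proof -
  define \<delta> where "\<delta> = min e (w (\<beta> x) / 3)"
  have \<delta>: "0 < \<delta>" "\<delta> \<le> e" "\<delta> < w (\<beta> x) - \<delta>" using assms(2) w_pos[of "\<beta> x"] by (auto simp: \<delta>_def)
  define h where "h = max \<delta> (min (w (\<beta> x) - \<delta>) (y x))"
  have h: "0 < h" "h < w (\<beta> x)" "\<bar>h - y x\<bar> \<le> e"
    using \<delta> y_bounds[OF assms(1)] by (auto simp: h_def)
  then obtain p where p: "p \<in> Z" "\<beta> p = \<beta> x" "y p = h" using point_ex[of h "\<beta> x"] by auto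
  show thesis using that[of p] dist_level[OF p(1) assms(1) p(2)] p h by (simp add: interior_point_def)
qed

lemma euclidean:
  assumes x: "x \<in> Z" and x': "x' \<in> Z"
  shows "dist x x' = dist (\<beta> x, y x) (\<beta> x', y x')"
proof -
  have "\<bar>dist x x' - dist (\<beta> x, y x) (\<beta> x', y x')\<bar> \<le> 0"
  proof (rule field_le_epsilon)
    fix e :: real assume "e > 0"
    then obtain p where p: "interior_point p" "\<beta> p = \<beta> x" "dist p x \<le> e / 2"
      using interior_dense[OF x, of "e / 2"] by auto
    have "dist p x = dist (\<beta> p, y p) (\<beta> x, y x)" "dist p x' = dist (\<beta> p, y p) (\<beta> x', y x')"
      by (rule euclidean_interior[OF p(1)], fact)+
    moreover have "\<bar>dist x x' - dist p x'\<bar> \<le> dist p x" by metric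
    moreover have "\<bar>dist (\<beta> p, y p) (\<beta> x', y x') - dist (\<beta> x, y x) (\<beta> x', y x')\<bar> \<le> dist (\<beta> p, y p) (\<beta> x, y x)"
      by metric
    ultimately show "\<bar>dist x x' - dist (\<beta> x, y x) (\<beta> x', y x')\<bar> \<le> 0 + e" using p(3) by linarith
  qed
  then show ?thesis by simp
qed

lemma bij_flat_strip: "bij_betw (\<lambda>x. (\<beta> x, y x)) Z (flat_strip (w 0))"
proof (rule bij_betwI')
  fix x x' assume "x \<in> Z" "x' \<in> Z"
  then show "(\<beta> x, y x) = (\<beta> x', y x') \<longleftrightarrow> x = x'" using eq_point by auto
next
  fix x assume "x \<in> Z"
  from y_bounds[OF this] show "(\<beta> x, y x) \<in> flat_strip (w 0)"
    using w_const[of "\<beta> x" 0] by (simp add: flat_strip_def)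
next
  fix v assume "v \<in> flat_strip (w 0)"
  then have "0 \<le> snd v" "snd v \<le> w (fst v)" using w_const[of "fst v" 0] by (auto simp: flat_strip_def)
  from point_ex[OF this] show "\<exists>x\<in>Z. v = (\<beta> x, y x)" by (metis prod.collapse)
qed

theorem isometric_flat_strip: "isometric Z (flat_strip (w 0))"
  unfolding isometric_def using bij_flat_strip euclidean by (intro exI[of _ "\<lambda>x. (\<beta> x, y x)"]) auto

end

section \<open>Topology of the strip\<close>

text \<open>Prolong \<open>P\<close> along the lower edge to a path joining the vertical sides of a
  rectangle; \<open>Q\<close> joins its horizontal sides, so they meet. The added pieces consist of
  points \<open>c0 t\<close> with \<open>\<bar>t\<bar> \<ge> T\<close>, because \<open>c0\<close>
  runs through the edge injectively and hence monotonically.\<close>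

lemma strip_crossing:
  fixes X :: "'a::metric_space set" and h :: "real \<times> real \<Rightarrow> 'a"
  assumes hom: "homeomorphism (UNIV \<times> {0..1}) X h k"
    and c0: "geodesic_line X c0" "range c0 = h ` (UNIV \<times> {0})"
    and P: "path P" "path_image P \<subseteq> X" "pathstart P = c0 (- T)" "pathfinish P = c0 T" and T: "T > 0"
    and Q: "path Q" "path_image Q \<subseteq> X" "pathstart Q \<in> h ` (UNIV \<times> {0})" "pathfinish Q \<in> h ` (UNIV \<times> {1})"
  obtains x where "x \<in> path_image Q" "x \<in> path_image P \<or> (\<exists>t. T \<le> \<bar>t\<bar> \<and> x = c0 t)"
proof -
  have kX: "k x \<in> UNIV \<times> {0..1}" "h (k x) = x" if "x \<in> X" for x
    using hom that by (auto simp: homeomorphism_def)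
  have kh: "k (h v) = v" if "v \<in> UNIV \<times> {0..1}" for v using hom that by (auto simp: homeomorphism_def)
  have k_cont: "continuous_on X k" using hom by (simp add: homeomorphism_def)
  have c0X: "c0 t \<in> X" for t using c0(1) by (auto simp: geodesic_line_def)
  have c0_dist: "dist (c0 s) (c0 t) = \<bar>s - t\<bar>" for s t using c0(1) by (simp add: geodesic_line_def)
  define u where "u t = fst (k (c0 t))" for t
  have kc0: "k (c0 t) = (u t, 0)" for t
  proof -
    have "c0 t \<in> h ` (UNIV \<times> {0})" using c0(2) by auto
    then obtain v where "c0 t = h (v, 0)" by auto
    then show ?thesis using kh[of "(v, 0)"] by (simp add: u_def)
  qed
  have u_surj: "\<exists>t. c0 t = h (v, 0) \<and> u t = v" for v
  proof -
    have "h (v, 0) \<in> range c0" using c0(2) by auto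
    then obtain t where "c0 t = h (v, 0)" by (metis rangeE)
    then show ?thesis using kc0[of t] kh[of "(v, 0)"] by auto
  qed
  have u_inj: "inj_on u S" for S
  proof (rule inj_onI)
    fix s t assume "u s = u t"
    then have "c0 s = c0 t" using kc0[of s] kc0[of t] kX(2)[OF c0X] by metis
    then show "s = t" using c0_dist[of s t] by simp
  qed
  have c0_cont: "continuous_on S c0" for S
  proof -
    have "1-lipschitz_on S c0" by (rule lipschitz_onI) (simp_all add: c0_dist dist_real_def)
    then show ?thesis by (rule lipschitz_on_continuous_on)
  qed
  have u_cont: "continuous_on S u" for S
    unfolding u_def
    by (intro continuous_intros continuous_on_compose2[OF k_cont c0_cont]) (use c0X in auto)
  have between: "(u (- T) < u t \<and> u t < u T) \<or> (u T < u t \<and> u t < u (- T))" if "\<bar>t\<bar> < T" for t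
    using continuous_inj_imp_mono[of "- T" t T u] that u_cont u_inj by auto
  \<comment> \<open>\<open>c0\<close> may run through the edge in either direction;
    \<open>P'\<close> is \<open>P\<close> or its reverse accordingly.\<close>
  define lo hi where "lo = min (u (- T)) (u T)" and "hi = max (u (- T)) (u T)"
  have "u (- T) \<noteq> u T" using inj_onD[OF u_inj[of UNIV], of "- T" T] T by auto
  obtain P' where P': "path P'" "path_image P' = path_image P" "k (pathstart P') = (lo, 0)" "k (pathfinish P') = (hi, 0)"
  proof (cases "u (- T) < u T")
    case True
    then show thesis using that[of P] P by (simp add: lo_def hi_def kc0)
  next
    case False
    then show thesis using that[of "reversepath P"] P by (simp add: lo_def hi_def kc0)
  qed
  have outer: "\<exists>t. T \<le> \<bar>t\<bar> \<and> c0 t = h (v, 0)" if "v \<le> lo \<or> hi \<le> v" for v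
  proof -
    obtain t where t: "c0 t = h (v, 0)" "u t = v" using u_surj by blast
    have "T \<le> \<bar>t\<bar>"
    proof (rule ccontr)
      assume "\<not> T \<le> \<bar>t\<bar>"
      then show False using between[of t] that t(2) by (auto simp: lo_def hi_def)
    qed
    then show ?thesis using t(1) by blast
  qed
  have kP: "path (k \<circ> P')" using P P' k_cont by (intro path_continuous_image) (auto intro: continuous_on_subset)
  have kQ: "path (k \<circ> Q)" using Q k_cont by (intro path_continuous_image) (auto intro: continuous_on_subset)
  have "bounded (path_image (k \<circ> P') \<union> path_image (k \<circ> Q))"
    using compact_path_image[OF kP] compact_path_image[OF kQ] by (intro compact_imp_bounded compact_Un)
  then obtain M where M: "\<And>v. v \<in> path_image (k \<circ> P') \<union> path_image (k \<circ> Q) \<Longrightarrow> norm v \<le> M"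
    unfolding bounded_iff by blast
  define S where "S = {- M..M} \<times> {0..1 :: real}"
  have S: "path_image (k \<circ> P') \<union> path_image (k \<circ> Q) \<subseteq> S"
  proof
    fix v assume v: "v \<in> path_image (k \<circ> P') \<union> path_image (k \<circ> Q)"
    have "\<bar>fst v\<bar> \<le> M" using M[OF v] norm_fst_le[of "fst v" "snd v"] by simp
    moreover have "v \<in> UNIV \<times> {0..1}" using v kX(1) P(2) P'(2) Q(2) by (auto simp: path_image_compose)
    ultimately show "v \<in> S" by (cases v) (auto simp: S_def abs_le_iff)
  qed
  have lohi: "(lo, 0) \<in> S" "(hi, 0) \<in> S"
    using S P'(3,4) pathstart_in_path_image[of "k \<circ> P'"] pathfinish_in_path_image[of "k \<circ> P'"]
    by (auto simp: pathstart_compose pathfinish_compose)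
  have M0: "M \<ge> 0" using lohi by (auto simp: S_def)
  define F where "F = linepath (- M, 0) (lo, 0) +++ (k \<circ> P') +++ linepath (hi, 0) (M, 0)"
  have F: "path F" unfolding F_def using kP P'(3,4) by (auto simp: pathstart_compose pathfinish_compose)
  have F_image: "path_image F = closed_segment (- M, 0) (lo, 0) \<union> path_image (k \<circ> P') \<union> closed_segment (hi, 0) (M, 0)"
    unfolding F_def using P'(3,4) by (subst path_image_join; simp add: pathstart_compose pathfinish_compose path_image_join Un_assoc)
  have "convex S" by (simp add: S_def convex_Times)
  then have FS: "path_image F \<subseteq> S"
    unfolding F_image using S lohi M0 by (intro Un_least closed_segment_subset) (auto simp: S_def)
  define e :: "real \<times> real \<Rightarrow> real^2" where "e v = (\<chi> i. if i = 1 then fst v else snd v)" for v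
  have e_cont: "continuous_on A e" for A
  proof -
    have "continuous_on A (\<lambda>x. if i = 1 then fst x else snd x)" for i :: 2
      by (cases "i = 1") (auto intro: continuous_intros)
    then show ?thesis unfolding e_def by (rule continuous_on_vec_lambda)
  qed
  have e_inj: "e v = e v' \<Longrightarrow> v = v'" for v v' by (auto simp: e_def vec_eq_iff forall_2 prod_eq_iff)
  have e_box: "e v \<in> cbox (e (- M, 0)) (e (M, 1))" if "v \<in> S" for v
    using that by (auto simp: S_def e_def mem_box_cart forall_2)
  obtain z where z: "z \<in> path_image (e \<circ> F)" "z \<in> path_image (e \<circ> (k \<circ> Q))"
  proof (rule fashoda[of "e \<circ> F" "e \<circ> (k \<circ> Q)" "e (- M, 0)" "e (M, 1)"])
    show "path (e \<circ> F)" "path (e \<circ> (k \<circ> Q))" by (intro path_continuous_image F kQ e_cont)+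
    show "path_image (e \<circ> F) \<subseteq> cbox (e (- M, 0)) (e (M, 1))"
      using FS e_box by (auto simp: path_image_compose)
    show "path_image (e \<circ> (k \<circ> Q)) \<subseteq> cbox (e (- M, 0)) (e (M, 1))"
      using S e_box by (auto simp: path_image_compose[of e])
    show "pathstart (e \<circ> F) $ 1 = e (- M, 0) $ 1" "pathfinish (e \<circ> F) $ 1 = e (M, 1) $ 1"
      by (simp_all add: pathstart_compose pathfinish_compose F_def e_def)
    obtain v where v: "pathstart Q = h (v, 0)" using Q(3) by auto
    obtain v' where v': "pathfinish Q = h (v', 1)" using Q(4) by auto
    show "pathstart (e \<circ> (k \<circ> Q)) $ 2 = e (- M, 0) $ 2" "pathfinish (e \<circ> (k \<circ> Q)) $ 2 = e (M, 1) $ 2"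
      using kh[of "(v, 0)"] kh[of "(v', 1)"] by (simp_all add: pathstart_compose pathfinish_compose v v' e_def)
  qed
  then obtain v x where v: "v \<in> path_image F" and x: "x \<in> path_image Q" and "e v = e (k x)"
    by (auto simp: path_image_compose)
  then have kx: "k x = v" using e_inj by metis
  have xX: "x \<in> X" using x Q(2) by auto
  show thesis
  proof (rule that[OF x])
    consider "v \<in> closed_segment (- M, 0) (lo, 0)" | "v \<in> path_image (k \<circ> P')" | "v \<in> closed_segment (hi, 0) (M, 0)"
      using v unfolding F_image by blast
    then show "x \<in> path_image P \<or> (\<exists>t. T \<le> \<bar>t\<bar> \<and> x = c0 t)"
    proof cases
      case 2
      then obtain p where p: "p \<in> path_image P" "v = k p" using P'(2) by (auto simp: path_image_compose)
      have "x = p" using kX(2)[OF xX] kX(2)[of p] p P(2) kx by auto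
      with p show ?thesis by simp
    next
      case 1
      then have "snd v = 0" "fst v \<in> closed_segment (- M) lo" by (auto simp: in_segment algebra_simps)
      moreover have "- M \<le> lo" using lohi by (simp add: S_def)
      ultimately have "fst v \<le> lo" "v = (fst v, 0)" by (auto simp: closed_segment_eq_real_ivl prod_eq_iff)
      then show ?thesis using outer[of "fst v"] kX(2)[OF xX] kx by metis
    next
      case 3
      then have "snd v = 0" "fst v \<in> closed_segment hi M" by (auto simp: in_segment algebra_simps)
      moreover have "hi \<le> M" using lohi by (simp add: S_def)
      ultimately have "hi \<le> fst v" "v = (fst v, 0)" by (auto simp: closed_segment_eq_real_ivl prod_eq_iff)
      then show ?thesis using outer[of "fst v"] kX(2)[OF xX] kx by metis
    qed
  qed
qed

text \<open>By invariance of domain the part of \<open>Z\<close> off the boundary lines is open in the part of \<open>X\<close> off them.\<close>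

lemma strip_exhausts:
  fixes X Z :: "'a::metric_space set" and h :: "real \<times> real \<Rightarrow> 'a" and F :: "'a \<Rightarrow> real \<times> real"
  assumes hom: "homeomorphism (UNIV \<times> {0..1}) X h k"
    and Z: "Z \<subseteq> X" "closedin (top_of_set X) Z"
    and a: "a > 0" and F: "bij_betw F Z (flat_strip a)" "\<And>x y. x \<in> Z \<Longrightarrow> y \<in> Z \<Longrightarrow> dist x y = dist (F x) (F y)"
    and c0: "range c0 = h ` (UNIV \<times> {0})" "\<And>t. c0 t \<in> Z \<and> F (c0 t) = (t, 0)"
    and c1: "range c1 = h ` (UNIV \<times> {1})" "\<And>t. c1 t \<in> Z \<and> F (c1 t) = (t, a)"
  shows "Z = X"
proof -
  have kX: "k x \<in> UNIV \<times> {0..1}" "h (k x) = x" if "x \<in> X" for x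
    using hom that by (auto simp: homeomorphism_def)
  have kh: "k (h v) = v" "h v \<in> X" if "v \<in> UNIV \<times> {0..1}" for v using hom that by (auto simp: homeomorphism_def)
  have cont: "continuous_on X k" "continuous_on (UNIV \<times> {0..1}) h" using hom by (simp_all add: homeomorphism_def)
  define G where "G = the_inv_into Z F"
  have G: "G v \<in> Z" "F (G v) = v" if "v \<in> flat_strip a" for v
    using that F(1) by (auto simp: G_def bij_betw_def the_inv_into_into f_the_inv_into_f)
  have GF: "G (F x) = x" if "x \<in> Z" for x using that F(1) by (simp add: G_def bij_betw_def the_inv_into_f_f)
  define U where "U = (UNIV :: real set) \<times> {0<..<1 :: real}"
  define V where "V = (UNIV :: real set) \<times> {0<..<a}"
  have V: "V \<subseteq> flat_strip a" by (auto simp: V_def flat_strip_def)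
  have U: "U \<subseteq> UNIV \<times> {0..1}" by (auto simp: U_def)
  \<comment> \<open>Both coordinate systems see the same boundary: by injectivity of
    \<open>F\<close> and of \<open>h\<close>, either equation says that \<open>x\<close> lies on
    \<open>c\<close>.\<close>
  have boundary: "snd (F x) = b \<longleftrightarrow> snd (k x) = i"
    if c: "range c = h ` (UNIV \<times> {i})" "\<And>t. c t \<in> Z \<and> F (c t) = (t, b)" and i: "i \<in> {0..1}" and x: "x \<in> Z"
    for c i b x
  proof
    assume "snd (F x) = b"
    then have "F x = F (c (fst (F x)))" using c(2) by (simp add: prod_eq_iff)
    then have "x = c (fst (F x))" using GF x c(2) by metis
    then have "x \<in> h ` (UNIV \<times> {i})" using c(1) by (metis rangeI)
    then obtain r where "x = h (r, i)" by auto
    then show "snd (k x) = i" using kh(1)[of "(r, i)"] i by simp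
  next
    assume "snd (k x) = i"
    then have "x \<in> h ` (UNIV \<times> {i})"
      using kX(2)[of x] x Z(1) by (metis SigmaI UNIV_I image_eqI insertI1 prod.collapse subsetD)
    then obtain t where "x = c t" using c(1) by (metis imageE)
    then show "snd (F x) = b" using c(2) by simp
  qed
  \<comment> \<open>\<open>A\<close> is open as the image of an open strip under the injective map
    \<open>k \<circ> G\<close>, closed in \<open>U\<close> because \<open>Z\<close> is closed in
    \<open>X\<close>, and nonempty. So it is all of the connected \<open>U\<close>.\<close>
  define A where "A = {v \<in> U. h v \<in> Z}"
  have A_eq: "A = (k \<circ> G) ` V"
  proof (intro equalityI subsetI)
    fix v assume v: "v \<in> A"
    then have hv: "h v \<in> Z" "v \<in> UNIV \<times> {0..1}" "v \<in> U" using U by (auto simp: A_def)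
    have Fhv: "F (h v) \<in> flat_strip a" using F(1) hv by (auto simp: bij_betw_def)
    have "snd (F (h v)) \<noteq> 0" "snd (F (h v)) \<noteq> a"
      using boundary[OF c0] boundary[OF c1] hv kh(1)[OF hv(2)] by (auto simp: U_def)
    then have "F (h v) \<in> V" using Fhv by (cases "F (h v)") (auto simp: V_def flat_strip_def)
    moreover have "v = (k \<circ> G) (F (h v))" using GF[OF hv(1)] kh(1)[OF hv(2)] by simp
    ultimately show "v \<in> (k \<circ> G) ` V" by blast
  next
    fix v assume "v \<in> (k \<circ> G) ` V"
    then obtain p where p: "p \<in> V" "v = k (G p)" by auto
    have GpZ: "G p \<in> Z" "F (G p) = p" using G[OF subsetD[OF V p(1)]] by simp_all
    then have X: "G p \<in> X" using Z(1) by auto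
    have "snd v \<noteq> 0" "snd v \<noteq> 1"
      using boundary[OF c0 _ GpZ(1)] boundary[OF c1 _ GpZ(1)] GpZ p by (auto simp: V_def)
    then have "v \<in> U" using kX(1)[OF X] p(2) by (cases v) (auto simp: U_def)
    then show "v \<in> A" using kX(2)[OF X] p(2) GpZ by (simp add: A_def)
  qed
  have "open A"
    unfolding A_eq
  proof (rule invariance_of_domain)
    show "open V" by (simp add: V_def open_Times)
    have "1-lipschitz_on V G"
      by (rule lipschitz_onI) (use G V F(2) in \<open>auto simp: subset_iff\<close>)
    then have "continuous_on V G" by (rule lipschitz_on_continuous_on)
    moreover have "G ` V \<subseteq> X" using G(1) V Z(1) by (meson image_subsetI subsetD)
    ultimately show "continuous_on V (k \<circ> G)" using cont(1) by (meson continuous_on_compose continuous_on_subset)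
    show "inj_on (k \<circ> G) V"
    proof (rule inj_onI)
      fix p q assume pq: "p \<in> V" "q \<in> V" "(k \<circ> G) p = (k \<circ> G) q"
      then have "G p = G q" using kX(2) G V Z(1) by (metis comp_apply subsetD)
      then show "p = q" using G(2) pq V by (metis subsetD)
    qed
  qed
  moreover have "closedin (top_of_set U) A"
  proof -
    have "closedin (top_of_set U) (U \<inter> h -` Z)"
    proof (rule continuous_closedin_preimage_gen[OF _ _ Z(2)])
      show "continuous_on U h" using cont(2) U by (rule continuous_on_subset)
      show "h \<in> U \<rightarrow> X" using kh(2) U by auto
    qed
    moreover have "U \<inter> h -` Z = A" by (auto simp: A_def)
    ultimately show ?thesis by simp
  qed
  moreover have "A \<noteq> {}"
  proof -
    have "(0, a / 2) \<in> V" using a by (simp add: V_def)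
    then show ?thesis unfolding A_eq by blast
  qed
  moreover have "connected U" unfolding U_def by (intro connected_Times) auto
  moreover have "A \<subseteq> U" by (auto simp: A_def)
  ultimately have "A = U" unfolding connected_clopen using open_subset[of A U] by blast
  have "x \<in> Z" if x: "x \<in> X" for x
  proof -
    obtain r s where rs: "k x = (r, s)" by (cases "k x")
    then have "0 \<le> s" "s \<le> 1" using kX(1)[OF x] by auto
    then consider "s = 0" | "s = 1" | "k x \<in> U" using rs by (auto simp: U_def order_less_le)
    then show ?thesis
    proof cases
      case 1
      then have "x \<in> range c0" using kX(2)[OF x] rs c0(1) by (metis SigmaI UNIV_I image_eqI insertI1)
      then show ?thesis using c0(2) by auto
    next
      case 2
      then have "x \<in> range c1" using kX(2)[OF x] rs c1(1) by (metis SigmaI UNIV_I image_eqI insertI1)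
      then show ?thesis using c1(2) by auto
    next
      case 3
      then have "k x \<in> A" using \<open>A = U\<close> by simp
      then show ?thesis using kX(2)[OF x] by (simp add: A_def)
    qed
  qed
  with Z(1) show ?thesis by auto
qed

section \<open>Geodesics and the flat strip theorem\<close>

text \<open>Rescaled to \<open>{0..1}\<close>, so that it is a \<open>path\<close> and its parameter
  is also the weight in convexity estimates.\<close>

definition geodesic_from :: "'a::metric_space set \<Rightarrow> 'a \<Rightarrow> 'a \<Rightarrow> (real \<Rightarrow> 'a) \<Rightarrow> bool" where
  "geodesic_from X x y p \<longleftrightarrow> p 0 = x \<and> p 1 = y \<and> p ` {0..1} \<subseteq> X \<and>
    (\<forall>r\<in>{0..1}. \<forall>s\<in>{0..1}. dist (p r) (p s) = \<bar>r - s\<bar> * dist x y)"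

lemma geodesic_from_ex:
  assumes "joined_by_geodesic X x y"
  shows "\<exists>p. geodesic_from X x y p"
proof -
  obtain a b c l where c: "a \<le> b" "l \<ge> 0" "c \<in> {a..b} \<rightarrow> X" "c a = x" "c b = y"
    "\<And>s t. s \<in> {a..b} \<Longrightarrow> t \<in> {a..b} \<Longrightarrow> dist (c t) (c s) = l * \<bar>t - s\<bar>"
    using assms unfolding joined_by_geodesic_def by blast
  define p where "p r = c (a + r * (b - a))" for r
  have ab: "a + r * (b - a) \<in> {a..b}" if "r \<in> {0..1}" for r
    using that c(1) mult_left_le_one_le[of "b - a" r] by auto
  have d: "dist x y = l * (b - a)" using c(6)[of b a] c(1,4,5) by simp
  have "geodesic_from X x y p"
    unfolding geodesic_from_def
  proof (intro conjI ballI)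
    show "p ` {0..1} \<subseteq> X" using c(3) ab unfolding p_def by blast
    fix r s :: real assume rs: "r \<in> {0..1}" "s \<in> {0..1}"
    have "dist (p r) (p s) = l * \<bar>(a + r * (b - a)) - (a + s * (b - a))\<bar>"
      unfolding p_def by (rule c(6)[OF ab[OF rs(2)] ab[OF rs(1)]])
    also have "(a + r * (b - a)) - (a + s * (b - a)) = (r - s) * (b - a)" by (simp add: algebra_simps)
    finally show "dist (p r) (p s) = \<bar>r - s\<bar> * dist x y" using c(1) by (simp add: d abs_mult)
  qed (use c in \<open>simp_all add: p_def\<close>)
  then show ?thesis by blast
qed

lemma geodesic_fromD:
  assumes "geodesic_from X x y p"
  shows "p 0 = x" "p 1 = y" "\<And>r. 0 \<le> r \<Longrightarrow> r \<le> 1 \<Longrightarrow> p r \<in> X"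
    "\<And>r s. 0 \<le> r \<Longrightarrow> r \<le> 1 \<Longrightarrow> 0 \<le> s \<Longrightarrow> s \<le> 1 \<Longrightarrow> dist (p r) (p s) = \<bar>r - s\<bar> * dist x y"
    "\<And>r. 0 \<le> r \<Longrightarrow> r \<le> 1 \<Longrightarrow> dist x (p r) = r * dist x y"
    "\<And>r. 0 \<le> r \<Longrightarrow> r \<le> 1 \<Longrightarrow> dist (p r) y = (1 - r) * dist x y"
proof -
  show p: "p 0 = x" "p 1 = y" "\<And>r. 0 \<le> r \<Longrightarrow> r \<le> 1 \<Longrightarrow> p r \<in> X"
    and d: "\<And>r s. 0 \<le> r \<Longrightarrow> r \<le> 1 \<Longrightarrow> 0 \<le> s \<Longrightarrow> s \<le> 1 \<Longrightarrow> dist (p r) (p s) = \<bar>r - s\<bar> * dist x y"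
    using assms by (auto simp: geodesic_from_def)
  show "dist x (p r) = r * dist x y" if "0 \<le> r" "r \<le> 1" for r using d[of 0 r] p(1) that by simp
  show "dist (p r) y = (1 - r) * dist x y" if "0 \<le> r" "r \<le> 1" for r using d[of r 1] p(2) that by simp
qed

lemma geodesic_from_path:
  assumes "geodesic_from X x y p"
  shows "path p" "path_image p \<subseteq> X" "pathstart p = x" "pathfinish p = y"
proof -
  have "(dist x y)-lipschitz_on {0..1} p"
    by (rule lipschitz_onI) (use geodesic_fromD(4)[OF assms] in \<open>auto simp: dist_real_def\<close>)
  then show "path p" unfolding path_def by (rule lipschitz_on_continuous_on)
qed (use assms in \<open>auto simp: geodesic_from_def path_image_def pathstart_def pathfinish_def\<close>)

text \<open>Ptolemy's inequality for \<open>x\<close>, \<open>y\<close>, \<open>m\<close>,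
  \<open>q\<close>, divided by \<open>dist x y\<close>.\<close>

lemma ptolemaic_convex:
  assumes X: "ptolemaic X" "x \<in> X" "y \<in> X" "m \<in> X" "q \<in> X"
    and m: "dist x m = r * dist x y" "dist m y = (1 - r) * dist x y" and r: "0 \<le> r" "r \<le> 1"
  shows "dist m q \<le> (1 - r) * dist x q + r * dist y q"
proof (cases "x = y")
  case False
  have "dist m q * dist x y \<le> dist m x * dist q y + dist m y * dist q x"
    using X unfolding ptolemaic_def by blast
  also have "\<dots> = ((1 - r) * dist x q + r * dist y q) * dist x y"
    unfolding dist_commute[of m x] dist_commute[of q] m by (simp add: algebra_simps)
  finally show ?thesis using False by simp
next
  case True
  then have "m = y" using m by simp
  with True show ?thesis by (simp flip: distrib_right)
qed

text \<open>\<open>c0\<close> and \<open>c1\<close> are parametrized such that both Busemann functions of \<open>c0\<close> agree with the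
  parameter on \<open>c1\<close>. The topology of the strip enters through \<open>crossing\<close> only.\<close>

locale aligned_pair =
  fixes X :: "'a::metric_space set" and c0 c1 :: "real \<Rightarrow> 'a"
  assumes geodesic: "geodesic_space X" and ptol: "ptolemaic X"
    and c0: "geodesic_line X c0" and c1: "geodesic_line X c1" and c01: "c0 t \<noteq> c1 t"
    and up: "(\<lambda>n. dist (c1 t) (c0 (real n)) - real n) \<longlonglongrightarrow> - t"
    and down: "(\<lambda>n. dist (c1 t) (c0 (- real n)) - real n) \<longlonglongrightarrow> t"
    and crossing: "T > 0 \<Longrightarrow> path P \<Longrightarrow> path_image P \<subseteq> X \<Longrightarrow> pathstart P = c0 (- T) \<Longrightarrow> pathfinish P = c0 T \<Longrightarrow>
      path Q \<Longrightarrow> path_image Q \<subseteq> X \<Longrightarrow> pathstart Q = c0 t \<Longrightarrow> pathfinish Q = c1 t \<Longrightarrow>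
      \<exists>x\<in>path_image Q. x \<in> path_image P \<or> (\<exists>s. T \<le> \<bar>s\<bar> \<and> x = c0 s)"
begin

lemma c0D: "c0 t \<in> X" "dist (c0 s) (c0 t) = \<bar>s - t\<bar>"
  using c0 by (auto simp: geodesic_line_def)

lemma c1D: "c1 t \<in> X" "dist (c1 s) (c1 t) = \<bar>s - t\<bar>"
  using c1 by (auto simp: geodesic_line_def)

lemma geodesic_ex:
  assumes "x \<in> X" "y \<in> X"
  shows "\<exists>p. geodesic_from X x y p"
  using geodesic_from_ex geodesic assms unfolding geodesic_space_def by blast

lemma level_geodesic_ex: "\<exists>Q. geodesic_from X (c0 t) (c1 t) Q"
  by (rule geodesic_ex[OF c0D(1) c1D(1)])

section \<open>The set where the Busemann functions cancel\<close>

definition bp where "bp x = lim (\<lambda>n. dist x (c0 (real n)) - real n)"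
definition bm where "bm x = lim (\<lambda>n. dist x (c0 (- real n)) - real n)"
definition Z where "Z = {x \<in> X. bp x + bm x = 0}"

lemma bp: "(\<lambda>n. dist x (c0 (real n)) - real n) \<longlonglongrightarrow> bp x"
proof -
  have "\<exists>L. (\<lambda>n. dist x (c0 (real n)) - real n) \<longlonglongrightarrow> L \<and> (\<forall>n. L \<le> dist x (c0 (real n)) - real n)"
  proof (rule decreasing_shift_convergent)
    fix s t
    have "\<bar>dist x (c0 s) - dist x (c0 t)\<bar> \<le> dist (c0 s) (c0 t)" by metric
    then show "\<bar>dist x (c0 s) - dist x (c0 t)\<bar> \<le> \<bar>s - t\<bar>" by (simp add: c0D(2))
    have "dist (c0 s) (c0 t) \<le> dist x (c0 s) + dist x (c0 t)" by metric
    then show "\<bar>s - t\<bar> \<le> dist x (c0 s) + dist x (c0 t)" by (simp add: c0D(2))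
  qed
  then show ?thesis unfolding bp_def by (metis limI)
qed

lemma bm: "(\<lambda>n. dist x (c0 (- real n)) - real n) \<longlonglongrightarrow> bm x"
proof -
  have "\<exists>L. (\<lambda>n. dist x (c0 (- real n)) - real n) \<longlonglongrightarrow> L \<and> (\<forall>n. L \<le> dist x (c0 (- real n)) - real n)"
  proof (rule decreasing_shift_convergent[where f = "\<lambda>s. dist x (c0 (- s))"])
    fix s t
    have "\<bar>dist x (c0 (- s)) - dist x (c0 (- t))\<bar> \<le> dist (c0 (- s)) (c0 (- t))" by metric
    then show "\<bar>dist x (c0 (- s)) - dist x (c0 (- t))\<bar> \<le> \<bar>s - t\<bar>" by (simp add: c0D(2) abs_minus_commute)
    have "dist (c0 (- s)) (c0 (- t)) \<le> dist x (c0 (- s)) + dist x (c0 (- t))" by metric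
    then show "\<bar>s - t\<bar> \<le> dist x (c0 (- s)) + dist x (c0 (- t))" by (simp add: c0D(2) abs_minus_commute)
  qed
  then show ?thesis unfolding bm_def by (metis limI)
qed

lemma busemann_lip:
  assumes L: "\<And>x. (\<lambda>n. dist x (u n) - real n) \<longlonglongrightarrow> L x"
  shows "\<bar>L x - L y\<bar> \<le> dist x y"
proof -
  have "L x - L y \<le> dist x y" for x y
  proof (rule LIMSEQ_le_const2[OF tendsto_diff[OF L L]], intro exI allI impI)
    fix n show "dist x (u n) - real n - (dist y (u n) - real n) \<le> dist x y"
      using dist_triangle[of x "u n" y] by simp
  qed
  from this[of x y] this[of y x] show ?thesis by (simp add: dist_commute)
qed

lemma busemann_convex:
  assumes L: "\<And>x. (\<lambda>n. dist x (u n) - real n) \<longlonglongrightarrow> L x" and u: "\<And>n. u n \<in> X"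
    and X: "x \<in> X" "y \<in> X" "m \<in> X"
    and m: "dist x m = r * dist x y" "dist m y = (1 - r) * dist x y" and r: "0 \<le> r" "r \<le> 1"
  shows "L m \<le> (1 - r) * L x + r * L y"
proof (rule LIMSEQ_le[OF L])
  show "(\<lambda>n. (1 - r) * (dist x (u n) - real n) + r * (dist y (u n) - real n)) \<longlonglongrightarrow> (1 - r) * L x + r * L y"
    by (intro tendsto_intros L)
  show "\<exists>N. \<forall>n\<ge>N. dist m (u n) - real n \<le> (1 - r) * (dist x (u n) - real n) + r * (dist y (u n) - real n)"
  proof (intro exI allI impI)
    fix n show "dist m (u n) - real n \<le> (1 - r) * (dist x (u n) - real n) + r * (dist y (u n) - real n)"
      using ptolemaic_convex[OF ptol X u m r, of n] by (simp add: algebra_simps)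
  qed
qed

lemmas bp_lip = busemann_lip[OF bp] and bm_lip = busemann_lip[OF bm]
lemmas bp_convex = busemann_convex[OF bp c0D(1)] and bm_convex = busemann_convex[OF bm c0D(1)]

lemma bp_bm_nonneg: "0 \<le> bp x + bm x"
proof (rule LIMSEQ_le_const[OF tendsto_add[OF bp bm]], intro exI allI impI)
  fix n
  have "dist (c0 (real n)) (c0 (- real n)) \<le> dist x (c0 (real n)) + dist x (c0 (- real n))" by metric
  then show "0 \<le> dist x (c0 (real n)) - real n + (dist x (c0 (- real n)) - real n)" by (simp add: c0D)
qed

lemma Z_X: "x \<in> Z \<Longrightarrow> x \<in> X" by (simp add: Z_def)

text \<open>The sum \<open>bp + bm\<close> is nonnegative everywhere and zero at \<open>x\<close>
  and \<open>y\<close>. Convexity of both summands makes it at most zero at \<open>m\<close>, so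
  both convexity estimates are equalities.\<close>

lemma between_Z:
  assumes x: "x \<in> Z" "y \<in> Z" and mX: "m \<in> X"
    and m: "dist x m = r * dist x y" "dist m y = (1 - r) * dist x y" and r: "0 \<le> r" "r \<le> 1"
  shows "m \<in> Z" "bm m = (1 - r) * bm x + r * bm y"
proof -
  have "bp x = - bm x" "bp y = - bm y" using x by (auto simp: Z_def)
  then have p: "bp m \<le> (1 - r) * - bm x + r * - bm y" and q: "bm m \<le> (1 - r) * bm x + r * bm y"
    using bp_convex[OF Z_X[OF x(1)] Z_X[OF x(2)] mX m r] bm_convex[OF Z_X[OF x(1)] Z_X[OF x(2)] mX m r] by simp_all
  have "(1 - r) * - bm x + r * - bm y = - ((1 - r) * bm x + r * bm y)" by simp
  with p q bp_bm_nonneg[of m] have "bp m + bm m = 0 \<and> bm m = (1 - r) * bm x + r * bm y" by linarith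
  then show "m \<in> Z" "bm m = (1 - r) * bm x + r * bm y" using mX by (auto simp: Z_def)
qed

lemma geodesic_Z:
  assumes "geodesic_from X x y p" and x: "x \<in> Z" "y \<in> Z" and r: "0 \<le> r" "r \<le> 1"
  shows "p r \<in> Z" "bm (p r) = (1 - r) * bm x + r * bm y"
  using between_Z[OF x geodesic_fromD(3)[OF assms(1) r] geodesic_fromD(5,6)[OF assms(1) r] r] by blast+

lemma vertical_c0: "vertical_line Z bm c0"
proof -
  have "(\<lambda>n. dist (c0 t) (c0 (real n)) - real n) \<longlonglongrightarrow> - t" for t
    unfolding c0D
  proof (rule tendsto_eventually)
    obtain N :: nat where "t \<le> real N" using real_arch_simple by blast
    then show "\<forall>\<^sub>F n in sequentially. \<bar>t - real n\<bar> - real n = - t"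
      by (intro eventually_sequentiallyI[of N]) simp
  qed
  then have 1: "bp (c0 t) = - t" for t using LIMSEQ_unique bp by blast
  have "(\<lambda>n. dist (c0 t) (c0 (- real n)) - real n) \<longlonglongrightarrow> t" for t
    unfolding c0D
  proof (rule tendsto_eventually)
    obtain N :: nat where "- t \<le> real N" using real_arch_simple by blast
    then show "\<forall>\<^sub>F n in sequentially. \<bar>t - - real n\<bar> - real n = t"
      by (intro eventually_sequentiallyI[of N]) simp
  qed
  then have "bm (c0 t) = t" for t using LIMSEQ_unique bm by blast
  with 1 show ?thesis by (auto simp: vertical_line_def Z_def c0D)
qed

lemma vertical_c1: "vertical_line Z bm c1"
proof -
  have "bp (c1 t) = - t" "bm (c1 t) = t" for t
    using LIMSEQ_unique[OF bp up] LIMSEQ_unique[OF bm down] by auto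
  then show ?thesis by (auto simp: vertical_line_def Z_def c1D)
qed


lemma c0Z: "c0 t \<in> Z" "bm (c0 t) = t" and c1Z: "c1 t \<in> Z" "bm (c1 t) = t"
  using vertical_c0 vertical_c1 by (auto simp: vertical_line_def)

text \<open>The path \<open>c0 (- T) \<rightarrow> z \<rightarrow> c0 T\<close> has strictly increasing height, so it can cross a level geodesic
  only in \<open>z\<close>.\<close>

lemma level_geodesic:
  assumes Q: "geodesic_from X (c0 t) (c1 t) Q" and z: "z \<in> Z" "bm z = t"
  shows "\<exists>r\<in>{0..1}. z = Q r"
proof -
  \<comment> \<open>Since \<open>T > \<bar>t\<bar>\<close>, no point \<open>c0 s\<close> with
    \<open>\<bar>s\<bar> \<ge> T\<close> has height \<open>t\<close>.\<close>
  define T where "T = \<bar>t\<bar> + 1"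
  have T: "T > 0" "- T < t" "t < T" "\<bar>t\<bar> < T" by (auto simp: T_def)
  obtain p where p: "geodesic_from X (c0 (- T)) z p" using geodesic_ex[OF c0D(1) Z_X[OF z(1)]] by blast
  obtain q where q: "geodesic_from X z (c0 T) q" using geodesic_ex[OF Z_X[OF z(1)] c0D(1)] by blast
  note pp = geodesic_from_path[OF p] and qp = geodesic_from_path[OF q] and Qp = geodesic_from_path[OF Q]
  have "\<exists>x\<in>path_image Q. x \<in> path_image (p +++ q) \<or> (\<exists>s. T \<le> \<bar>s\<bar> \<and> x = c0 s)"
    by (rule crossing[OF T(1)]) (use pp qp Qp in \<open>simp_all add: path_image_join\<close>)
  moreover have "path_image (p +++ q) = path_image p \<union> path_image q" using pp qp by (simp add: path_image_join)
  ultimately obtain v where v: "v \<in> path_image Q" "v \<in> path_image p \<union> path_image q \<or> (\<exists>s. T \<le> \<bar>s\<bar> \<and> v = c0 s)"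
    by auto
  from v(1) obtain r where r: "0 \<le> r" "r \<le> 1" "v = Q r" by (auto simp: path_image_def)
  have x: "Q r \<in> path_image p \<union> path_image q \<or> (\<exists>s. T \<le> \<bar>s\<bar> \<and> Q r = c0 s)" using v(2) r(3) by simp
  have Qr: "bm (Q r) = t" using geodesic_Z(2)[OF Q c0Z(1) c1Z(1) r(1,2)] by (simp add: c0Z c1Z algebra_simps)
  have "z = Q r"
    using x
  proof (elim disjE exE conjE UnE)
    assume "Q r \<in> path_image p"
    then obtain s where s: "0 \<le> s" "s \<le> 1" "Q r = p s" by (auto simp: path_image_def)
    then have "t = (1 - s) * (- T) + s * t" using geodesic_Z(2)[OF p c0Z(1) z(1) s(1,2)] Qr z by (simp add: c0Z)
    moreover have "(1 - s) * (t + T) = t - ((1 - s) * (- T) + s * t)" by (simp add: algebra_simps)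
    ultimately have "(1 - s) * (t + T) = 0" by simp
    then show ?thesis using T s(3) geodesic_fromD(2)[OF p] by simp
  next
    assume "Q r \<in> path_image q"
    then obtain s where s: "0 \<le> s" "s \<le> 1" "Q r = q s" by (auto simp: path_image_def)
    then have "t = (1 - s) * t + s * T" using geodesic_Z(2)[OF q z(1) c0Z(1) s(1,2)] Qr z by (simp add: c0Z)
    moreover have "s * (T - t) = ((1 - s) * t + s * T) - t" by (simp add: algebra_simps)
    ultimately have "s * (T - t) = 0" by simp
    then show ?thesis using T s(3) geodesic_fromD(1)[OF q] by simp
  next
    fix s assume "T \<le> \<bar>s\<bar>" "Q r = c0 s"
    then show ?thesis using Qr T by (simp add: c0Z)
  qed
  with r show ?thesis by auto
qed

lemma level_set_eq:
  assumes Q: "geodesic_from X (c0 t) (c1 t) Q"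
  shows "{z \<in> Z. bm z = t} = Q ` {0..1}"
proof -
  have "Q r \<in> Z \<and> bm (Q r) = t" if "r \<in> {0..1}" for r
    using geodesic_Z[OF Q c0Z(1) c1Z(1), of r] that by (simp add: c0Z c1Z algebra_simps)
  then show ?thesis using level_geodesic[OF Q] by blast
qed

lemma compact_level: "compact {z \<in> Z. bm z = t}"
proof -
  obtain Q where Q: "geodesic_from X (c0 t) (c1 t) Q" using level_geodesic_ex by blast
  show ?thesis
    unfolding level_set_eq[OF Q] using compact_path_image[OF geodesic_from_path(1)[OF Q]] by (simp add: path_image_def)
qed

text \<open>The sign \<open>e\<close> selects the end of \<open>c0\<close> at which the geodesics are aimed.\<close>

lemma ray_points:
  assumes x: "x \<in> Z" and e: "e \<in> {1, - 1}"
  obtains P where "\<And>r. r \<ge> 0 \<Longrightarrow> \<forall>\<^sub>F n in sequentially. P n r \<in> {z \<in> Z. bm z = bm x + e * r}"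
    "\<And>r s. r \<ge> 0 \<Longrightarrow> s \<ge> 0 \<Longrightarrow> (\<lambda>n. dist (P n r) (P n s)) \<longlonglongrightarrow> \<bar>r - s\<bar>" "\<And>n. P n 0 = x"
proof -
  have ee: "e * e = 1" using e by auto
  have "\<exists>p. geodesic_from X x (c0 (e * real n)) p" for n using geodesic_ex[OF Z_X[OF x] c0D(1)] by blast
  then have "\<forall>n. \<exists>p. geodesic_from X x (c0 (e * real n)) p" ..
  from choice[OF this] obtain p where p: "\<And>n. geodesic_from X x (c0 (e * real n)) (p n)" by blast
  define t where "t = e * bm x"
  define a where "a n = dist x (c0 (e * real n))" for n
  have "(\<lambda>n. a n - real n) \<longlonglongrightarrow> - t"
  proof (cases "e = 1")
    case True
    moreover have "bp x = - bm x" using x by (simp add: Z_def)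
    ultimately show ?thesis using bp[of x] by (simp add: a_def t_def)
  next
    case False
    then show ?thesis using e bm[of x] by (simp add: a_def t_def)
  qed
  moreover have "(\<lambda>n. 1 / (real n - t)) \<longlonglongrightarrow> 0" by real_asymp
  ultimately have "(\<lambda>n. (a n - real n + t) * (1 / (real n - t)) + 1) \<longlonglongrightarrow> (- t + t) * 0 + 1"
    by (intro tendsto_intros)
  moreover have "\<forall>\<^sub>F n in sequentially. (a n - real n + t) * (1 / (real n - t)) + 1 = a n / (real n - t)"
  proof -
    have "\<forall>\<^sub>F n in sequentially. t < real n" by real_asymp
    then show ?thesis by eventually_elim (simp add: field_simps)
  qed
  ultimately have ratio: "(\<lambda>n. a n / (real n - t)) \<longlonglongrightarrow> 1"
    using Lim_transform_eventually by fastforce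
  \<comment> \<open>Dividing by \<open>real n - t\<close> rather than by the length
    \<open>a n\<close> makes heights exact, so the points lie in one compact level. Distances are
    right only in the limit, as the ratio tends to 1.\<close>
  define P where "P n r = p n (r / (real n - t))" for n r
  have ev: "\<forall>\<^sub>F n in sequentially. t < real n \<and> r \<le> real n - t" for r
  proof -
    have "\<forall>\<^sub>F n in sequentially. t + \<bar>r\<bar> < real n" by real_asymp
    then show ?thesis by eventually_elim auto
  qed
  show thesis
  proof (rule that[of P])
    fix r :: real assume r: "r \<ge> 0"
    show "\<forall>\<^sub>F n in sequentially. P n r \<in> {z \<in> Z. bm z = bm x + e * r}"
      using ev[of r]
    proof eventually_elim
      case (elim n)
      define \<rho> where "\<rho> = r / (real n - t)"
      have \<rho>: "0 \<le> \<rho>" "\<rho> \<le> 1" "\<rho> * (real n - t) = r" using r elim by (simp_all add: \<rho>_def)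
      have "bm (p n \<rho>) = (1 - \<rho>) * bm x + \<rho> * (e * real n)"
        using geodesic_Z(2)[OF p x c0Z(1) \<rho>(1,2)] by (simp add: c0Z)
      also have "\<dots> = bm x + e * (\<rho> * (real n - t))"
      proof -
        have "e * (\<rho> * (real n - t)) = \<rho> * (e * real n) - \<rho> * ((e * e) * bm x)"
          by (simp only: t_def right_diff_distrib mult_ac)
        then show ?thesis unfolding ee by (simp add: left_diff_distrib)
      qed
      finally have "bm (p n \<rho>) = bm x + e * r" using \<rho>(3) by simp
      then show ?case using geodesic_Z(1)[OF p x c0Z(1) \<rho>(1,2)] by (simp add: P_def \<rho>_def)
    qed
    fix s :: real assume s: "s \<ge> 0"
    have "\<forall>\<^sub>F n in sequentially. \<bar>r - s\<bar> * (a n / (real n - t)) = dist (P n r) (P n s)"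
      using ev[of r] ev[of s]
    proof eventually_elim
      case (elim n)
      have "dist (P n r) (P n s) = \<bar>r / (real n - t) - s / (real n - t)\<bar> * a n"
        unfolding P_def a_def by (rule geodesic_fromD(4)[OF p]) (use r s elim in \<open>simp_all add: pos_divide_le_eq\<close>)
      also have "\<dots> = \<bar>r - s\<bar> / (real n - t) * a n"
        using elim by (simp flip: diff_divide_distrib)
      finally show ?case by simp
    qed
    moreover have "(\<lambda>n. \<bar>r - s\<bar> * (a n / (real n - t))) \<longlonglongrightarrow> \<bar>r - s\<bar> * 1" by (intro tendsto_intros ratio)
    ultimately show "(\<lambda>n. dist (P n r) (P n s)) \<longlonglongrightarrow> \<bar>r - s\<bar>" using Lim_transform_eventually by fastforce
  next
    fix n show "P n 0 = x" using geodesic_fromD(1)[OF p] by (simp add: P_def)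
  qed
qed

text \<open>Geodesics aimed at both ends of \<open>c0\<close> cluster at two rays, level by level.
  Limits of distances, and the triangle inequality at \<open>x\<close> for points on different rays,
  give the upper bound \<open>\<bar>r - s\<bar>\<close>; the 1-Lipschitz height gives the lower one,
  so the rays join to a line.\<close>

lemma line_through:
  assumes x: "x \<in> Z"
  shows "\<exists>l. vertical_line Z bm l \<and> l (bm x) = x"
proof -
  define t where "t = bm x"
  obtain P where P: "\<And>r. r \<ge> 0 \<Longrightarrow> \<forall>\<^sub>F n in sequentially. P n r \<in> {z \<in> Z. bm z = bm x + 1 * r}"
    "\<And>r s. r \<ge> 0 \<Longrightarrow> s \<ge> 0 \<Longrightarrow> (\<lambda>n. dist (P n r) (P n s)) \<longlonglongrightarrow> \<bar>r - s\<bar>" "\<And>n. P n 0 = x"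
    by (rule ray_points[OF x, of 1]) auto
  obtain M where M: "\<And>r. r \<ge> 0 \<Longrightarrow> \<forall>\<^sub>F n in sequentially. M n r \<in> {z \<in> Z. bm z = bm x + - 1 * r}"
    "\<And>r s. r \<ge> 0 \<Longrightarrow> s \<ge> 0 \<Longrightarrow> (\<lambda>n. dist (M n r) (M n s)) \<longlonglongrightarrow> \<bar>r - s\<bar>" "\<And>n. M n 0 = x"
    by (rule ray_points[OF x, of "- 1"]) auto
  define f where "f n s = (if t \<le> s then P n (s - t) else M n (t - s))" for n s
  have f: "\<forall>\<^sub>F n in sequentially. f n s \<in> {z \<in> Z. bm z = s}" for s
    using P(1)[of "s - t"] M(1)[of "t - s"] by (cases "t \<le> s") (simp_all add: f_def t_def)
  obtain G l where G: "G \<le> sequentially" "G \<noteq> bot" and l: "\<And>s. l s \<in> {z \<in> Z. bm z = s}"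
    and lim: "\<And>s. ((\<lambda>n. f n s) \<longlongrightarrow> l s) G"
    by (rule function_cluster[of "\<lambda>s. {z \<in> Z. bm z = s}" sequentially f])
      (rule compact_level, simp, rule f, rule that)
  have fx: "f n t = x" for n by (simp add: f_def P(3))
  have dist_x: "(\<lambda>n. dist (f n s) x) \<longlonglongrightarrow> \<bar>s - t\<bar>" for s
    using P(2)[of "s - t" 0] M(2)[of "t - s" 0] by (cases "t \<le> s") (simp_all add: f_def P(3) M(3))
  have le: "dist (l r) (l s) \<le> c" if "u \<longlonglongrightarrow> c" "\<And>n. dist (f n r) (f n s) \<le> u n" for r s u c
    by (rule tendsto_le[OF G(2) tendsto_mono[OF G(1) that(1)] tendsto_dist[OF lim lim]])
      (use that(2) in simp)
  have upper: "dist (l r) (l s) \<le> \<bar>r - s\<bar>" if "r \<le> s" for r s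
  proof -
    consider "t \<le> r" | "s < t" | "r < t" "t \<le> s" by linarith
    then show ?thesis
    proof cases
      case 1
      then have "(\<lambda>n. dist (f n r) (f n s)) \<longlonglongrightarrow> \<bar>r - s\<bar>" using P(2)[of "r - t" "s - t"] that by (simp add: f_def)
      then show ?thesis by (rule le) simp
    next
      case 2
      then have "(\<lambda>n. dist (f n r) (f n s)) \<longlonglongrightarrow> \<bar>r - s\<bar>"
        using M(2)[of "t - r" "t - s"] that by (simp add: f_def abs_minus_commute)
      then show ?thesis by (rule le) simp
    next
      case 3
      have "(\<lambda>n. dist (f n r) x + dist (f n s) x) \<longlonglongrightarrow> \<bar>r - t\<bar> + \<bar>s - t\<bar>" by (intro tendsto_add dist_x)
      moreover have "\<bar>r - t\<bar> + \<bar>s - t\<bar> = \<bar>r - s\<bar>" using 3 by simp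
      ultimately have "(\<lambda>n. dist (f n r) x + dist (f n s) x) \<longlonglongrightarrow> \<bar>r - s\<bar>" by simp
      then show ?thesis by (rule le) (rule dist_triangle2)
    qed
  qed
  have "dist (l r) (l s) \<le> \<bar>r - s\<bar>" for r s
    using upper[of r s] upper[of s r] by (cases "r \<le> s") (simp_all add: dist_commute abs_minus_commute)
  moreover have "\<bar>r - s\<bar> \<le> dist (l r) (l s)" for r s using bm_lip[of "l r" "l s"] l[of r] l[of s] by simp
  ultimately have "vertical_line Z bm l" using l by (auto simp: vertical_line_def intro: antisym)
  moreover have "l t = x"
  proof (rule tendsto_unique[OF G(2) lim])
    show "((\<lambda>n. f n t) \<longlongrightarrow> x) G" by (simp add: fx)
  qed
  ultimately show ?thesis by (auto simp: t_def)
qed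

sublocale strip Z bm c0 c1
proof
  show "ptolemaic Z" using ptol Z_X unfolding ptolemaic_def by blast
  show "vertical_line Z bm c0" "vertical_line Z bm c1" by (rule vertical_c0 vertical_c1)+
  show "c0 t \<noteq> c1 t" for t by (rule c01)
next
  fix x y assume "x \<in> Z" "y \<in> Z"
  show "\<bar>bm x - bm y\<bar> \<le> dist x y" by (rule bm_lip)
next
  fix x y and r :: real assume x: "x \<in> Z" "y \<in> Z" and r: "0 \<le> r" "r \<le> 1"
  obtain p where p: "geodesic_from X x y p" using geodesic_ex[OF Z_X[OF x(1)] Z_X[OF x(2)]] by blast
  show "\<exists>m\<in>Z. dist x m = r * dist x y \<and> dist m y = (1 - r) * dist x y \<and> bm m = (1 - r) * bm x + r * bm y"
    using geodesic_Z[OF p x r] geodesic_fromD(5,6)[OF p r] by blast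
next
  fix x assume x: "x \<in> Z"
  obtain Q where Q: "geodesic_from X (c0 (bm x)) (c1 (bm x)) Q" using level_geodesic_ex by blast
  obtain r where r: "r \<in> {0..1}" "x = Q r" using level_geodesic[OF Q x refl] by blast
  show "dist x (c0 (bm x)) + dist x (c1 (bm x)) = dist (c0 (bm x)) (c1 (bm x))"
    using geodesic_fromD(5,6)[OF Q, of r] r unfolding dist_commute[of x "c0 (bm x)"]
    by (simp flip: distrib_right)
  show "\<exists>l. vertical_line Z bm l \<and> l (bm x) = x" by (rule line_through[OF x])
next
  fix x y assume x: "x \<in> Z" "y \<in> Z" "bm x = bm y"
  obtain Q where Q: "geodesic_from X (c0 (bm x)) (c1 (bm x)) Q" using level_geodesic_ex by blast
  obtain r where r: "r \<in> {0..1}" "x = Q r" using level_geodesic[OF Q x(1) refl] by blast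
  obtain s where s: "s \<in> {0..1}" "y = Q s" using level_geodesic[OF Q x(2)] x(3) by auto
  define w where "w = dist (c0 (bm x)) (c1 (bm x))"
  have "dist x y = \<bar>r - s\<bar> * w" "dist x (c0 (bm x)) = r * w" "dist y (c0 (bm x)) = s * w"
    using geodesic_fromD(4)[OF Q, of r s] geodesic_fromD(5)[OF Q, of r] geodesic_fromD(5)[OF Q, of s] r s
    by (simp_all add: w_def dist_commute)
  moreover have "\<bar>r * w - s * w\<bar> = \<bar>r - s\<bar> * w" by (simp add: w_def abs_mult flip: left_diff_distrib)
  ultimately show "dist x y = \<bar>dist x (c0 (bm x)) - dist y (c0 (bm x))\<bar>" by simp
next
  fix h t :: real assume h: "0 \<le> h" "h \<le> dist (c0 t) (c1 t)"
  obtain Q where Q: "geodesic_from X (c0 t) (c1 t) Q" using level_geodesic_ex by blast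
  have "dist (c0 t) (c1 t) > 0" using c01 by simp
  then have r: "0 \<le> h / dist (c0 t) (c1 t)" "h / dist (c0 t) (c1 t) \<le> 1" "h / dist (c0 t) (c1 t) * dist (c0 t) (c1 t) = h"
    using h by auto
  have "Q (h / dist (c0 t) (c1 t)) \<in> {z \<in> Z. bm z = t}" unfolding level_set_eq[OF Q] using r(1,2) by simp
  then show "\<exists>x\<in>Z. bm x = t \<and> dist x (c0 t) = h"
    using geodesic_fromD(5)[OF Q r(1,2)] r
    by (intro bexI[of _ "Q (h / dist (c0 t) (c1 t))"]) (auto simp: dist_commute)
qed

lemma closedin_Z: "closedin (top_of_set X) Z"
proof -
  have "1-lipschitz_on X bp" "1-lipschitz_on X bm"
    by (rule lipschitz_onI; simp add: dist_real_def bp_lip bm_lip)+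
  then have "continuous_on X (\<lambda>x. bp x + bm x)" by (intro continuous_intros lipschitz_on_continuous_on)
  from continuous_closedin_preimage[OF this, of "{0}"] show ?thesis
    by (simp add: Z_def vimage_def Int_def)
qed

end

section \<open>Alignment of the lines and conclusion\<close>

text \<open>\<open>busemann_pair\<close> leaves one constant, the relative offset of the two
  parametrizations; shifting the parameter of \<open>c1\<close> by it removes it at both ends
  simultaneously.\<close>

lemma busemann_alignment:
  assumes ptol: "ptolemaic X" and c0: "geodesic_line X c0" and c1: "geodesic_line X c1" and par: "parallel_lines c0 c1"
  obtains \<delta> where "\<And>t. (\<lambda>n. dist (c1 (t - \<delta>)) (c0 (real n)) - real n) \<longlonglongrightarrow> - t"
    "\<And>t. (\<lambda>n. dist (c1 (t - \<delta>)) (c0 (- real n)) - real n) \<longlonglongrightarrow> t"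
proof -
  have c0D: "c0 t \<in> X" "dist (c0 s) (c0 t) = \<bar>s - t\<bar>" and c1D: "c1 t \<in> X" "dist (c1 s) (c1 t) = \<bar>s - t\<bar>" for s t
    using c0 c1 by (auto simp: geodesic_line_def)
  have half: "2 * dist (c ((s + t) / 2)) q \<le> dist (c s) q + dist (c t) q" if "geodesic_line X c" "q \<in> X" for c q s t
  proof -
    have D: "c t \<in> X" "dist (c s) (c t) = \<bar>s - t\<bar>" for s t using that(1) by (auto simp: geodesic_line_def)
    have "dist (c ((s + t) / 2)) q \<le> (1 - 1/2) * dist (c s) q + 1/2 * dist (c t) q"
      by (rule ptolemaic_convex[OF ptol D(1) D(1) D(1) that(2)]) (auto simp: D abs_if field_simps)
    then show ?thesis by simp
  qed
  interpret parallel_pair "\<lambda>t s. dist (c0 t) (c1 s)"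
  proof
    fix t s t' s'
    have "\<bar>dist (c0 t) (c1 s) - dist (c0 t') (c1 s)\<bar> \<le> dist (c0 t) (c0 t')" by metric
    then show "\<bar>dist (c0 t) (c1 s) - dist (c0 t') (c1 s)\<bar> \<le> \<bar>t - t'\<bar>" by (simp add: c0D)
    have "\<bar>dist (c0 t) (c1 s) - dist (c0 t) (c1 s')\<bar> \<le> dist (c1 s) (c1 s')" by metric
    then show "\<bar>dist (c0 t) (c1 s) - dist (c0 t) (c1 s')\<bar> \<le> \<bar>s - s'\<bar>" by (simp add: c1D)
    have "dist (c0 t) (c0 t') \<le> dist (c0 t) (c1 s) + dist (c0 t') (c1 s)" by metric
    then show "\<bar>t - t'\<bar> \<le> dist (c0 t) (c1 s) + dist (c0 t') (c1 s)" by (simp add: c0D)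
    have "dist (c1 s) (c1 s') \<le> dist (c0 t) (c1 s) + dist (c0 t) (c1 s')" by metric
    then show "\<bar>s - s'\<bar> \<le> dist (c0 t) (c1 s) + dist (c0 t) (c1 s')" by (simp add: c1D)
    show "2 * dist (c0 ((t + t') / 2)) (c1 s) \<le> dist (c0 t) (c1 s) + dist (c0 t') (c1 s)"
      by (rule half[OF c0 c1D(1)])
    show "2 * dist (c0 t) (c1 ((s + s') / 2)) \<le> dist (c0 t) (c1 s) + dist (c0 t) (c1 s')"
      using half[OF c1 c0D(1), of s s' t] by (simp add: dist_commute)
    have "dist (c0 t) (c1 s') * dist (c0 t') (c1 s) \<le> dist (c0 t) (c0 t') * dist (c1 s') (c1 s) + dist (c0 t) (c1 s) * dist (c1 s') (c0 t')"
      using ptol c0D(1) c1D(1) unfolding ptolemaic_def by blast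
    then show "dist (c0 t) (c1 s') * dist (c0 t') (c1 s) \<le> \<bar>t - t'\<bar> * \<bar>s - s'\<bar> + dist (c0 t) (c1 s) * dist (c0 t') (c1 s')"
      by (simp add: c0D c1D dist_commute abs_minus_commute)
  next
    have "((\<lambda>t. 1 / t * dist (c0 t) (c1 t)) \<longlongrightarrow> 0) at_top" using par by (simp add: parallel_lines_def)
    from filterlim_compose[OF this filterlim_real_sequentially]
    show "(\<lambda>n. dist (c0 (real n)) (c1 (real n)) / real n) \<longlonglongrightarrow> 0" by simp
    have "((\<lambda>t. 1 / t * dist (c0 t) (c1 t)) \<longlongrightarrow> 0) at_bot" using par by (simp add: parallel_lines_def)
    moreover have "filterlim (\<lambda>n. - real n) at_bot sequentially" by real_asymp
    ultimately have "(\<lambda>n. 1 / (- real n) * dist (c0 (- real n)) (c1 (- real n))) \<longlonglongrightarrow> 0"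
      by (rule filterlim_compose)
    \<comment> \<open>Towards \<open>at_bot\<close> the factor \<open>1 / t\<close> is negative,
      hence the change of sign.\<close>
    from tendsto_minus[OF this]
    show "(\<lambda>n. dist (c0 (- real n)) (c1 (- real n)) / real n) \<longlonglongrightarrow> 0" by simp
  qed
  show thesis
  proof (rule busemann_pair)
    fix \<delta>
    assume "\<And>t. (\<lambda>n. dist (c0 t) (c1 (real n)) - real n) \<longlonglongrightarrow> \<delta> - t"
      "\<And>t. (\<lambda>n. dist (c0 t) (c1 (- real n)) - real n) \<longlonglongrightarrow> t - \<delta>"
      and p: "\<And>s. (\<lambda>n. dist (c0 (real n)) (c1 s) - real n) \<longlonglongrightarrow> - \<delta> - s"
      and m: "\<And>s. (\<lambda>n. dist (c0 (- real n)) (c1 s) - real n) \<longlonglongrightarrow> s + \<delta>"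
    show thesis
      by (rule that[of \<delta>]) (use p[of "_ - \<delta>"] m[of "_ - \<delta>"] in \<open>simp_all add: dist_commute\<close>)
  qed
qed

theorem theorem1p1:
  fixes X :: "'a::metric_space set"
    and h :: "real \<times> real \<Rightarrow> 'a" and k :: "'a \<Rightarrow> real \<times> real"
    and c0 c1 :: "real \<Rightarrow> 'a"
  assumes "geodesic_space X"
    and "ptolemaic X"
    and "homeomorphism (UNIV \<times> {0..1}) X h k"
    and "geodesic_line X c0" and "geodesic_line X c1"
    and "range c0 = h ` (UNIV \<times> {0})" and "range c1 = h ` (UNIV \<times> {1})"
    and "parallel_lines c0 c1"
  shows "\<exists>a>0. isometric X (flat_strip a)"
proof -
  obtain \<delta> where \<delta>: "\<And>t. (\<lambda>n. dist (c1 (t - \<delta>)) (c0 (real n)) - real n) \<longlonglongrightarrow> - t"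
    "\<And>t. (\<lambda>n. dist (c1 (t - \<delta>)) (c0 (- real n)) - real n) \<longlonglongrightarrow> t"
    using busemann_alignment[OF assms(2,4,5,8)] by blast
  define c1' where "c1' t = c1 (t - \<delta>)" for t
  have line: "geodesic_line X c1'" using assms(5) by (auto simp: geodesic_line_def c1'_def)
  have range: "range c1' = h ` (UNIV \<times> {1})"
  proof -
    have "c1 t \<in> range c1'" for t by (rule range_eqI[of _ _ "t + \<delta>"]) (simp add: c1'_def)
    then have "range c1' = range c1" by (auto simp: c1'_def)
    with assms(7) show ?thesis by simp
  qed
  have kh: "k (h v) = v" if "v \<in> UNIV \<times> {0..1}" for v using assms(3) that by (auto simp: homeomorphism_def)
  have ends: "c0 t \<in> h ` (UNIV \<times> {0})" "c1' t \<in> h ` (UNIV \<times> {1})" for t using assms(6) range by auto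
  interpret aligned_pair X c0 c1'
  proof
    show "c0 t \<noteq> c1' t" for t
    proof
      assume eq: "c0 t = c1' t"
      obtain r s where "c0 t = h (r, 0)" "c1' t = h (s, 1)" using ends[of t] by auto
      then have "k (h (r, 0)) = k (h (s, 1))" using eq by simp
      then show False by (simp add: kh)
    qed
  next
    fix T t P Q
    assume *: "T > 0" "path P" "path_image P \<subseteq> X" "pathstart P = c0 (- T)" "pathfinish P = c0 T"
      "path Q" "path_image Q \<subseteq> X" "pathstart Q = c0 t" "pathfinish Q = c1' t"
    show "\<exists>x\<in>path_image Q. x \<in> path_image P \<or> (\<exists>s. T \<le> \<bar>s\<bar> \<and> x = c0 s)"
      by (rule strip_crossing[OF assms(3,4,6) *(2-5,1,6,7)]) (use * ends in auto)
  qed (use assms(1,2,4) line \<delta> in \<open>simp_all add: c1'_def\<close>)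
  have "Z = X"
  proof (rule strip_exhausts[OF assms(3) _ closedin_Z w_pos[of 0] bij_flat_strip euclidean assms(6) _ range])
    show "Z \<subseteq> X" by (auto dest: Z_X)
    show "c0 t \<in> Z \<and> (bm (c0 t), y (c0 t)) = (t, 0)" for t using c0Z by (simp add: y_def)
    show "c1' t \<in> Z \<and> (bm (c1' t), y (c1' t)) = (t, w 0)" for t
      using c1Z w_const[of t 0] by (simp add: y_def w_def dist_commute)
  qed auto
  then show ?thesis using isometric_flat_strip w_pos[of 0] by auto
qed

end
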